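(* Let $\Omega\subseteq\mathbb{R}^N$ be a bounded open set with $C^1$ boundary and let $s\in(0,1)$. Given $f\in L^2(\Omega)$, there exists a unique weak solution $u_f\in H^1(\mathbb{R}^N)$ of $$\begin{cases}\mathcal{L}u=f & \text{in }\Omega,\\ u\big|_{\mathbb{R}^N\setminus\Omega}=0.\end{cases}$$ Furthermore, there exists a constant $\mathbf{c}>0$ such that $$\|u_f\|_{H^1(\mathbb{R}^N)}\le \mathbf{c}\,\|f\|_{L^2(\Omega)}.$$
   Context: $\mathcal{L}:=-\Delta+(-\Delta)^s$, where $(-\Delta)^s u(x)=c_{N,s}\,\mathrm{P.V.}\int_{\mathbb{R}^N}\frac{u(x)-u(y)}{|x-y|^{N+2s}}\,dy$ and $c_{N,s}=\Big(\int_{\mathbb{R}^N}\frac{1-\cos(\zeta_1)}{|\zeta|^{N+2s}}\,d\zeta\Big)^{-1}$. $\mathbb{X}(\Omega):=\{u\in H^1(\mathbb{R}^N): u\equiv 0 \text{ a.e. in }\mathbb{R}^N\setminus\Omega\}$. For $f\in L^2(\Omega)$, a function $u\in H^1(\mathbb{R}^N)$ is a weak solution of the equation $\mathcal{L}u=f$ in $\Omega$ if for every $\varphi\in C_0^\infty(\Omega,\mathbb{R})$ $$\int_\Omega\langle\nabla u,\nabla\varphi\rangle\,dx+\frac{c_{N,s}}{2}\int_{\mathbb{R}^N\times\mathbb{R}^N}\frac{(u(x)-u(y))(\varphi(x)-\varphi(y))}{|x-y|^{N+2s}}\,dx\,dy=\int_\Omega f\varphi\,dx.$$ If in addition $u\in\mathbb{X}(\Omega)$,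 then $u$ is called a weak solution of the problem $\mathcal{L}u=f$ in $\Omega$, $u|_{\mathbb{R}^N\setminus\Omega}=0$. *)

theory Defs
  imports "HOL-Analysis.Analysis"
begin

subsection \<open>Classical derivatives, test functions, \<open>C\<^sup>1\<close> boundaries\<close>

definition pderivative :: "'n::finite \<Rightarrow> (real^'n \<Rightarrow> real) \<Rightarrow> real^'n \<Rightarrow> real" where
  "pderivative i g x = frechet_derivative g (at x) (axis i 1)"

definition gradient :: "(real^'n::finite \<Rightarrow> real) \<Rightarrow> real^'n \<Rightarrow> real^'n" where
  "gradient g x = (\<chi> i. pderivative i g x)"

primrec C_k :: "nat \<Rightarrow> (real^'n::finite \<Rightarrow> real) \<Rightarrow> bool" where
  "C_k 0 g \<longleftrightarrow> continuous_on UNIV g"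
| "C_k (Suc k) g \<longleftrightarrow> (\<forall>x. g differentiable (at x)) \<and> (\<forall>i. C_k k (pderivative i g))"

text \<open>\<open>C\<^sub>0\<^sup>\<infinity>(\<Omega>, \<real>)\<close>; its elements are taken to be extended by zero to all of \<open>\<real>\<^sup>N\<close>.\<close>
definition test_functions :: "(real^'n::finite) set \<Rightarrow> (real^'n \<Rightarrow> real) set" where
  "test_functions \<Omega> = {\<phi>. (\<forall>k. C_k k \<phi>) \<and>
     compact (closure {x. \<phi> x \<noteq> 0}) \<and> closure {x. \<phi> x \<noteq> 0} \<subseteq> \<Omega>}"

text \<open>Near every boundary point, \<open>\<Omega>\<close> is the region strictly above the graph of a \<open>C\<^sup>1\<close> function
  in some direction \<open>\<nu>\<close>. The function \<open>\<gamma>\<close> of \<open>N - 1\<close> variables is evaluated only on the hyperplane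
  orthogonal to \<open>\<nu>\<close>, onto which \<open>y - (y \<bullet> \<nu>) *\<^sub>R \<nu>\<close> is the orthogonal projection of \<open>y\<close>.\<close>
definition C1_boundary :: "(real^'n::finite) set \<Rightarrow> bool" where
  "C1_boundary \<Omega> \<longleftrightarrow> (\<forall>p \<in> frontier \<Omega>. \<exists>r>0. \<exists>\<nu> \<gamma>. norm \<nu> = 1 \<and> C_k 1 \<gamma> \<and>
     \<Omega> \<inter> ball p r = {y \<in> ball p r. \<gamma> (y - (y \<bullet> \<nu>) *\<^sub>R \<nu>) < y \<bullet> \<nu>})"

subsection \<open>Lebesgue and Sobolev spaces\<close>

text \<open>Elements are functions rather than equivalence classes modulo null sets.\<close>

definition L2 :: "'a measure \<Rightarrow> ('a \<Rightarrow> 'b::real_normed_vector) set" where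
  "L2 M = {f \<in> borel_measurable M. integrable M (\<lambda>x. (norm (f x))\<^sup>2)}"

definition L2_norm :: "'a measure \<Rightarrow> ('a \<Rightarrow> 'b::real_normed_vector) \<Rightarrow> real" where
  "L2_norm M f = sqrt (\<integral>x. (norm (f x))\<^sup>2 \<partial>M)"

definition has_weak_gradient :: "(real^'n::finite \<Rightarrow> real) \<Rightarrow> (real^'n \<Rightarrow> real^'n) \<Rightarrow> bool" where
  "has_weak_gradient u g \<longleftrightarrow>
     (\<forall>K. compact K \<longrightarrow> u absolutely_integrable_on K \<and> g absolutely_integrable_on K) \<and>
     (\<forall>\<phi> \<in> test_functions UNIV. \<forall>i.
        (\<integral>x. u x * pderivative i \<phi> x \<partial>lebesgue) = - (\<integral>x. g x $ i * \<phi> x \<partial>lebesgue))"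

text \<open>Determined up to a null set.\<close>
definition weak_gradient :: "(real^'n::finite \<Rightarrow> real) \<Rightarrow> real^'n \<Rightarrow> real^'n" where
  "weak_gradient u = (SOME g. has_weak_gradient u g)"

definition H1 :: "(real^'n::finite \<Rightarrow> real) set" where
  "H1 = {u \<in> L2 lebesgue. \<exists>g \<in> L2 lebesgue. has_weak_gradient u g}"

definition H1_norm :: "(real^'n::finite \<Rightarrow> real) \<Rightarrow> real" where
  "H1_norm u = sqrt ((L2_norm lebesgue u)\<^sup>2 + (L2_norm lebesgue (weak_gradient u))\<^sup>2)"

definition X_space :: "(real^'n::finite) set \<Rightarrow> (real^'n \<Rightarrow> real) set" where
  "X_space \<Omega> = {u \<in> H1. AE x in lebesgue. x \<notin> \<Omega> \<longrightarrow> u x = 0}"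

subsection \<open>Weak solutions for \<open>\<L> = -\<Delta> + (-\<Delta>)\<^sup>s\<close>\<close>

text \<open>The first index in a numbering of \<open>'n\<close>; which one it is does not affect the constant below,
  as Lebesgue measure and the norm are invariant under permutations of the coordinates.\<close>
definition first_index :: "'n::finite" where
  "first_index = from_nat_into UNIV 0"

definition c_Ns :: "'n::finite itself \<Rightarrow> real \<Rightarrow> real" where
  "c_Ns _ s = inverse (\<integral>\<zeta>. (1 - cos (\<zeta> $ first_index)) /
      norm \<zeta> powr (real CARD('n) + 2 * s) \<partial>(lebesgue :: (real^'n) measure))"

text \<open>The double integral is a Lebesgue integral over \<open>\<real>\<^sup>N \<times> \<real>\<^sup>N\<close>; on the diagonal, a null set,
  the integrand is 0.\<close>
definition weak_form :: "real \<Rightarrow> (real^'n::finite) set \<Rightarrow> (real^'n \<Rightarrow> real) \<Rightarrow> (real^'n \<Rightarrow> real) \<Rightarrow> real" where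
  "weak_form s \<Omega> u \<phi> =
     (\<integral>x. weak_gradient u x \<bullet> gradient \<phi> x \<partial>(lebesgue_on \<Omega>)) +
     c_Ns TYPE('n) s / 2 *
       (\<integral>z. (case z of (x, y) \<Rightarrow>
            (u x - u y) * (\<phi> x - \<phi> y) / norm (x - y) powr (real CARD('n) + 2 * s))
          \<partial>(lebesgue :: ((real^'n) \<times> (real^'n)) measure))"

definition weak_solution_eq ::
  "real \<Rightarrow> (real^'n::finite) set \<Rightarrow> (real^'n \<Rightarrow> real) \<Rightarrow> (real^'n \<Rightarrow> real) \<Rightarrow> bool" where
  "weak_solution_eq s \<Omega> f u \<longleftrightarrow> u \<in> H1 \<and>
     (\<forall>\<phi> \<in> test_functions \<Omega>. weak_form s \<Omega> u \<phi> = (\<integral>x. f x * \<phi> x \<partial>(lebesgue_on \<Omega>)))"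

definition weak_solution ::
  "real \<Rightarrow> (real^'n::finite) set \<Rightarrow> (real^'n \<Rightarrow> real) \<Rightarrow> (real^'n \<Rightarrow> real) \<Rightarrow> bool" where
  "weak_solution s \<Omega> f u \<longleftrightarrow> weak_solution_eq s \<Omega> f u \<and> u \<in> X_space \<Omega>"

end

theory Submission
  imports Defs
begin

text \<open>The energy form \<open>energy s\<close> (Dirichlet form plus \<open>c/2\<close> times the Gagliardo form) is a scalar product
  on \<open>\<X>(\<Omega>)\<close>: the Gagliardo seminorm is dominated by the \<open>H\<^sup>1\<close> norm, because
  \<open>\<parallel>u(\<cdot> + h) - u\<parallel> \<le> min (|h| \<parallel>\<nabla>u\<parallel>) (2 \<parallel>u\<parallel>)\<close> and \<open>min |h|\<^sup>2 1 / |h|\<^bsup>N+2s\<^esup>\<close> is integrable,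
  and the same translation estimate, with \<open>h\<close> longer than the diameter of \<open>\<Omega>\<close>, is a Poincare inequality.
  So \<open>\<X>(\<Omega>)\<close> is complete for the energy and the Riesz representation theorem gives a solution tested against
  all of \<open>\<X>(\<Omega>)\<close>. Uniqueness and the estimate for arbitrary weak solutions need that test functions
  are dense in \<open>\<X>(\<Omega>)\<close>; this is where the boundary regularity enters: near the boundary a function is
  pushed into \<open>\<Omega>\<close> along the graph direction and then mollified.\<close>

subsection \<open>Semi-inner product spaces of functions and \<open>L\<^sup>2\<close>\<close>

text \<open>The spaces consist of functions rather than classes, and \<open>weak_gradient\<close> is
  a choice that is linear only almost everywhere. So the forms are merely semidefinite, and the
  linearity of the energy holds because integrals ignore null sets. The minimisation argument serves
  twice: with the whole of X(\<Omega>) for existence, and with the test functions inside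
  \<open>L2\<close> for their density there, where the fundamental lemma supplies the trivial
  orthogonal complement. The second use avoids a circle: mollifiers converge in \<open>L2\<close> by
  continuity of translations, and that continuity is deduced from the density. For the same reason
  the translation estimate in \<open>H1\<close> is proved by duality: paired with a test function, a
  translate of \<open>u\<close> becomes a value of a smooth convolution, so no approximation of
  \<open>u\<close> in \<open>H1\<close> is involved. A further obstacle is measurability. The
  definitions use the completed Lebesgue measure, whereas Tonelli is applied to functions of two
  variables on Borel products; square integrable functions are therefore replaced by Borel
  representatives whenever the order of integration is exchanged.\<close>

abbreviation (input) diag :: "('a \<Rightarrow> 'a \<Rightarrow> 'b) \<Rightarrow> 'a \<Rightarrow> 'b" where
  "diag B u \<equiv> B u u"

text \<open>The carrier is a set of functions because \<open>L2\<close>, \<open>H1\<close> and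
  \<open>X_space\<close> are such sets. Definiteness is not demanded: a function that vanishes
  almost everywhere has form 0. The single combination \<open>u + c v\<close> covers sums,
  differences and multiples.\<close>

locale semi_inner_space =
  fixes V :: "('a \<Rightarrow> 'b::real_vector) set" and B :: "('a \<Rightarrow> 'b) \<Rightarrow> ('a \<Rightarrow> 'b) \<Rightarrow> real"
  assumes zero_mem: "(\<lambda>_. 0) \<in> V"
    and add_scaleR_mem: "u \<in> V \<Longrightarrow> v \<in> V \<Longrightarrow> (\<lambda>x. u x + c *\<^sub>R v x) \<in> V"
    and form_add_scaleR: "u \<in> V \<Longrightarrow> v \<in> V \<Longrightarrow> w \<in> V \<Longrightarrow>
      B (\<lambda>x. u x + c *\<^sub>R v x) w = B u w + c * B v w"
    and form_sym: "u \<in> V \<Longrightarrow> v \<in> V \<Longrightarrow> B u v = B v u"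
    and form_nonneg: "u \<in> V \<Longrightarrow> 0 \<le> B u u"
begin

lemma diff_mem: "u \<in> V \<Longrightarrow> v \<in> V \<Longrightarrow> (\<lambda>x. u x - v x) \<in> V"
  using add_scaleR_mem[of u v "-1"] by simp

lemma scaleR_mem: "u \<in> V \<Longrightarrow> (\<lambda>x. c *\<^sub>R u x) \<in> V"
  using add_scaleR_mem[OF zero_mem, of u c] by simp

lemma add_mem: "u \<in> V \<Longrightarrow> v \<in> V \<Longrightarrow> (\<lambda>x. u x + v x) \<in> V"
  using add_scaleR_mem[of u v 1] by simp

lemma form_diff: "u \<in> V \<Longrightarrow> v \<in> V \<Longrightarrow> w \<in> V \<Longrightarrow> B (\<lambda>x. u x - v x) w = B u w - B v w"
  using form_add_scaleR[of u v w "-1"] by simp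

lemma form_square_add_scaleR:
  assumes "u \<in> V" "v \<in> V"
  shows "diag B (\<lambda>x. u x + c *\<^sub>R v x) = B u u + 2 * c * B u v + c\<^sup>2 * B v v"
  using assms by (simp add: form_add_scaleR add_scaleR_mem form_sym[of _ "\<lambda>x. u x + c *\<^sub>R v x"]
      form_sym[of v u] power2_eq_square algebra_simps)

lemma form_square_diff:
  assumes "u \<in> V" "v \<in> V"
  shows "diag B (\<lambda>x. u x - v x) = B u u - 2 * B u v + B v v"
  using form_square_add_scaleR[OF assms, of "-1"] by simp

lemma form_square_diff_commute:
  assumes "u \<in> V" "v \<in> V"
  shows "diag B (\<lambda>x. u x - v x) = diag B (\<lambda>x. v x - u x)"
  using assms by (simp add: form_square_diff form_sym[of v u])

text \<open>The quadratic polynomial \<open>B u u + 2 c B u v + c^2 B v v\<close> in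
  \<open>c\<close> is nonnegative. As the form is only semidefinite, the degenerate case
  \<open>B v v = 0\<close> is separate.\<close>

lemma Cauchy_Schwarz_square:
  assumes "u \<in> V" "v \<in> V"
  shows "(B u v)\<^sup>2 \<le> B u u * B v v"
proof -
  have *: "0 \<le> B u u + 2 * c * B u v + c\<^sup>2 * B v v" for c
    using form_nonneg[OF add_scaleR_mem[OF assms, of c]] form_square_add_scaleR[OF assms, of c] by simp
  show ?thesis
  proof (cases "B v v = 0")
    case True
    \<comment> \<open>Here the polynomial is affine in \<open>c\<close>; with a nonzero slope it
      would take the value -1 at the chosen \<open>c\<close>.\<close>
    have "B u v = 0"
    proof (rule ccontr)
      assume "B u v \<noteq> 0"
      then show False
        using *[of "- (B u u + 1) / (2 * B u v)"] True by (simp add: field_simps)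
    qed
    then show ?thesis using True by simp
  next
    case False
    then have pos: "B v v > 0" using form_nonneg[OF assms(2)] by simp
    have "0 \<le> B u u - (B u v)\<^sup>2 / B v v"
      using *[of "- B u v / B v v"] pos by (simp add: power2_eq_square field_simps)
    then show ?thesis using pos by (simp add: field_simps)
  qed
qed

lemma Cauchy_Schwarz:
  assumes "u \<in> V" "v \<in> V"
  shows "\<bar>B u v\<bar> \<le> sqrt (B u u) * sqrt (B v v)"
  using real_sqrt_le_mono[OF Cauchy_Schwarz_square[OF assms]] by (simp add: real_sqrt_mult)

lemma triangle_add_scaleR:
  assumes "u \<in> V" "v \<in> V"
  shows "sqrt (diag B (\<lambda>x. u x + c *\<^sub>R v x)) \<le> sqrt (B u u) + \<bar>c\<bar> * sqrt (B v v)"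
proof (rule real_le_lsqrt)
  have "c * B u v \<le> \<bar>c\<bar> * (sqrt (B u u) * sqrt (B v v))"
    using mult_left_mono[OF Cauchy_Schwarz[OF assms], of "\<bar>c\<bar>"] abs_ge_self[of "c * B u v"]
    by (simp add: abs_mult)
  then show "diag B (\<lambda>x. u x + c *\<^sub>R v x) \<le> (sqrt (B u u) + \<bar>c\<bar> * sqrt (B v v))\<^sup>2"
    using assms by (simp add: form_square_add_scaleR power2_sum power_mult_distrib form_nonneg mult_ac)
qed (use assms form_nonneg in auto)

lemma triangle_diff:
  assumes "u \<in> V" "v \<in> V" "w \<in> V"
  shows "sqrt (diag B (\<lambda>x. u x - w x))
    \<le> sqrt (diag B (\<lambda>x. u x - v x)) + sqrt (diag B (\<lambda>x. v x - w x))"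
  using triangle_add_scaleR[OF diff_mem[OF assms(1,2)] diff_mem[OF assms(2,3)], of 1] by simp

text \<open>A predicate and not a locale axiom, since completeness is proved separately for each
  space, and for the energy it rests on the boundedness of \<Omega>. Limits are unique only up to
  form 0.\<close>

definition complete_form :: bool where
  "complete_form \<longleftrightarrow> (\<forall>X. (\<forall>n. X n \<in> V) \<longrightarrow>
     (\<forall>e>0. \<exists>M. \<forall>m\<ge>M. \<forall>n\<ge>M. diag B (\<lambda>x. X m x - X n x) < e) \<longrightarrow>
     (\<exists>u\<in>V. (\<lambda>n. diag B (\<lambda>x. X n x - u x)) \<longlonglongrightarrow> 0))"

text \<open>A minimising sequence of \<open>B v v - 2 l v\<close> on \<open>D\<close> is Cauchy by the parallelogram law.\<close>
lemma Riesz_subspace: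
  assumes complete: complete_form
    and D: "D \<subseteq> V" "(\<lambda>_. 0) \<in> D" "\<And>u v c. u \<in> D \<Longrightarrow> v \<in> D \<Longrightarrow> (\<lambda>x. u x + c *\<^sub>R v x) \<in> D"
    and l: "\<And>u v c. u \<in> V \<Longrightarrow> v \<in> V \<Longrightarrow> l (\<lambda>x. u x + c *\<^sub>R v x) = l u + c * l v"
    and l_le: "\<And>u. u \<in> V \<Longrightarrow> \<bar>l u\<bar> \<le> C * sqrt (B u u)"
  obtains X u where "\<And>n. X n \<in> D" "u \<in> V" "(\<lambda>n. diag B (\<lambda>x. X n x - u x)) \<longlonglongrightarrow> 0"
    "\<And>v. v \<in> D \<Longrightarrow> B u v = l v"
proof -
  define J where "J v = B v v - 2 * l v" for v
  have DV: "v \<in> V" if "v \<in> D" for v using D that by auto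
  have J_ge: "J v \<ge> - C\<^sup>2" if "v \<in> V" for v
  proof -
    \<comment> \<open>Completing the square: \<open>J v\<close> is at least
      \<open>B v v - 2 C sqrt (B v v)\<close>.\<close>
    have "0 \<le> (sqrt (B v v) - C)\<^sup>2" by simp
    then show ?thesis
      using l_le[OF that] form_nonneg[OF that] unfolding J_def by (simp add: power2_diff algebra_simps)
  qed
  have bdd: "bdd_below (J ` D)"
    using J_ge DV by (intro bdd_belowI2[of _ "- C\<^sup>2"]) auto
  define m where "m = Inf (J ` D)"
  have m_le: "m \<le> J v" if "v \<in> D" for v
    unfolding m_def by (rule cInf_lower[OF _ bdd]) (use that in auto)
  have "\<exists>v\<in>D. J v < m + 1 / (real n + 1)" for n
    using cInf_lessD[of "J ` D" "m + 1 / (real n + 1)"] D(2) unfolding m_def by auto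
  then obtain X where X: "\<And>n. X n \<in> D" "\<And>n. J (X n) < m + 1 / (real n + 1)"
    by metis
  note XV = DV[OF X(1)]
  have J_add: "J (\<lambda>x. u x + c *\<^sub>R v x) = J u + 2 * c * (B u v - l v) + c\<^sup>2 * B v v"
    if "u \<in> V" "v \<in> V" for u v c
    using that unfolding J_def by (simp add: form_square_add_scaleR l algebra_simps)
  \<comment> \<open>The midpoint of \<open>X i\<close> and \<open>X j\<close> lies in
    \<open>D\<close>, so its value is at least \<open>m\<close>. Eliminating the linear term between
    the expansions of \<open>J\<close> at the midpoint and at \<open>X i\<close> bounds the distance
    by the excess of \<open>J (X i)\<close> and \<open>J (X j)\<close> over
    \<open>m\<close>.\<close>
  have Cauchy_le: "diag B (\<lambda>x. X i x - X j x) \<le> 2 / (real i + 1) + 2 / (real j + 1)" for i j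
  proof -
    define mid where "mid = (\<lambda>x. X j x + (1/2) *\<^sub>R (X i x - X j x))"
    define d where "d = (\<lambda>x. X i x - X j x)"
    have d: "d \<in> V" unfolding d_def using XV diff_mem by auto
    have "d = (\<lambda>x. X i x + (-1) *\<^sub>R X j x)" unfolding d_def by auto
    then have "(\<lambda>x. X j x + (1/2) *\<^sub>R d x) = (\<lambda>x. (X j x + (1/2) *\<^sub>R X i x) + (-1/2) *\<^sub>R X j x)" (is "_ = ?rhs")
      by (auto simp: d_def fun_eq_iff algebra_simps simp flip: scaleR_add_left)
    moreover have "?rhs \<in> D" by (intro D(3) X(1))
    ultimately have "(\<lambda>x. X j x + (1/2) *\<^sub>R d x) \<in> D" by simp
    then have "m \<le> J (\<lambda>x. X j x + (1/2) *\<^sub>R d x)" by (rule m_le)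
    also have "\<dots> = J (X j) + (B (X j) d - l d) + 1/4 * B d d"
      by (subst J_add[OF XV d]) (simp add: power2_eq_square)
    finally have 1: "m \<le> J (X j) + (B (X j) d - l d) + 1/4 * B d d" .
    have "J (X i) = J (\<lambda>x. X j x + 1 *\<^sub>R d x)" by (simp add: d_def)
    also have "\<dots> = J (X j) + 2 * (B (X j) d - l d) + B d d"
      by (subst J_add[OF XV d]) simp
    finally have 2: "J (X i) = J (X j) + 2 * (B (X j) d - l d) + B d d" .
    have "B d d \<le> 2 * J (X i) + 2 * J (X j) - 4 * m"
      using 1 unfolding 2 by (simp add: field_simps)
    then show ?thesis using X(2)[of i] X(2)[of j] unfolding d_def by linarith
  qed
  have "\<exists>M. \<forall>i\<ge>M. \<forall>j\<ge>M. diag B (\<lambda>x. X i x - X j x) < e" if e: "e > 0" for e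
  proof -
    obtain M where M: "1 / real (Suc M) < e / 4"
      using e by (auto intro: nat_approx_posE[of "e/4"])
    have le: "2 / (real i + 1) < e / 2" if "i \<ge> M" for i
    proof -
      have "2 / (real i + 1) \<le> 2 / real (Suc M)" using that by (intro divide_left_mono) auto
      also have "\<dots> < e / 2" using M by (simp add: field_simps)
      finally show ?thesis .
    qed
    show ?thesis
    proof (intro exI[of _ M] allI impI)
      fix i j assume "i \<ge> M" "j \<ge> M"
      then show "diag B (\<lambda>x. X i x - X j x) < e"
        using Cauchy_le[of i j] le[of i] le[of j] by linarith
    qed
  qed
  then obtain u where u: "u \<in> V" "(\<lambda>n. diag B (\<lambda>x. X n x - u x)) \<longlonglongrightarrow> 0"
    using complete[unfolded complete_form_def, rule_format, of X] XV by blast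
  have "B u v = l v" if v: "v \<in> D" for v
  proof -
    define d where "d n = (\<lambda>x. u x - X n x)" for n
    have dV: "d n \<in> V" for n unfolding d_def using u XV diff_mem by auto
    have lim: "(\<lambda>n. sqrt (B (d n) (d n))) \<longlonglongrightarrow> 0"
      using tendsto_real_sqrt[OF u(2)] form_square_diff_commute[OF u(1) XV] unfolding d_def by simp
    \<comment> \<open>The limit \<open>u\<close> need not lie in \<open>D\<close>, so minimality is
      used at \<open>X n + t v\<close>; the error terms contain the norm of \<open>d n\<close> and
      disappear in the limit.\<close>
    have ineq: "0 \<le> 2 * t * (B u v - l v) + t\<^sup>2 * B v v" for t
    proof (rule LIMSEQ_le_const)
      let ?f = "\<lambda>n. 2 * \<bar>t\<bar> * (sqrt (B (d n) (d n)) * sqrt (B v v) + C * sqrt (B (d n) (d n)))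
          + 2 * t * (B u v - l v) + t\<^sup>2 * B v v + 1 / (real n + 1)"
      show "?f \<longlonglongrightarrow> 2 * t * (B u v - l v) + t\<^sup>2 * B v v"
      proof -
        have "(\<lambda>n. 1 / (real n + 1)) \<longlonglongrightarrow> 0"
          using LIMSEQ_inverse_real_of_nat by (simp add: inverse_eq_divide add.commute)
        then have "?f \<longlonglongrightarrow> 2 * \<bar>t\<bar> * (0 * sqrt (B v v) + C * 0) + 2 * t * (B u v - l v) + t\<^sup>2 * B v v + 0"
          by (intro tendsto_add tendsto_mult tendsto_const lim)
        then show ?thesis by simp
      qed
      have "0 \<le> ?f n" for n
      proof -
        have Cn: "0 \<le> C * sqrt (B (d n) (d n))" using l_le[OF dV[of n]] by simp
        have "m \<le> J (\<lambda>x. X n x + t *\<^sub>R v x)" using X v D(3) by (intro m_le) auto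
        also have "\<dots> = J (X n) + 2 * t * (B (X n) v - l v) + t\<^sup>2 * B v v"
          by (rule J_add[OF XV DV[OF v]])
        also have "\<dots> \<le> m + 1 / (real n + 1) + 2 * t * (B (X n) v - l v) + t\<^sup>2 * B v v"
          using X(2)[of n] by linarith
        also have "B (X n) v = B u v - B (d n) v"
          unfolding d_def using form_diff u(1) XV DV[OF v] by simp
        finally have 1: "0 \<le> 1 / (real n + 1) + 2 * t * (B u v - l v) - 2 * t * B (d n) v + t\<^sup>2 * B v v"
          by (simp add: algebra_simps)
        have "- (t * B (d n) v) \<le> \<bar>t\<bar> * (sqrt (B (d n) (d n)) * sqrt (B v v))"
          using mult_left_mono[OF Cauchy_Schwarz[OF dV[of n] DV[OF v]], of "\<bar>t\<bar>"] abs_ge_minus_self[of "t * B (d n) v"]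
          by (simp add: abs_mult)
        moreover have "0 \<le> \<bar>t\<bar> * (C * sqrt (B (d n) (d n)))" using Cn by simp
        ultimately show ?thesis using 1 by (simp add: algebra_simps)
      qed
      then show "\<exists>N. \<forall>n\<ge>N. 0 \<le> ?f n" by blast
    qed
    show ?thesis
    proof (rule ccontr)
      assume ne: "B u v \<noteq> l v"
      define a where "a = B u v - l v"
      define b where "b = B v v"
      have b: "b \<ge> 0" unfolding b_def using form_nonneg[OF DV[OF v]] .
      have a: "a\<^sup>2 > 0" using ne unfolding a_def by simp
      \<comment> \<open>The choice \<open>t = - a / (1 + b)\<close> makes the quadratic negative
        and, unlike \<open>- a / b\<close>, is also meaningful for \<open>b = 0\<close>.\<close>
      have "0 \<le> 2 * (- a / (1 + b)) * a + (- a / (1 + b))\<^sup>2 * b"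
        using ineq[of "- a / (1 + b)"] unfolding a_def b_def .
      also have "\<dots> = - a\<^sup>2 * (2 + b) / (1 + b)\<^sup>2"
        using b by (simp add: power2_eq_square divide_simps) (simp add: algebra_simps)
      also have "\<dots> < 0" using a b by (simp add: divide_neg_pos mult_neg_pos)
      finally show False by simp
    qed
  qed
  then show thesis using that X(1) u by blast
qed

text \<open>Applied to the functional \<open>B w\<close>, the Riesz argument yields the projection
  \<open>u\<close> of \<open>w\<close> onto the closure of \<open>D\<close>. The residual
  \<open>w - u\<close> is orthogonal to \<open>D\<close>, hence has form 0, and the minimising
  sequence in \<open>D\<close> approximates \<open>w\<close>.\<close>

lemma dense_if_orthogonal_zero:
  assumes complete: complete_form
    and D: "D \<subseteq> V" "(\<lambda>_. 0) \<in> D" "\<And>u v c. u \<in> D \<Longrightarrow> v \<in> D \<Longrightarrow> (\<lambda>x. u x + c *\<^sub>R v x) \<in> D"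
    and orth: "\<And>w. w \<in> V \<Longrightarrow> (\<And>v. v \<in> D \<Longrightarrow> B w v = 0) \<Longrightarrow> B w w = 0"
    and w: "w \<in> V" and e: "e > 0"
  obtains v where "v \<in> D" "sqrt (diag B (\<lambda>x. w x - v x)) < e"
proof -
  obtain X u where X: "\<And>n. X n \<in> D" "u \<in> V"
      "(\<lambda>n. diag B (\<lambda>x. X n x - u x)) \<longlonglongrightarrow> 0"
    and u: "\<And>v. v \<in> D \<Longrightarrow> B u v = B w v"
  proof (rule Riesz_subspace[OF complete D, of "B w" "sqrt (B w w)"])
    show "B w (\<lambda>x. u x + c *\<^sub>R v x) = B w u + c * B w v" if "u \<in> V" "v \<in> V" for u v c
      using that w by (simp add: form_add_scaleR form_sym[of w] add_scaleR_mem)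
    show "\<bar>B w u\<bar> \<le> sqrt (B w w) * sqrt (B u u)" if "u \<in> V" for u
      using Cauchy_Schwarz[OF w that] .
  qed auto
  have "B (\<lambda>x. w x - u x) v = 0" if "v \<in> D" for v
    using u[OF that] form_diff[OF w X(2), of v] D(1) that by auto
  then have 0: "diag B (\<lambda>x. w x - u x) = 0"
    using orth diff_mem[OF w X(2)] by blast
  have "(\<lambda>n. sqrt (diag B (\<lambda>x. X n x - u x))) \<longlonglongrightarrow> 0"
    using tendsto_real_sqrt[OF X(3)] by simp
  then have "\<forall>\<^sub>F n in sequentially. sqrt (diag B (\<lambda>x. X n x - u x)) < e"
    using e by (rule order_tendstoD(2))
  then obtain n where n: "sqrt (diag B (\<lambda>x. X n x - u x)) < e"
    by (auto simp: eventually_sequentially)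
  have XV: "X n \<in> V" using X(1) D(1) by auto
  have "sqrt (diag B (\<lambda>x. w x - X n x)) < e"
    using triangle_diff[OF w X(2) XV] n unfolding 0 real_sqrt_zero form_square_diff_commute[OF X(2) XV] by linarith
  then show thesis using that X(1) by blast
qed

end

section \<open>The space L2 and its completeness\<close>

definition L2_inner :: "'a measure \<Rightarrow> ('a \<Rightarrow> 'b::euclidean_space) \<Rightarrow> ('a \<Rightarrow> 'b) \<Rightarrow> real" where
  "L2_inner M f g = (\<integral>x. f x \<bullet> g x \<partial>M)"

lemma L2_norm_eq_inner: "L2_norm M f = sqrt (L2_inner M f f)"
  by (simp add: L2_norm_def L2_inner_def power2_norm_eq_inner)

lemma L2_measurable [measurable_dest]: "f \<in> L2 M \<Longrightarrow> f \<in> borel_measurable M"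
  by (simp add: L2_def)

lemma L2_integrable_square: "f \<in> L2 M \<Longrightarrow> integrable M (\<lambda>x. (norm (f x))\<^sup>2)"
  by (simp add: L2_def)

lemma L2_norm_nonneg [simp]: "0 \<le> L2_norm M f"
  by (simp add: L2_norm_def integral_nonneg_AE)

lemma L2_norm_square: "(L2_norm M f)\<^sup>2 = (\<integral>x. (norm (f x))\<^sup>2 \<partial>M)"
  by (simp add: L2_norm_def integral_nonneg_AE)

lemma L2_integrable_inner:
  fixes f g :: "'a \<Rightarrow> 'b::euclidean_space"
  assumes "f \<in> L2 M" "g \<in> L2 M"
  shows "integrable M (\<lambda>x. f x \<bullet> g x)"
proof (rule Bochner_Integration.integrable_bound)
  show "integrable M (\<lambda>x. (norm (f x))\<^sup>2 + (norm (g x))\<^sup>2)"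
    using assms by (auto simp: L2_def)
  show "(\<lambda>x. f x \<bullet> g x) \<in> borel_measurable M"
    using assms by (auto simp: L2_def)
  have "\<bar>a \<bullet> b\<bar> \<le> (norm a)\<^sup>2 + (norm b)\<^sup>2" for a b :: 'b
  proof -
    have "\<bar>a \<bullet> b\<bar> \<le> norm a * norm b" by (rule Cauchy_Schwarz_ineq2)
    also have "\<dots> \<le> (norm a)\<^sup>2 + (norm b)\<^sup>2"
      using zero_le_power2[of "norm a - norm b"] mult_nonneg_nonneg[OF norm_ge_zero norm_ge_zero, of a b]
      unfolding power2_diff mult.assoc by linarith
    finally show ?thesis .
  qed
  then show "AE x in M. norm (f x \<bullet> g x) \<le> norm ((norm (f x))\<^sup>2 + (norm (g x))\<^sup>2)"
    by simp
qed

lemma L2_add_scaleR: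
  fixes f g :: "'a \<Rightarrow> 'b::euclidean_space"
  assumes "f \<in> L2 M" "g \<in> L2 M"
  shows "(\<lambda>x. f x + c *\<^sub>R g x) \<in> L2 M"
proof -
  have int: "integrable M (\<lambda>x. f x \<bullet> f x + 2 * c * (f x \<bullet> g x) + c\<^sup>2 * (g x \<bullet> g x))"
    using assms L2_integrable_inner by (intro Bochner_Integration.integrable_add integrable_mult_right) auto
  have *: "f x \<bullet> f x + 2 * c * (f x \<bullet> g x) + c\<^sup>2 * (g x \<bullet> g x) = (norm (f x + c *\<^sub>R g x))\<^sup>2" for x
    unfolding power2_norm_eq_inner
    by (simp add: inner_add_left inner_add_right inner_commute[of "g x" "f x"] power2_eq_square algebra_simps)
  have "integrable M (\<lambda>x. (norm (f x + c *\<^sub>R g x))\<^sup>2)" using int unfolding * .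
  then show ?thesis
    using assms by (auto simp: L2_def)
qed

lemma semi_inner_space_L2:
  "semi_inner_space (L2 M) (L2_inner M :: ('a \<Rightarrow> 'b::euclidean_space) \<Rightarrow> _)"
proof
  show "(\<lambda>_. 0) \<in> L2 M" by (simp add: L2_def)
  show "L2_inner M (\<lambda>x. u x + c *\<^sub>R v x) w = L2_inner M u w + c * L2_inner M v w"
    if "u \<in> L2 M" "v \<in> L2 M" "w \<in> L2 M" for u v w :: "'a \<Rightarrow> 'b" and c
    using that by (simp add: L2_inner_def inner_simps L2_integrable_inner)
qed (auto simp: L2_add_scaleR L2_inner_def inner_commute integral_nonneg_AE)

interpretation L2: semi_inner_space "L2 M" "L2_inner M" for M
  by (rule semi_inner_space_L2)

text \<open>Fatou's lemma for squared norms. The bound is asked only for indices from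
  \<open>k\<close> on, so that a Cauchy estimate can be inserted directly.\<close>

lemma L2_Fatou:
  fixes f :: "nat \<Rightarrow> 'a \<Rightarrow> 'b::euclidean_space"
  assumes f: "\<And>n. f n \<in> L2 M" and g: "g \<in> borel_measurable M"
    and lim: "AE x in M. (\<lambda>n. f n x) \<longlonglongrightarrow> g x"
    and le: "\<And>n. n \<ge> k \<Longrightarrow> (L2_norm M (f n))\<^sup>2 \<le> C"
  shows "g \<in> L2 M" "(L2_norm M g)\<^sup>2 \<le> C"
proof -
  have C: "0 \<le> C" using le[of k] by (meson order_refl order_trans zero_le_power2)
  have [measurable]: "\<And>n. f n \<in> borel_measurable M" "g \<in> borel_measurable M" using f g by (auto simp: L2_def)
  have fn: "(\<integral>\<^sup>+x. ennreal ((norm (f n x))\<^sup>2) \<partial>M) \<le> ennreal C" if "n \<ge> k" for n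
    using f[of n] le[OF that] by (simp add: nn_integral_eq_integral L2_def L2_norm_square ennreal_leI)
  have "(\<integral>\<^sup>+x. ennreal ((norm (g x))\<^sup>2) \<partial>M) = (\<integral>\<^sup>+x. liminf (\<lambda>n. ennreal ((norm (f n x))\<^sup>2)) \<partial>M)"
  proof (rule nn_integral_cong_AE)
    show "AE x in M. ennreal ((norm (g x))\<^sup>2) = liminf (\<lambda>n. ennreal ((norm (f n x))\<^sup>2))"
      using lim
    proof eventually_elim
      case (elim x)
      have "(\<lambda>n. ennreal ((norm (f n x))\<^sup>2)) \<longlonglongrightarrow> ennreal ((norm (g x))\<^sup>2)"
        using elim by (intro tendsto_ennrealI tendsto_intros)
      then show ?case by (intro lim_imp_Liminf[symmetric]) auto
    qed
  qed
  also have "\<dots> \<le> liminf (\<lambda>n. \<integral>\<^sup>+x. ennreal ((norm (f n x))\<^sup>2) \<partial>M)"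
    by (rule nn_integral_liminf) auto
  also have "\<dots> \<le> ennreal C"
    by (rule order_trans[OF Liminf_mono[of _ "\<lambda>_. ennreal C"]])
       (use fn in \<open>auto simp: eventually_sequentially Liminf_const\<close>)
  finally have *: "(\<integral>\<^sup>+x. ennreal ((norm (g x))\<^sup>2) \<partial>M) \<le> ennreal C" .
  then have int: "integrable M (\<lambda>x. (norm (g x))\<^sup>2)"
    by (intro integrableI_bounded) (auto simp: top_unique intro: le_less_trans)
  then show "g \<in> L2 M" by (simp add: L2_def g)
  show "(L2_norm M g)\<^sup>2 \<le> C"
    using * int C by (simp add: L2_norm_square nn_integral_eq_integral)
qed

text \<open>Riesz-Fischer: a subsequence with rapidly decreasing increments converges almost
  everywhere, and Fatou's lemma turns the Cauchy estimate into an estimate for the limit.\<close>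

lemma L2_complete:
  "semi_inner_space.complete_form (L2 M) (L2_inner M :: ('a \<Rightarrow> 'b::euclidean_space) \<Rightarrow> _)"
  unfolding L2.complete_form_def
proof (intro allI impI)
  fix X :: "nat \<Rightarrow> 'a \<Rightarrow> 'b"
  assume X: "\<forall>n. X n \<in> L2 M"
    and Cauchy: "\<forall>e>0. \<exists>N. \<forall>m\<ge>N. \<forall>n\<ge>N. diag (L2_inner M) (\<lambda>x. X m x - X n x) < e"
  have [measurable]: "\<And>n. X n \<in> borel_measurable M" using X by (auto simp: L2_def)
  have "\<forall>k. \<exists>N. \<forall>m\<ge>N. \<forall>n\<ge>N. diag (L2_inner M) (\<lambda>x. X m x - X n x) < (1/4)^k"
    using Cauchy by simp
  then obtain N where N: "\<And>k m n. m \<ge> N k \<Longrightarrow> n \<ge> N k \<Longrightarrow> 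
      diag (L2_inner M) (\<lambda>x. X m x - X n x) < (1/4)^k"
    by metis
  \<comment> \<open>Adding up all earlier thresholds makes \<open>r\<close> monotone and at least
    \<open>N k\<close>; the summand \<open>k\<close> makes it tend to infinity.\<close>
  define r where "r k = (\<Sum>i\<le>k. N i) + k" for k
  have rN: "r k \<ge> N k" for k unfolding r_def
    using member_le_sum[of k "{..k}" N] by simp
  have r_mono: "r k \<ge> k" "r k \<le> r (Suc k)" for k unfolding r_def by auto
  define d where "d k x = norm (X (r (Suc k)) x - X (r k) x)" for k x
  have [measurable]: "d k \<in> borel_measurable M" for k unfolding d_def by simp
  \<comment> \<open>The weight \<open>2^k\<close> still leaves summable integrals. Where the
    weighted sum is finite, say equal to \<open>S\<close>, each increment is at most
    \<open>sqrt S\<close> times \<open>sqrt (1/2)^k\<close>, a summable bound. Working with squares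
    avoids comparing L1 with L2, which would fail on infinite measure spaces.\<close>
  have d_int: "(\<integral>\<^sup>+x. ennreal (2^k * (d k x)\<^sup>2) \<partial>M) \<le> ennreal ((1/2)^k)" for k
  proof -
    have "(\<lambda>x. X (r (Suc k)) x - X (r k) x) \<in> L2 M" using L2.diff_mem[of "X (r (Suc k))" M "X (r k)"] X by simp
    then have int: "integrable M (\<lambda>x. (d k x)\<^sup>2)" unfolding d_def by (simp add: L2_def)
    have "(\<integral>x. (d k x)\<^sup>2 \<partial>M) \<le> (1/4)^k"
      using N[of k "r (Suc k)" "r k"] rN[of k] r_mono(2)[of k]
      by (simp add: d_def L2_inner_def power2_norm_eq_inner)
    then have "(\<integral>x. 2^k * (d k x)\<^sup>2 \<partial>M) \<le> 2^k * (1/4)^k" using int by simp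
    also have "\<dots> = (1/2::real)^k" by (simp add: power_mult_distrib[symmetric])
    finally show ?thesis using int by (simp add: nn_integral_eq_integral ennreal_leI)
  qed
  have "(\<integral>\<^sup>+x. (\<Sum>k. ennreal (2^k * (d k x)\<^sup>2)) \<partial>M) = (\<Sum>k. \<integral>\<^sup>+x. ennreal (2^k * (d k x)\<^sup>2) \<partial>M)"
    by (rule nn_integral_suminf) auto
  also have "\<dots> \<le> (\<Sum>k. ennreal ((1/2)^k))"
    by (rule suminf_le) (use d_int in auto)
  also have "\<dots> = ennreal (\<Sum>k. (1/2)^k)"
    by (rule suminf_ennreal2) (auto intro: summable_geometric)
  also have "\<dots> < \<infinity>" by simp
  finally have "(\<integral>\<^sup>+x. (\<Sum>k. ennreal (2^k * (d k x)\<^sup>2)) \<partial>M) \<noteq> \<infinity>" by simp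
  then have AE_fin: "AE x in M. (\<Sum>k. ennreal (2^k * (d k x)\<^sup>2)) \<noteq> \<infinity>"
    by (intro nn_integral_PInf_AE) auto
  define g where "g x = lim (\<lambda>k. X (r k) x)" for x
  have [measurable]: "g \<in> borel_measurable M" unfolding g_def by simp
  have lim_g: "AE x in M. (\<lambda>k. X (r k) x) \<longlonglongrightarrow> g x"
    using AE_fin
  proof eventually_elim
    case (elim x)
    define S where "S = enn2real (\<Sum>k. ennreal (2^k * (d k x)\<^sup>2))"
    have dS: "2^k * (d k x)\<^sup>2 \<le> S" for k
    proof -
      define F where "F k = ennreal (2^k * (d k x)\<^sup>2)" for k
      have "sum F {k} \<le> suminf F" by (rule sum_le_suminf) auto
      then have "F k \<le> suminf F" by simp
      also have "\<dots> = ennreal S" using elim unfolding S_def F_def by (simp add: less_top)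
      finally show ?thesis unfolding S_def F_def by simp
    qed
    have "d k x \<le> sqrt S * (sqrt (1/2))^k" for k
    proof -
      have "d k x = sqrt ((d k x)\<^sup>2)" by (simp add: d_def)
      also have "\<dots> \<le> sqrt (S * (1/2)^k)"
        using dS[of k] by (intro real_sqrt_le_mono) (simp add: field_simps power_divide)
      finally show ?thesis by (simp add: real_sqrt_mult real_sqrt_power)
    qed
    moreover have "summable (\<lambda>k. sqrt S * (sqrt (1/2))^k)"
      by (intro summable_mult summable_geometric) (simp add: real_sqrt_lt_1_iff)
    ultimately have "summable (\<lambda>k. norm (X (r (Suc k)) x - X (r k) x))"
      by (intro summable_comparison_test[OF _ \<open>summable (\<lambda>k. sqrt S * (sqrt (1/2))^k)\<close>])
         (auto simp: d_def intro!: exI[of _ 0])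
    then have "summable (\<lambda>k. X (r (Suc k)) x - X (r k) x)" by (rule summable_norm_cancel)
    then have "convergent (\<lambda>n. \<Sum>k<n. X (r (Suc k)) x - X (r k) x)"
      by (simp add: summable_iff_convergent)
    then have "convergent (\<lambda>n. X (r n) x - X (r 0) x)"
      using sum_lessThan_telescope[of "\<lambda>k. X (r k) x"] by simp
    then have "convergent (\<lambda>n. X (r n) x)"
      using convergent_add[OF _ convergent_const[of "X (r 0) x"]] by force
    then show ?case unfolding g_def by (simp add: convergent_LIMSEQ_iff)
  qed
  \<comment> \<open>Let the second index run along the subsequence. The strict bound becomes a weak
    one in the limit, hence \<open>e/2\<close> at the end.\<close>
  have main: "(\<lambda>x. X n x - g x) \<in> L2 M \<and> (L2_norm M (\<lambda>x. X n x - g x))\<^sup>2 \<le> e"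
    if n: "\<forall>m\<ge>K. diag (L2_inner M) (\<lambda>x. X n x - X m x) < e" for n K e
  proof -
    have "(L2_norm M (\<lambda>x. X n x - X (r k) x))\<^sup>2 \<le> e" if "k \<ge> K" for k
      using n r_mono(1)[of k] that by (simp add: L2_norm_eq_inner L2.form_nonneg L2.diff_mem X less_imp_le)
    moreover have "AE x in M. (\<lambda>k. X n x - X (r k) x) \<longlonglongrightarrow> X n x - g x"
      using lim_g by eventually_elim (intro tendsto_intros)
    ultimately show ?thesis
      using L2_Fatou[of "\<lambda>k x. X n x - X (r k) x" M "\<lambda>x. X n x - g x" K e] X
      by (auto simp: L2.diff_mem)
  qed
  obtain n0 where "\<forall>m\<ge>n0. \<forall>n\<ge>n0. diag (L2_inner M) (\<lambda>x. X m x - X n x) < 1"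
    using Cauchy zero_less_one by blast
  then have "(\<lambda>x. X n0 x - g x) \<in> L2 M" using main[of n0 n0 1] by auto
  from L2.diff_mem[OF _ this, of "X n0"] X have g: "g \<in> L2 M" by simp
  show "\<exists>u\<in>L2 M. (\<lambda>n. diag (L2_inner M) (\<lambda>x. X n x - u x)) \<longlonglongrightarrow> 0"
  proof (intro bexI[OF _ g] LIMSEQ_I)
    fix e :: real assume e: "e > 0"
    then obtain K where K: "\<forall>m\<ge>K. \<forall>n\<ge>K. diag (L2_inner M) (\<lambda>x. X m x - X n x) < e/2"
      using Cauchy half_gt_zero by blast
    show "\<exists>no. \<forall>n\<ge>no. norm (diag (L2_inner M) (\<lambda>x. X n x - g x) - 0) < e"
    proof (intro exI[of _ K] allI impI)
      fix n assume "K \<le> n"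
      then show "norm (diag (L2_inner M) (\<lambda>x. X n x - g x) - 0) < e"
        using main[of K n "e/2"] K e L2.form_nonneg[of "\<lambda>x. X n x - g x" M]
        by (auto simp: L2_norm_eq_inner)
    qed
  qed
qed

subsection \<open>Smooth functions\<close>

definition smooth :: "(real^'n::finite \<Rightarrow> real) \<Rightarrow> bool" where
  "smooth g \<longleftrightarrow> (\<forall>k. C_k k g)"

lemma has_derivative_gradient:
  fixes g :: "real^'n::finite \<Rightarrow> real"
  assumes "g differentiable (at x)"
  shows "(g has_derivative (\<lambda>h. gradient g x \<bullet> h)) (at x)"
proof -
  let ?D = "frechet_derivative g (at x)"
  have der: "(g has_derivative ?D) (at x)"
    using assms by (simp add: frechet_derivative_works)
  then have lin: "linear ?D" by (rule has_derivative_linear)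
  have "?D h = gradient g x \<bullet> h" for h
  proof -
    have "?D h = ?D (\<Sum>i\<in>UNIV. h $ i *\<^sub>R axis i 1)"
      by (simp add: basis_expansion scalar_mult_eq_scaleR[symmetric])
    also have "\<dots> = (\<Sum>i\<in>UNIV. h $ i * ?D (axis i 1))"
      by (simp add: linear_sum[OF lin] linear_scale[OF lin])
    also have "\<dots> = gradient g x \<bullet> h"
      by (simp add: gradient_def pderivative_def inner_vec_def mult.commute)
    finally show ?thesis .
  qed
  then have "?D = (\<lambda>h. gradient g x \<bullet> h)" by auto
  with der show ?thesis by simp
qed

lemma pderivative_eqI:
  assumes "(g has_derivative g') (at x)"
  shows "pderivative i g x = g' (axis i 1)"
  using frechet_derivative_at[OF assms] by (simp add: pderivative_def)

lemma C_k_Suc_D: "C_k (Suc k) g \<Longrightarrow> C_k k g"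
proof (induction k arbitrary: g)
  case 0
  then show ?case
    by (auto intro!: differentiable_imp_continuous_on simp: differentiable_on_def)
next
  case (Suc k)
  from Suc.prems have "\<forall>x. g differentiable (at x)" "\<forall>i. C_k (Suc k) (pderivative i g)"
    unfolding C_k.simps(2)[of "Suc k"] by auto
  then show ?case using Suc.IH by simp
qed

lemma smooth_differentiable: "smooth g \<Longrightarrow> g differentiable (at x)"
  unfolding smooth_def using C_k.simps(2)[of 0 g] by blast

lemma smooth_pderivative: "smooth g \<Longrightarrow> smooth (pderivative i g)"
  unfolding smooth_def using C_k.simps(2) by blast

text \<open>The hypotheses give \<open>C_k (Suc k)\<close> for every \<open>k\<close>; stepping down
  by one also covers order 0.\<close>

lemma smoothI:
  assumes "\<And>x. g differentiable (at x)" "\<And>i. smooth (pderivative i g)"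
  shows "smooth g"
  unfolding smooth_def
proof
  fix k show "C_k k g"
    by (rule C_k_Suc_D) (use assms in \<open>auto simp: smooth_def\<close>)
qed

lemma smooth_continuous: "smooth g \<Longrightarrow> continuous_on S g"
  unfolding smooth_def using continuous_on_subset[of UNIV g S] by (metis C_k.simps(1) subset_UNIV)

lemma smooth_has_derivative:
  "smooth g \<Longrightarrow> (g has_derivative (\<lambda>h. gradient g x \<bullet> h)) (at x)"
  by (intro has_derivative_gradient smooth_differentiable)

lemma smooth_const: "smooth (\<lambda>_. c)"
proof -
  have "C_k k (\<lambda>_::real^'a. c)" for k :: nat and c :: real
  proof (induction k arbitrary: c)
    case (Suc k)
    have "pderivative i (\<lambda>_::real^'a. c) = (\<lambda>_. 0)" for i
      by (intro ext) (auto intro!: pderivative_eqI[of _ "\<lambda>_. 0"])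
    then show ?case using Suc by simp
  qed simp
  then show ?thesis by (simp add: smooth_def)
qed

lemma pderivative_add_scale:
  assumes "g differentiable (at x)" "h differentiable (at x)"
  shows "pderivative i (\<lambda>x. g x + c * h x) x = pderivative i g x + c * pderivative i h x"
  by (subst pderivative_eqI[of _ "\<lambda>v. gradient g x \<bullet> v + c * (gradient h x \<bullet> v)"])
     (auto intro!: derivative_eq_intros has_derivative_gradient assms
       simp: gradient_def inner_axis)

lemma pderivative_mult:
  assumes "g differentiable (at x)" "h differentiable (at x)"
  shows "pderivative i (\<lambda>x. g x * h x) x = pderivative i g x * h x + g x * pderivative i h x"
  by (subst pderivative_eqI[of _ "\<lambda>v. g x * (gradient h x \<bullet> v) + (gradient g x \<bullet> v) * h x"])
     (auto intro!: derivative_eq_intros has_derivative_gradient assms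
       simp: gradient_def inner_axis)

lemma C_k_add_scale: "C_k k g \<Longrightarrow> C_k k h \<Longrightarrow> C_k k (\<lambda>x. g x + c * h x)"
proof (induction k arbitrary: g h)
  case 0
  then show ?case by (auto intro!: continuous_intros)
next
  case (Suc k)
  have "pderivative i (\<lambda>x. g x + c * h x) = (\<lambda>x. pderivative i g x + c * pderivative i h x)" for i
    using Suc.prems by (intro ext pderivative_add_scale) auto
  then show ?case using Suc by (auto intro!: derivative_intros)
qed

lemma C_k_mult: "C_k k g \<Longrightarrow> C_k k h \<Longrightarrow> C_k k (\<lambda>x. g x * h x)"
proof (induction k arbitrary: g h)
  case 0
  then show ?case by (auto intro!: continuous_intros)
next
  case (Suc k)
  \<comment> \<open>The factor 1 brings the product rule into the shape required by
    \<open>C_k_add_scale\<close>.\<close>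
  have eq: "pderivative i (\<lambda>x. g x * h x) = (\<lambda>x. pderivative i g x * h x + 1 * (g x * pderivative i h x))" for i
    using Suc.prems by (intro ext) (auto simp: pderivative_mult)
  have "C_k k (pderivative i (\<lambda>x. g x * h x))" for i
    unfolding eq using Suc.prems C_k_Suc_D[OF Suc.prems(1)] C_k_Suc_D[OF Suc.prems(2)]
    by (intro C_k_add_scale Suc.IH) auto
  then show ?case using Suc.prems by (auto intro!: derivative_intros)
qed

lemma smooth_add_scale: "smooth g \<Longrightarrow> smooth h \<Longrightarrow> smooth (\<lambda>x. g x + c * h x)"
  by (simp add: smooth_def C_k_add_scale)

lemma smooth_scale: "smooth g \<Longrightarrow> smooth (\<lambda>x. c * g x)"
  using smooth_add_scale[OF smooth_const[of 0], of g c] by simp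

lemma smooth_diff: "smooth g \<Longrightarrow> smooth h \<Longrightarrow> smooth (\<lambda>x. g x - h x)"
  using smooth_add_scale[of g h "-1"] by simp

lemma smooth_mult: "smooth g \<Longrightarrow> smooth h \<Longrightarrow> smooth (\<lambda>x. g x * h x)"
  by (simp add: smooth_def C_k_mult)

lemma smooth_component: "smooth (\<lambda>x. x $ i)"
proof (rule smoothI)
  have der: "((\<lambda>x. x $ i) has_derivative (\<lambda>v. v $ i)) (at x)" for x :: "real^'a"
    by (intro bounded_linear_imp_has_derivative bounded_linear_vec_nth)
  then show "(\<lambda>x. x $ i) differentiable (at x)" for x :: "real^'a"
    by (auto simp: differentiable_def)
  have "pderivative j (\<lambda>x. x $ i) = (\<lambda>_. axis j 1 $ i)" for j
    by (intro ext pderivative_eqI der)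
  then show "smooth (pderivative j (\<lambda>x. x $ i))" for j
    by (simp add: smooth_const)
qed

lemma smooth_dist_square: "smooth (\<lambda>x. (x - a) \<bullet> (x - a))"
proof (rule smoothI)
  have der: "((\<lambda>x. (x - a) \<bullet> (x - a)) has_derivative (\<lambda>v. 2 * ((x - a) \<bullet> v))) (at x)" for x :: "real^'a"
    by (auto intro!: derivative_eq_intros simp: inner_commute)
  then show "(\<lambda>x. (x - a) \<bullet> (x - a)) differentiable (at x)" for x :: "real^'a"
    by (auto simp: differentiable_def)
  have "pderivative i (\<lambda>x. (x - a) \<bullet> (x - a)) = (\<lambda>x. 2 * (x $ i - a $ i))" for i
    by (intro ext) (subst pderivative_eqI[OF der], simp add: inner_axis)
  then show "smooth (pderivative i (\<lambda>x. (x - a) \<bullet> (x - a)))" for i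
    by (simp add: smooth_scale smooth_diff smooth_const smooth_component)
qed

lemma pderivative_reflect:
  assumes "g differentiable (at (a - x))"
  shows "pderivative i (\<lambda>x. g (a - x)) x = - pderivative i g (a - x)"
proof -
  have "((\<lambda>x. g (a - x)) has_derivative (\<lambda>v. gradient g (a - x) \<bullet> (- v))) (at x)"
    by (rule has_derivative_compose[of "\<lambda>x. a - x" uminus x UNIV g])
       (auto intro!: derivative_eq_intros has_derivative_gradient assms)
  from pderivative_eqI[OF this] show ?thesis
    by (simp add: gradient_def inner_axis)
qed

lemma smooth_reflect: "smooth g \<Longrightarrow> smooth (\<lambda>x. g (a - x))"
proof -
  have "C_k k (\<lambda>x. g (a - x))" if "smooth g" for k and g :: "real^'a \<Rightarrow> real" and a
    using that
  proof (induction k arbitrary: g)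
    case 0
    have "continuous_on UNIV (g \<circ> (\<lambda>x. a - x))"
      by (intro continuous_on_compose smooth_continuous 0 continuous_intros)
    then show ?case by (simp add: o_def)
  next
    case (Suc k)
    have eq: "pderivative i (\<lambda>x. g (a - x)) = (\<lambda>x. (\<lambda>y. (-1) * pderivative i g y) (a - x))" for i
      using Suc.prems by (intro ext) (simp add: pderivative_reflect smooth_differentiable)
    have "(\<lambda>x. g (a - x)) differentiable (at x)" for x
      using differentiable_chain_at[of "\<lambda>x. a - x" x g] smooth_differentiable[OF Suc.prems]
      by (auto simp: o_def intro!: derivative_intros)
    then show ?case
      unfolding C_k.simps eq using Suc.IH[OF smooth_scale[OF smooth_pderivative[OF Suc.prems], of "-1"]] by blast
  qed
  then show "smooth g \<Longrightarrow> smooth (\<lambda>x. g (a - x))" by (simp add: smooth_def)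
qed

subsection \<open>Bump functions\<close>

text \<open>The functions \<open>t \<mapsto> p(1/t) e\<^bsup>-1/t\<^esup>\<close>, extended by zero, are closed under differentiation.\<close>
definition flat :: "real poly \<Rightarrow> real \<Rightarrow> real" where
  "flat p t = (if t > 0 then poly p (1 / t) * exp (- 1 / t) else 0)"

lemma poly_exp_tendsto_0: "((\<lambda>x. poly p x * exp (- x)) \<longlongrightarrow> 0) (at_top :: real filter)"
proof -
  have "((\<lambda>x::real. \<Sum>i\<le>degree p. coeff p i * (x ^ i / exp x)) \<longlongrightarrow> (\<Sum>i\<le>degree p. coeff p i * 0)) at_top"
    by (intro tendsto_intros tendsto_power_div_exp_0)
  then show ?thesis
    by (simp add: poly_altdef exp_minus divide_inverse sum_distrib_right mult.assoc)
qed

lemma flat_tendsto_0: "(flat p \<longlongrightarrow> 0) (at 0)"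
proof -
  have "((\<lambda>t. poly p (inverse t) * exp (- inverse t)) \<longlongrightarrow> 0) (at_right 0)"
    by (rule filterlim_compose[OF poly_exp_tendsto_0 filterlim_inverse_at_top_right])
  then have "(flat p \<longlongrightarrow> 0) (at_right 0)"
    by (rule Lim_transform_eventually)
       (auto simp: eventually_at_filter flat_def inverse_eq_divide)
  moreover have "(flat p \<longlongrightarrow> 0) (at_left 0)"
    by (rule tendsto_eventually) (auto simp: eventually_at_filter flat_def)
  ultimately show ?thesis by (simp add: filterlim_at_split)
qed

text \<open>For \<open>t > 0\<close> the chain rule gives \<open>(p(1/t) - p'(1/t)) / t^2\<close>
  times the exponential, and \<open>[:0, 0, 1:]\<close> is the square of the variable
  \<open>1/t\<close>. At 0 the difference quotient of \<open>flat p\<close> is again a flat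
  function, with polynomial \<open>[:0, 1:] * p\<close>, so it tends to 0.\<close>

lemma DERIV_flat: "DERIV (flat p) t :> flat ([:0, 0, 1:] * (p - pderiv p)) t"
proof -
  consider "t > 0" | "t < 0" | "t = 0" by linarith
  then show ?thesis
  proof cases
    case 1
    have "DERIV (\<lambda>t. poly p (1 / t) * exp (- 1 / t)) t :> flat ([:0, 0, 1:] * (p - pderiv p)) t"
      using 1 by (auto intro!: derivative_eq_intros poly_DERIV[THEN DERIV_chain2]
          simp: flat_def power2_eq_square field_simps)
    moreover have "\<forall>\<^sub>F s in nhds t. flat p s = poly p (1 / s) * exp (- 1 / s)"
      using eventually_nhds_in_open[of "{0<..}" t] 1 by (auto simp: flat_def elim!: eventually_mono)
    ultimately show ?thesis by (subst DERIV_cong_ev[OF refl _ refl]) auto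
  next
    case 2
    have "\<forall>\<^sub>F s in nhds t. flat p s = 0"
      using eventually_nhds_in_open[of "{..<0}" t] 2 by (auto simp: flat_def elim!: eventually_mono)
    then show ?thesis using 2 by (subst DERIV_cong_ev[OF refl _ refl]) (auto simp: flat_def)
  next
    case 3
    have "(flat ([:0, 1:] * p) \<longlongrightarrow> 0) (at 0)" by (rule flat_tendsto_0)
    moreover have "flat ([:0, 1:] * p) = (\<lambda>s. (flat p s - flat p 0) / (s - 0))"
      by (intro ext) (simp add: flat_def)
    ultimately have "((\<lambda>s. (flat p s - flat p 0) / (s - 0)) \<longlongrightarrow> 0) (at 0)" by metis
    then have "DERIV (flat p) 0 :> 0" by (simp add: has_field_derivative_iff)
    then show ?thesis using 3 by (simp add: flat_def)
  qed
qed

text \<open>A partial derivative is a partial derivative of \<open>q\<close> times another flat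
  function of \<open>q\<close>, so the induction closes once \<open>p\<close> is
  generalised.\<close>

lemma smooth_flat: "smooth q \<Longrightarrow> smooth (\<lambda>x. flat p (q x))"
proof -
  have der: "((\<lambda>x. flat p (q x)) has_derivative
      (\<lambda>h. (gradient q x \<bullet> h) * flat ([:0, 0, 1:] * (p - pderiv p)) (q x))) (at x)"
    if "smooth q" for p and q :: "real^'a \<Rightarrow> real" and x
    using has_derivative_compose[OF smooth_has_derivative[OF that]
        DERIV_flat[unfolded has_field_derivative_def]] by (simp add: mult.commute)
  have "C_k k (\<lambda>x. flat p (q x))" if "smooth q" for k p and q :: "real^'a \<Rightarrow> real"
    using that
  proof (induction k arbitrary: p)
    case 0
    have "continuous_on UNIV (\<lambda>x. flat p (q x))"
      using der[OF 0] by (meson continuous_on_eq_continuous_at has_derivative_continuous open_UNIV)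
    then show ?case by simp
  next
    case (Suc k)
    have "pderivative i (\<lambda>x. flat p (q x)) = (\<lambda>x. pderivative i q x * flat ([:0, 0, 1:] * (p - pderiv p)) (q x))" for i
      using pderivative_eqI[OF der[OF Suc.prems]] by (intro ext) (simp add: gradient_def inner_axis)
    moreover have "C_k k (pderivative i q)" for i
      using smooth_pderivative[OF Suc.prems] by (simp add: smooth_def)
    ultimately show ?case
      using Suc der[OF Suc.prems] by (simp add: C_k_mult differentiable_def del: mult_pCons_left) blast
  qed
  then show "smooth q \<Longrightarrow> smooth (\<lambda>x. flat p (q x))" by (simp add: smooth_def)
qed

subsection \<open>Translations and reflections\<close>

text \<open>The condition on \<open>c\<close> covers translations (\<open>c = 1\<close>) and point
  reflections (\<open>c = -1\<close>) together. Measurability is claimed between completed measures,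
  where continuity alone would not give it.\<close>

lemma distr_lebesgue_isometry:
  fixes a :: "'a::euclidean_space"
  assumes "\<bar>c\<bar> = 1"
  shows "distr lebesgue lebesgue (\<lambda>x. a + c *\<^sub>R x) = lebesgue"
    and measurable_lebesgue_isometry: "(\<lambda>x. a + c *\<^sub>R x) \<in> lebesgue \<rightarrow>\<^sub>M lebesgue"
proof -
  have c: "c \<noteq> 0" using assms by auto
  have T: "(\<lambda>x. a + c *\<^sub>R x) = (\<lambda>x. a + (\<Sum>j\<in>Basis. (c * (x \<bullet> j)) *\<^sub>R j))"
    by (simp add: scaleR_sum_right[symmetric] euclidean_representation scaleR_scaleR[symmetric] del: scaleR_scaleR)
  show "(\<lambda>x. a + c *\<^sub>R x) \<in> lebesgue \<rightarrow>\<^sub>M lebesgue"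
    unfolding T by (rule lebesgue_affine_measurable) (use c in auto)
  have "lebesgue = density (distr lebesgue lebesgue (\<lambda>x. a + c *\<^sub>R x)) (\<lambda>_. (\<Prod>j\<in>(Basis::'a set). \<bar>c\<bar>))"
    unfolding T by (rule lebesgue_affine_euclidean) (use c in auto)
  then show "distr lebesgue lebesgue (\<lambda>x. a + c *\<^sub>R x) = lebesgue"
    using assms by (simp add: density_1)
qed

lemma AE_isometry:
  fixes a :: "'a::euclidean_space"
  assumes "\<bar>c\<bar> = 1" "AE x in lebesgue. P x"
  shows "AE x in lebesgue. P (a + c *\<^sub>R x)"
  by (rule AE_distrD[OF measurable_lebesgue_isometry[OF assms(1)]])
     (use assms(2) in \<open>simp only: distr_lebesgue_isometry[OF assms(1)]\<close>)

lemma integrable_isometry: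
  fixes a :: "'a::euclidean_space" and f :: "'a \<Rightarrow> 'b::{banach, second_countable_topology}"
  assumes "\<bar>c\<bar> = 1" "integrable lebesgue f"
  shows "integrable lebesgue (\<lambda>x. f (a + c *\<^sub>R x))"
  using integrable_distr[OF measurable_lebesgue_isometry[OF assms(1), of a], of f]
    assms(2) distr_lebesgue_isometry[OF assms(1), of a] by simp

lemma integral_isometry:
  fixes a :: "'a::euclidean_space" and f :: "'a \<Rightarrow> 'b::{banach, second_countable_topology}"
  assumes "\<bar>c\<bar> = 1" "f \<in> borel_measurable lebesgue"
  shows "(\<integral>x. f (a + c *\<^sub>R x) \<partial>lebesgue) = (\<integral>x. f x \<partial>lebesgue)"
  using integral_distr[OF measurable_lebesgue_isometry[OF assms(1), of a], of f]
    assms(2) distr_lebesgue_isometry[OF assms(1), of a] by simp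

lemma L2_isometry:
  fixes a :: "'a::euclidean_space" and f :: "'a \<Rightarrow> 'b::euclidean_space"
  assumes "\<bar>c\<bar> = 1" "f \<in> L2 lebesgue"
  shows "(\<lambda>x. f (a + c *\<^sub>R x)) \<in> L2 lebesgue"
    and "L2_norm lebesgue (\<lambda>x. f (a + c *\<^sub>R x)) = L2_norm lebesgue f"
proof -
  have f: "f \<in> borel_measurable lebesgue" "integrable lebesgue (\<lambda>x. (norm (f x))\<^sup>2)"
    using assms(2) by (auto simp: L2_def)
  show "(\<lambda>x. f (a + c *\<^sub>R x)) \<in> L2 lebesgue"
    unfolding L2_def
    using measurable_compose[OF measurable_lebesgue_isometry[OF assms(1)] f(1)]
      integrable_isometry[OF assms(1) f(2)] by simp
  show "L2_norm lebesgue (\<lambda>x. f (a + c *\<^sub>R x)) = L2_norm lebesgue f"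
    unfolding L2_norm_def using integral_isometry[OF assms(1) borel_measurable_integrable[OF f(2)]] by simp
qed

subsection \<open>Local integrability\<close>

definition locally_integrable :: "('a::euclidean_space \<Rightarrow> 'b::euclidean_space) \<Rightarrow> bool" where
  "locally_integrable u \<longleftrightarrow> (\<forall>K. compact K \<longrightarrow> u absolutely_integrable_on K)"

lemma L2_locally_integrable:
  fixes u :: "'a::euclidean_space \<Rightarrow> 'b::euclidean_space"
  assumes "u \<in> L2 lebesgue"
  shows "locally_integrable u"
  unfolding locally_integrable_def set_integrable_def
proof (intro allI impI)
  fix K :: "'a set" assume K: "compact K"
  show "integrable lebesgue (\<lambda>x. indicator K x *\<^sub>R u x)"
  proof (rule Bochner_Integration.integrable_bound)
    have "K \<in> lmeasurable" using K by (rule lmeasurable_compact)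
    then show "integrable lebesgue (\<lambda>x. indicator K x + (norm (u x))\<^sup>2)"
      using assms by (auto simp: L2_def fmeasurable_def)
    show "(\<lambda>x. indicator K x *\<^sub>R u x) \<in> borel_measurable lebesgue"
      using assms \<open>K \<in> lmeasurable\<close> by (auto simp: L2_def fmeasurable_def)
    have "t \<le> 1 + t\<^sup>2" for t :: real
      using zero_le_power2[of "t - 1"] zero_le_power2[of t] unfolding power2_diff one_power2 mult_1_right by linarith
    then show "AE x in lebesgue. norm (indicator K x *\<^sub>R u x) \<le> norm (indicator K x + (norm (u x))\<^sup>2)"
      by (auto simp: indicator_def)
  qed
qed

lemma locally_integrable_component:
  fixes g :: "'a::euclidean_space \<Rightarrow> real^'n"
  assumes "locally_integrable g"
  shows "locally_integrable (\<lambda>x. g x $ i)"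
  using assms integrable_bounded_linear[OF bounded_linear_vec_nth[of i]]
  unfolding locally_integrable_def set_integrable_def by fastforce

lemma locally_integrable_mult:
  fixes u \<phi> :: "'a::euclidean_space \<Rightarrow> real"
  assumes "locally_integrable u" "continuous_on UNIV \<phi>" "compact K" "\<And>x. x \<notin> K \<Longrightarrow> \<phi> x = 0"
  shows "integrable lebesgue (\<lambda>x. u x * \<phi> x)"
proof -
  have "bounded (\<phi> ` K)"
    using assms(2,3) by (intro compact_imp_bounded compact_continuous_image) (auto intro: continuous_on_subset)
  then obtain C where C: "\<And>x. x \<in> K \<Longrightarrow> \<bar>\<phi> x\<bar> \<le> C" "C > 0"
    unfolding bounded_pos by auto
  have u: "integrable lebesgue (\<lambda>x. indicator K x *\<^sub>R u x)"
    using assms(1,3) by (auto simp: locally_integrable_def set_integrable_def)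
  have eq: "(\<lambda>x. u x * \<phi> x) = (\<lambda>x. (indicator K x *\<^sub>R u x) * \<phi> x)"
    using assms(4) by (intro ext) (auto simp: indicator_def)
  have "\<phi> \<in> borel_measurable lebesgue"
    using borel_measurable_continuous_onI[OF assms(2)] by (simp add: measurable_completion)
  then have "(\<lambda>x. u x * \<phi> x) \<in> borel_measurable lebesgue"
    unfolding eq using borel_measurable_integrable[OF u] by measurable
  then show ?thesis
  proof (rule Bochner_Integration.integrable_bound[OF integrable_mult_right[OF u, of C]])
    show "AE x in lebesgue. norm (u x * \<phi> x) \<le> norm (C * (indicator K x *\<^sub>R u x))"
      using C assms(4) by (intro AE_I2) (auto simp: abs_mult indicator_def intro!: mult_left_mono
          simp: mult.commute[of C])
  qed
qed

subsection \<open>Test functions\<close>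

abbreviation tests :: "(real^'n::finite \<Rightarrow> real) set" where
  "tests \<equiv> test_functions UNIV"

lemma test_functionsI:
  assumes "smooth \<phi>" "compact K" "K \<subseteq> \<Omega>" "\<And>x. x \<notin> K \<Longrightarrow> \<phi> x = 0"
  shows "\<phi> \<in> test_functions \<Omega>"
proof -
  have "closure {x. \<phi> x \<noteq> 0} \<subseteq> K"
    using assms(2,4) by (intro closure_minimal) (auto intro: compact_imp_closed)
  moreover from this have "compact (closure {x. \<phi> x \<noteq> 0})"
    using assms(2) by (meson bounded_subset closed_closure compact_eq_bounded_closed)
  ultimately show ?thesis
    using assms by (auto simp: test_functions_def smooth_def)
qed

lemma test_functionsE:
  assumes "\<phi> \<in> test_functions \<Omega>"
  obtains K where "compact K" "K \<subseteq> \<Omega>" "\<And>x. x \<notin> K \<Longrightarrow> \<phi> x = 0"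
proof
  show "compact (closure {x. \<phi> x \<noteq> 0})" "closure {x. \<phi> x \<noteq> 0} \<subseteq> \<Omega>"
    using assms by (auto simp: test_functions_def)
  show "\<phi> x = 0" if "x \<notin> closure {x. \<phi> x \<noteq> 0}" for x
    using that closure_subset[of "{x. \<phi> x \<noteq> 0}"] by auto
qed

lemma test_smooth: "\<phi> \<in> test_functions \<Omega> \<Longrightarrow> smooth \<phi>"
  by (simp add: test_functions_def smooth_def)

lemma test_mono: "\<phi> \<in> test_functions \<Omega> \<Longrightarrow> \<Omega> \<subseteq> \<Omega>' \<Longrightarrow> \<phi> \<in> test_functions \<Omega>'"
  by (auto simp: test_functions_def)

lemma test_zero: "(\<lambda>_. 0) \<in> test_functions \<Omega>"
  by (rule test_functionsI[of _ "{}"]) (auto simp: smooth_const)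

lemma test_add_scale:
  assumes "\<phi> \<in> test_functions \<Omega>" "\<psi> \<in> test_functions \<Omega>"
  shows "(\<lambda>x. \<phi> x + c * \<psi> x) \<in> test_functions \<Omega>"
proof -
  note smooth = test_smooth[OF assms(1)] test_smooth[OF assms(2)]
  obtain K where K: "compact K" "K \<subseteq> \<Omega>" "\<And>x. x \<notin> K \<Longrightarrow> \<phi> x = 0"
    using assms(1) by (rule test_functionsE) blast
  obtain L where L: "compact L" "L \<subseteq> \<Omega>" "\<And>x. x \<notin> L \<Longrightarrow> \<psi> x = 0"
    using assms(2) by (rule test_functionsE) blast
  show ?thesis
    by (rule test_functionsI[of _ "K \<union> L"])
       (use K L smooth in \<open>auto intro!: smooth_add_scale compact_Un\<close>)
qed

lemma test_mult:
  assumes "smooth \<eta>" "\<phi> \<in> test_functions \<Omega>"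
  shows "(\<lambda>x. \<eta> x * \<phi> x) \<in> test_functions \<Omega>"
proof -
  obtain K where K: "compact K" "K \<subseteq> \<Omega>" "\<And>x. x \<notin> K \<Longrightarrow> \<phi> x = 0"
    using assms(2) by (rule test_functionsE) blast
  show ?thesis
    by (rule test_functionsI[of _ K]) (use K assms in \<open>auto intro!: smooth_mult intro: test_smooth\<close>)
qed

lemma pderivative_eq_0_outside:
  assumes "closed K" "\<And>x. x \<notin> K \<Longrightarrow> \<phi> x = 0" "x \<notin> K"
  shows "pderivative i \<phi> x = 0"
proof -
  have "(\<phi> has_derivative (\<lambda>_. 0)) (at x)"
  proof (rule has_derivative_transform_within_open)
    show "((\<lambda>_. 0::real) has_derivative (\<lambda>_. 0)) (at x)" by simp
    show "open (- K)" "x \<in> - K" using assms by auto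
  qed (use assms in auto)
  from pderivative_eqI[OF this] show ?thesis .
qed

lemma gradient_eq_0_outside:
  assumes "closed K" "\<And>x. x \<notin> K \<Longrightarrow> \<phi> x = 0" "x \<notin> K"
  shows "gradient \<phi> x = 0"
  using pderivative_eq_0_outside[OF assms] by (simp add: gradient_def vec_eq_iff)

lemma test_pderivative:
  assumes "\<phi> \<in> test_functions \<Omega>"
  shows "pderivative i \<phi> \<in> test_functions \<Omega>"
proof -
  obtain K where K: "compact K" "K \<subseteq> \<Omega>" "\<And>x. x \<notin> K \<Longrightarrow> \<phi> x = 0"
    using assms by (rule test_functionsE) blast
  show ?thesis
    by (rule test_functionsI[of _ K])
       (use K assms in \<open>auto intro!: smooth_pderivative pderivative_eq_0_outside[of K]
          intro: test_smooth compact_imp_closed\<close>)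
qed

lemma test_reflect:
  assumes "\<phi> \<in> tests"
  shows "(\<lambda>x. \<phi> (a - x)) \<in> tests"
proof -
  obtain K where K: "compact K" "\<And>x. x \<notin> K \<Longrightarrow> \<phi> x = 0"
    using assms by (rule test_functionsE) blast
  show ?thesis
  proof (rule test_functionsI[of _ "(\<lambda>x. a - x) ` K"])
    show "compact ((\<lambda>x. a - x) ` K)"
      using K(1) by (intro compact_continuous_image continuous_intros)
    show "\<phi> (a - x) = 0" if "x \<notin> (\<lambda>x. a - x) ` K" for x
      using that K(2)[of "a - x"] by (metis diff_diff_cancel diff_add_cancel add_diff_cancel_left' diff_diff_eq2 image_eqI)
  qed (use assms in \<open>auto intro: smooth_reflect test_smooth\<close>)
qed

lemma test_bounded:
  assumes "\<phi> \<in> tests"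
  obtains C where "C > 0" "\<And>x. \<bar>\<phi> x\<bar> \<le> C"
proof -
  obtain K where K: "compact K" "\<And>x. x \<notin> K \<Longrightarrow> \<phi> x = 0"
    using assms by (rule test_functionsE) blast
  have "bounded (\<phi> ` K)"
    using K(1) test_smooth[OF assms]
    by (intro compact_imp_bounded compact_continuous_image smooth_continuous)
  then obtain C where C: "C > 0" "\<And>x. x \<in> K \<Longrightarrow> \<bar>\<phi> x\<bar> \<le> C"
    unfolding bounded_pos by auto
  then have "\<bar>\<phi> x\<bar> \<le> C" for x using K(2)[of x] by (cases "x \<in> K") auto
  then show thesis using that C(1) by blast
qed

lemma test_Lipschitz:
  assumes "\<phi> \<in> tests"
  obtains L where "L > 0" "\<And>x y. \<bar>\<phi> x - \<phi> y\<bar> \<le> L * norm (x - y)"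
proof -
  have "\<exists>C. \<forall>x. \<bar>pderivative i \<phi> x\<bar> \<le> C" for i
    using test_bounded[OF test_pderivative[OF assms, of i]] by metis
  then obtain C where C: "\<And>i x. \<bar>pderivative i \<phi> x\<bar> \<le> C i" by metis
  have le: "norm (gradient \<phi> x) \<le> sum C UNIV" for x
    using norm_le_l1_cart[of "gradient \<phi> x"] sum_mono[of UNIV "\<lambda>i. \<bar>pderivative i \<phi> x\<bar>" C] C
    by (auto simp: gradient_def intro: order_trans)
  show thesis
  proof
    have "0 \<le> sum C UNIV" using le norm_ge_zero order_trans by blast
    then show "sum C UNIV + 1 > 0" by simp
    fix x y
    have "norm (\<phi> x - \<phi> y) \<le> sum C UNIV * norm (x - y)"
    proof (rule differentiable_bound[of UNIV _ "\<lambda>x h. gradient \<phi> x \<bullet> h"])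
      show "onorm ((\<bullet>) (gradient \<phi> x)) \<le> sum C UNIV" for x
        using order_trans[OF Cauchy_Schwarz_ineq2 mult_right_mono[OF le norm_ge_zero]]
        by (intro onorm_le) simp
    qed (use smooth_has_derivative[OF test_smooth[OF assms]] in auto)
    then show "\<bar>\<phi> x - \<phi> y\<bar> \<le> (sum C UNIV + 1) * norm (x - y)"
      by (simp add: algebra_simps) (smt (verit) norm_ge_zero)
  qed
qed

text \<open>The gradient is globally Lipschitz, so the quadratic remainder is uniform in
  \<open>x\<close>. This uniformity is what differentiates convolutions.\<close>

lemma test_Taylor:
  assumes "\<phi> \<in> tests"
  obtains L where "L > 0" "\<And>x h. \<bar>\<phi> (x + h) - \<phi> x - gradient \<phi> x \<bullet> h\<bar> \<le> L * (norm h)\<^sup>2"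
proof -
  have "\<exists>C. \<forall>x y. \<bar>pderivative i \<phi> x - pderivative i \<phi> y\<bar> \<le> C * norm (x - y)" for i
    using test_Lipschitz[OF test_pderivative[OF assms, of i]] by metis
  then obtain C where C: "\<And>i x y. \<bar>pderivative i \<phi> x - pderivative i \<phi> y\<bar> \<le> C i * norm (x - y)" by metis
  have le: "norm (gradient \<phi> x - gradient \<phi> y) \<le> sum C UNIV * norm (x - y)" for x y
    using norm_le_l1_cart[of "gradient \<phi> x - gradient \<phi> y"]
      sum_mono[of UNIV "\<lambda>i. \<bar>pderivative i \<phi> x - pderivative i \<phi> y\<bar>" "\<lambda>i. C i * norm (x - y)"] C
    by (auto simp: gradient_def sum_distrib_right intro: order_trans)
  show thesis
  proof
    show "\<bar>sum C UNIV\<bar> + 1 > 0" by simp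
    fix x h
    have "norm (\<phi> (x + h) - \<phi> x - gradient \<phi> x \<bullet> (x + h - x)) \<le> norm (x + h - x) * ((\<bar>sum C UNIV\<bar> + 1) * norm h)"
    proof (rule differentiable_bound_linearization[where S = "cball x (norm h)" and f' = "\<lambda>x h. gradient \<phi> x \<bullet> h"])
      show "x + t *\<^sub>R (x + h - x) \<in> cball x (norm h)" if "t \<in> {0..1}" for t
        using that by (auto simp: dist_norm intro: mult_left_le_one_le)
      show "(\<phi> has_derivative (\<bullet>) (gradient \<phi> y)) (at y within cball x (norm h))" for y
        using smooth_has_derivative[OF test_smooth[OF assms]] by (rule has_derivative_at_withinI)
      show "onorm ((\<bullet>) (gradient \<phi> y) - (\<bullet>) (gradient \<phi> x)) \<le> (\<bar>sum C UNIV\<bar> + 1) * norm h"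
        if "y \<in> cball x (norm h)" for y
      proof (rule onorm_le)
        fix v
        have "norm (gradient \<phi> y - gradient \<phi> x) \<le> sum C UNIV * norm (y - x)" by (rule le)
        also have "\<dots> \<le> (\<bar>sum C UNIV\<bar> + 1) * norm h"
          using that by (intro mult_mono) (auto simp: dist_norm norm_minus_commute)
        finally have *: "norm (gradient \<phi> y - gradient \<phi> x) \<le> (\<bar>sum C UNIV\<bar> + 1) * norm h" .
        have "((\<bullet>) (gradient \<phi> y) - (\<bullet>) (gradient \<phi> x)) v = (gradient \<phi> y - gradient \<phi> x) \<bullet> v"
          by (simp add: inner_diff_left)
        then show "norm (((\<bullet>) (gradient \<phi> y) - (\<bullet>) (gradient \<phi> x)) v) \<le> (\<bar>sum C UNIV\<bar> + 1) * norm h * norm v"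
          using order_trans[OF Cauchy_Schwarz_ineq2 mult_right_mono[OF * norm_ge_zero[of v]]] by simp
      qed
    qed auto
    then show "\<bar>\<phi> (x + h) - \<phi> x - gradient \<phi> x \<bullet> h\<bar> \<le> (\<bar>sum C UNIV\<bar> + 1) * (norm h)\<^sup>2"
      by (simp add: power2_eq_square mult.left_commute)
  qed
qed

section \<open>Integrals of test functions, integration by parts and kernels\<close>

lemma locally_integrable_mult_test:
  "locally_integrable u \<Longrightarrow> \<phi> \<in> tests \<Longrightarrow> integrable lebesgue (\<lambda>x. u x * \<phi> x)"
  by (metis locally_integrable_mult smooth_continuous test_functionsE test_smooth)

lemma smooth_measurable: "smooth \<phi> \<Longrightarrow> \<phi> \<in> borel_measurable lebesgue"
  by (intro measurable_completion) (simp add: borel_measurable_continuous_onI smooth_continuous)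

lemma locally_integrable_const: "locally_integrable (\<lambda>_. c)"
  unfolding locally_integrable_def by (auto intro: absolutely_integrable_on_const lmeasurable_compact)

lemma test_integrable: "\<phi> \<in> tests \<Longrightarrow> integrable lebesgue \<phi>"
  using locally_integrable_mult_test[OF locally_integrable_const, of \<phi> 1] by simp

lemma test_L2: "\<phi> \<in> test_functions \<Omega> \<Longrightarrow> \<phi> \<in> L2 lebesgue"
  using test_integrable[OF test_mult[OF test_smooth test_mono[OF _ subset_UNIV]], of \<phi> \<Omega> \<phi> \<Omega>]
  by (simp add: L2_def smooth_measurable test_smooth power2_eq_square)

text \<open>Every difference quotient has integral 0 by translation invariance, and the quotients
  converge to the derivative, dominated by the Lipschitz constant on a ball. No iterated integration
  is involved.\<close>

lemma integral_pderivative_test: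
  fixes \<phi> :: "real^'n::finite \<Rightarrow> real"
  assumes "\<phi> \<in> tests"
  shows "(\<integral>x. pderivative i \<phi> x \<partial>lebesgue) = 0"
proof -
  obtain L where L: "L > 0" "\<And>x y. \<bar>\<phi> x - \<phi> y\<bar> \<le> L * norm (x - y)"
    using test_Lipschitz[OF assms] by blast
  obtain K where K: "compact K" "\<And>x. x \<notin> K \<Longrightarrow> \<phi> x = 0"
    using assms by (rule test_functionsE) blast
  then obtain R where R: "\<And>x. x \<in> K \<Longrightarrow> norm x \<le> R"
    using compact_imp_bounded[OF K(1)] unfolding bounded_iff by auto
  define d where "d n x = (\<phi> (inverse (real (Suc n)) *\<^sub>R axis i 1 + 1 *\<^sub>R x) - \<phi> x) / inverse (real (Suc n))" for n x
  have meas: "\<phi> \<in> borel_measurable lebesgue" using assms by (intro smooth_measurable test_smooth)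
  have int: "integrable lebesgue \<phi>" using assms by (rule test_integrable)
  have d_int: "integrable lebesgue (d n)" "integral\<^sup>L lebesgue (d n) = 0" for n
    unfolding d_def using integrable_isometry[OF _ int, of 1] integral_isometry[OF _ meas, of 1] int by auto
  \<comment> \<open>The shift has length at most 1, so all quotients vanish outside the ball of
    radius \<open>R + 1\<close>.\<close>
  have "(\<lambda>n. integral\<^sup>L lebesgue (d n)) \<longlonglongrightarrow> integral\<^sup>L lebesgue (pderivative i \<phi>)"
  proof (rule integral_dominated_convergence[where w = "\<lambda>x. L * indicator (cball 0 (R + 1)) x"])
    show "pderivative i \<phi> \<in> borel_measurable lebesgue"
      using assms by (intro smooth_measurable smooth_pderivative test_smooth)
    show "d n \<in> borel_measurable lebesgue" for n using d_int by auto
    show "integrable lebesgue (\<lambda>x. L * indicator (cball (0::real^'n) (R + 1)) x :: real)"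
      by (intro integrable_mult_right integrable_real_indicator)
         (use lmeasurable_cball[of "0::real^'n" "R+1"] in \<open>auto simp: fmeasurable_def\<close>)
    show "AE x in lebesgue. (\<lambda>n. d n x) \<longlonglongrightarrow> pderivative i \<phi> x"
    proof (rule AE_I2)
      fix x
      have "((\<lambda>t. \<phi> (t *\<^sub>R axis i 1 + x)) has_derivative (\<lambda>t. gradient \<phi> (0 *\<^sub>R axis i 1 + x) \<bullet> (t *\<^sub>R axis i 1))) (at 0)"
        by (rule has_derivative_compose[of "\<lambda>t. t *\<^sub>R axis i 1 + x" _ 0 UNIV \<phi>])
           (auto intro!: derivative_eq_intros smooth_has_derivative test_smooth[OF assms])
      then have "DERIV (\<lambda>t. \<phi> (t *\<^sub>R axis i 1 + x)) 0 :> pderivative i \<phi> x"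
        by (simp add: has_field_derivative_def gradient_def inner_axis mult.commute[of _ "pderivative i \<phi> x"] cong: if_cong)
      then have "((\<lambda>t. (\<phi> (t *\<^sub>R axis i 1 + x) - \<phi> x) / t) \<longlongrightarrow> pderivative i \<phi> x) (at 0)"
        by (simp add: has_field_derivative_iff)
      moreover have "filterlim (\<lambda>n. inverse (real (Suc n))) (at 0) sequentially"
        using LIMSEQ_inverse_real_of_nat by (auto simp: filterlim_at)
      ultimately show "(\<lambda>n. d n x) \<longlonglongrightarrow> pderivative i \<phi> x"
        unfolding d_def scaleR_one by (rule filterlim_compose)
    qed
    show "AE x in lebesgue. norm (d n x) \<le> L * indicator (cball 0 (R + 1)) x" for n
    proof (rule AE_I2)
      fix x
      let ?h = "inverse (real (Suc n)) *\<^sub>R axis i 1 :: real^'n"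
      have h: "norm ?h = inverse (real (Suc n))" by simp
      have h1: "inverse (real (Suc n)) \<le> 1" by (simp add: inverse_eq_divide)
      show "norm (d n x) \<le> L * indicator (cball 0 (R + 1)) x"
      proof (cases "norm x \<le> R + 1")
        case True
        have "\<bar>\<phi> (?h + x) - \<phi> x\<bar> \<le> L * inverse (real (Suc n))"
          using L(2)[of "?h + x" x] h by simp
        then have "\<bar>\<phi> (?h + x) - \<phi> x\<bar> / inverse (real (Suc n)) \<le> L"
          by (subst pos_divide_le_eq) auto
        then show ?thesis using True by (simp only: d_def) (simp add: abs_divide)
      next
        case False
        have "norm x \<le> norm (?h + x) + norm ?h" using norm_triangle_ineq4[of "?h + x" ?h] by simp
        then have "\<not> norm (?h + x) \<le> R" "\<not> norm x \<le> R" using False h h1 by linarith+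
        then have "\<phi> (?h + x) = 0" "\<phi> x = 0" using K(2) R by blast+
        then show ?thesis using False by (simp add: d_def)
      qed
    qed
  qed
  then show ?thesis using d_int by (simp add: LIMSEQ_const_iff)
qed

lemma integral_by_parts_test:
  assumes "smooth \<eta>" "\<phi> \<in> tests"
  shows "(\<integral>x. \<eta> x * pderivative i \<phi> x \<partial>lebesgue) = - (\<integral>x. pderivative i \<eta> x * \<phi> x \<partial>lebesgue)"
proof -
  have "0 = (\<integral>x. pderivative i (\<lambda>x. \<eta> x * \<phi> x) x \<partial>lebesgue)"
    by (simp add: integral_pderivative_test test_mult assms)
  also have "\<dots> = (\<integral>x. pderivative i \<eta> x * \<phi> x + \<eta> x * pderivative i \<phi> x \<partial>lebesgue)"
    using assms by (simp add: pderivative_mult smooth_differentiable test_smooth)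
  also have "\<dots> = (\<integral>x. pderivative i \<eta> x * \<phi> x \<partial>lebesgue) + (\<integral>x. \<eta> x * pderivative i \<phi> x \<partial>lebesgue)"
    using assms by (intro Bochner_Integration.integral_add test_integrable test_mult smooth_pderivative test_pderivative)
  finally show ?thesis by simp
qed

text \<open>The normalised bump \<open>exp (- 1 / (e^2 - |x - a|^2))\<close>. The centre is
  arbitrary because kernels away from the origin are used later to translate while
  smoothing.\<close>

lemma exists_kernel:
  fixes a :: "real^'n::finite"
  assumes "e > 0"
  obtains k where "k \<in> tests" "\<And>x. 0 \<le> k x" "\<And>x. x \<notin> cball a e \<Longrightarrow> k x = 0"
    "integral\<^sup>L lebesgue k = 1"
proof -
  define b where "b x = flat [:1:] (e\<^sup>2 - (x - a) \<bullet> (x - a))" for x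
  have b0: "b x = 0" if "x \<notin> cball a e" for x
  proof -
    have "norm (x - a) > e" using that by (simp add: dist_norm norm_minus_commute)
    then have "e\<^sup>2 < (norm (x - a))\<^sup>2" using assms by (intro power_strict_mono) auto
    then show ?thesis by (simp add: b_def flat_def power2_norm_eq_inner)
  qed
  have b_pos: "b x > 0" if "x \<in> ball a e" for x
  proof -
    have "norm (x - a) < e" using that by (simp add: dist_norm norm_minus_commute)
    then have "(norm (x - a))\<^sup>2 < e\<^sup>2" by (intro power_strict_mono) auto
    then show ?thesis by (simp add: b_def flat_def power2_norm_eq_inner)
  qed
  have b_nonneg: "0 \<le> b x" for x by (simp add: b_def flat_def)
  have "smooth b"
    unfolding b_def by (intro smooth_flat smooth_diff smooth_const smooth_dist_square)
  then have b: "b \<in> tests"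
    using b0 by (intro test_functionsI[of b "cball a e"]) auto
  \<comment> \<open>A vanishing integral would make the open ball negligible, as \<open>b\<close> is
    positive there.\<close>
  have "integral\<^sup>L lebesgue b \<noteq> 0"
  proof
    assume "integral\<^sup>L lebesgue b = 0"
    then have "AE x in lebesgue. b x = 0"
      using integral_nonneg_eq_0_iff_AE[OF test_integrable[OF b]] b_nonneg by simp
    then have "AE x in lebesgue. x \<notin> ball a e"
      by eventually_elim (use b_pos in fastforce)
    then have "negligible (ball a e)"
      by (simp add: negligible_iff_null_sets AE_iff_null_sets)
    then show False using assms open_not_negligible[of "ball a e"] by simp
  qed
  then have I: "integral\<^sup>L lebesgue b > 0"
    using integral_nonneg_AE[of b lebesgue] b_nonneg by fastforce
  show thesis
  proof (rule that)
    show "(\<lambda>x. inverse (integral\<^sup>L lebesgue b) * b x) \<in> tests"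
      by (intro test_mult smooth_const b)
  qed (use I b0 b_nonneg in auto)
qed

subsection \<open>Convolution\<close>

definition conv :: "('a::euclidean_space \<Rightarrow> real) \<Rightarrow> ('a \<Rightarrow> real) \<Rightarrow> 'a \<Rightarrow> real" where
  "conv u k x = (\<integral>y. u y * k (x - y) \<partial>lebesgue)"

lemma conv_integrable:
  "locally_integrable u \<Longrightarrow> k \<in> tests \<Longrightarrow> integrable lebesgue (\<lambda>y. u y * k (x - y))"
  by (intro locally_integrable_mult_test test_reflect)

text \<open>The uniform Taylor remainder of \<open>k\<close>, integrated against \<open>|u|\<close>
  over one fixed ball, is of order \<open>|h|^2\<close>. Differentiation under the integral thus
  follows without a limit theorem.\<close>

lemma has_derivative_conv:
  fixes u :: "real^'n::finite \<Rightarrow> real"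
  assumes u: "locally_integrable u" and k: "k \<in> tests"
  shows "(conv u k has_derivative (\<lambda>h. \<Sum>i\<in>UNIV. h $ i * conv u (pderivative i k) x)) (at x)"
proof -
  obtain K where K: "compact K" "\<And>x. x \<notin> K \<Longrightarrow> k x = 0"
    using k by (rule test_functionsE) blast
  then obtain R where R: "\<And>x. x \<in> K \<Longrightarrow> norm x \<le> R"
    using compact_imp_bounded[OF K(1)] unfolding bounded_iff by auto
  obtain L where L: "L > 0" "\<And>x h. \<bar>k (x + h) - k x - gradient k x \<bullet> h\<bar> \<le> L * (norm h)\<^sup>2"
    using test_Taylor[OF k] by blast
  \<comment> \<open>For \<open>|h| <= 1\<close> both \<open>k (x - z)\<close> and
    \<open>k (x + h - z)\<close> vanish once \<open>|z| > Q\<close>.\<close>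
  define Q where "Q = R + norm x + 1"
  define I where "I = (\<integral>z. norm (indicator (cball 0 Q) z *\<^sub>R u z) \<partial>lebesgue)"
  have uQ: "integrable lebesgue (\<lambda>z. indicator (cball 0 Q) z *\<^sub>R u z)"
    using u by (simp add: locally_integrable_def set_integrable_def)
  have I: "I \<ge> 0" unfolding I_def by (intro integral_nonneg_AE) auto
  have int: "integrable lebesgue (\<lambda>y. u y * k (z - y))" for z
    by (rule conv_integrable[OF u k])
  have int': "integrable lebesgue (\<lambda>y. u y * pderivative i k (z - y))" for z i
    by (rule conv_integrable[OF u test_pderivative[OF k]])
  have est: "\<bar>conv u k (x + h) - conv u k x - (\<Sum>i\<in>UNIV. h $ i * conv u (pderivative i k) x)\<bar> \<le> L * (norm h)\<^sup>2 * I"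
    if h: "norm h \<le> 1" for h
  proof -
    let ?R = "\<lambda>z. k (x - z + h) - k (x - z) - gradient k (x - z) \<bullet> h"
    have eq: "u z * k (x + h - z) - u z * k (x - z) - (\<Sum>i\<in>UNIV. h $ i * (u z * pderivative i k (x - z)))
      = u z * ?R z" for z
      by (simp add: algebra_simps gradient_def inner_vec_def sum_distrib_left)
    have "integrable lebesgue (\<lambda>z. u z * k (x + h - z) - u z * k (x - z) - (\<Sum>i\<in>UNIV. h $ i * (u z * pderivative i k (x - z))))"
      by (intro Bochner_Integration.integrable_diff Bochner_Integration.integrable_sum integrable_mult_right int int')
    then have int_rem: "integrable lebesgue (\<lambda>z. u z * ?R z)"
      unfolding eq .
    have "conv u k (x + h) - conv u k x - (\<Sum>i\<in>UNIV. h $ i * conv u (pderivative i k) x)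
      = (\<integral>z. u z * k (x + h - z) - u z * k (x - z) - (\<Sum>i\<in>UNIV. h $ i * (u z * pderivative i k (x - z))) \<partial>lebesgue)"
      unfolding conv_def using int int' by simp
    also have "\<dots> = (\<integral>z. u z * ?R z \<partial>lebesgue)"
      unfolding eq ..
    also have "\<bar>\<dots>\<bar> \<le> (\<integral>z. L * (norm h)\<^sup>2 * norm (indicator (cball 0 Q) z *\<^sub>R u z) \<partial>lebesgue)"
    proof (rule Bochner_Integration.integral_abs_bound_integral[OF int_rem])
        fix z
        show "\<bar>u z * ?R z\<bar>
          \<le> L * (norm h)\<^sup>2 * norm (indicator (cball 0 Q) z *\<^sub>R u z)"
        proof (cases "norm z \<le> Q")
          case True
          then show ?thesis
            using mult_left_mono[OF L(2)[of "x - z" h] abs_ge_zero[of "u z"]] by (simp add: abs_mult mult_ac)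
        next
          case False
          have "norm z \<le> norm (x - z) + norm x" "norm z \<le> norm (x - z + h) + norm x + norm h"
            by norm+
          then have "\<not> norm (x - z) \<le> R" "\<not> norm (x - z + h) \<le> R"
            using False h unfolding Q_def by linarith+
          then have "x - z \<notin> K" "x - z + h \<notin> K" using R by blast+
          then show ?thesis
            using K(2) gradient_eq_0_outside[of K k "x - z"] compact_imp_closed[OF K(1)] L(1)
            by (simp add: mult_nonneg_nonneg)
        qed
    qed (use uQ in auto)
    also have "\<dots> = L * (norm h)\<^sup>2 * I" using uQ by (simp add: I_def)
    finally show ?thesis .
  qed
  let ?rem = "\<lambda>y. conv u k y - conv u k x - (\<Sum>i\<in>UNIV. (y - x) $ i * conv u (pderivative i k) x)"
  show ?thesis
    unfolding has_derivative_at_alt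
  proof (intro conjI allI impI)
    show "bounded_linear (\<lambda>h. \<Sum>i\<in>UNIV. h $ i * conv u (pderivative i k) x)"
      by (intro bounded_linear_sum bounded_linear_mult_const bounded_linear_vec_nth)
    fix e :: real assume e: "e > 0"
    have pos: "L * I + 1 > 0" using L I by (simp add: add_nonneg_pos)
    show "\<exists>d>0. \<forall>y. norm (y - x) < d \<longrightarrow>
      norm (?rem y) \<le> e * norm (y - x)"
    proof (intro exI conjI allI impI)
      show "min 1 (e / (L * I + 1)) > 0" using e pos by simp
      fix y assume y: "norm (y - x) < min 1 (e / (L * I + 1))"
      have "norm (y - x) * (L * I) \<le> norm (y - x) * (L * I + 1)" by (intro mult_left_mono) auto
      also have "\<dots> \<le> e" using y pos by (simp add: field_simps)
      finally have le: "norm (y - x) * (L * I) \<le> e" .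
      have "norm (?rem y)
        \<le> L * (norm (y - x))\<^sup>2 * I"
        using est[of "y - x"] y by simp
      also have "\<dots> = norm (y - x) * (L * I) * norm (y - x)" by (simp add: power2_eq_square mult_ac)
      also have "\<dots> \<le> e * norm (y - x)" by (intro mult_right_mono le) auto
      finally show "norm (?rem y)
        \<le> e * norm (y - x)" .
    qed
  qed
qed

lemma pderivative_conv:
  assumes "locally_integrable u" "k \<in> tests"
  shows "pderivative i (conv u k) = conv u (pderivative i k)"
proof
  fix x
  have "pderivative i (conv u k) x = (\<Sum>j\<in>UNIV. axis i 1 $ j * conv u (pderivative j k) x)"
    by (rule pderivative_eqI[OF has_derivative_conv[OF assms]])
  also have "\<dots> = conv u (pderivative i k) x"
    by (simp add: axis_def if_distrib[of "\<lambda>x. x * _"] cong: if_cong)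
  finally show "pderivative i (conv u k) x = conv u (pderivative i k) x" .
qed

lemma smooth_conv:
  assumes "locally_integrable u" "k \<in> tests"
  shows "smooth (conv u k)"
proof -
  have "C_k j (conv u k)" if "k \<in> tests" for j k
    using that
  proof (induction j arbitrary: k)
    case 0
    then show ?case
      using has_derivative_conv[OF assms(1) 0]
      by (auto intro!: continuous_at_imp_continuous_on has_derivative_continuous)
  next
    case (Suc j)
    then show ?case
      using has_derivative_conv[OF assms(1) Suc.prems]
      by (auto simp: pderivative_conv[OF assms(1)] test_pderivative differentiable_def)
  qed
  then show ?thesis using assms(2) by (simp add: smooth_def)
qed

lemma conv_eq_0:
  assumes "AE y in lebesgue. y \<notin> S \<longrightarrow> u y = 0" "\<And>z. z \<notin> T \<Longrightarrow> k z = 0"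
    and "\<And>s t. s \<in> S \<Longrightarrow> t \<in> T \<Longrightarrow> x \<noteq> s + t"
  shows "conv u k x = 0"
proof -
  have "AE y in lebesgue. u y * k (x - y) = 0"
    using assms(1)
  proof eventually_elim
    case (elim y)
    have "y \<in> S \<Longrightarrow> x - y \<notin> T" using assms(3)[of y "x - y"] by auto
    then show ?case using elim assms(2)[of "x - y"] by auto
  qed
  then show ?thesis unfolding conv_def by (rule integral_eq_zero_AE)
qed

lemma conv_test:
  fixes u :: "real^'n::finite \<Rightarrow> real"
  assumes "locally_integrable u" "k \<in> tests"
    and "compact S" "AE y in lebesgue. y \<notin> S \<longrightarrow> u y = 0"
    and "compact T" "\<And>z. z \<notin> T \<Longrightarrow> k z = 0"
    and sub: "\<And>s t. s \<in> S \<Longrightarrow> t \<in> T \<Longrightarrow> s + t \<in> \<Omega>"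
  shows "conv u k \<in> test_functions \<Omega>"
proof (rule test_functionsI)
  show "smooth (conv u k)" by (rule smooth_conv[OF assms(1,2)])
  show "compact {s + t |s t. s \<in> S \<and> t \<in> T}" by (rule compact_sums[OF assms(3,5)])
  show "{s + t |s t. s \<in> S \<and> t \<in> T} \<subseteq> \<Omega>" using sub by auto
  show "conv u k x = 0" if "x \<notin> {s + t |s t. s \<in> S \<and> t \<in> T}" for x
    by (rule conv_eq_0[OF assms(4,6)]) (use that in auto)
qed

lemma integral_reflect:
  fixes f :: "'a::euclidean_space \<Rightarrow> real"
  assumes "f \<in> borel_measurable lebesgue"
  shows "(\<integral>y. f (x - y) \<partial>lebesgue) = (\<integral>y. f y \<partial>lebesgue)"
  using integral_isometry[OF _ assms, of "-1" x] by simp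

text \<open>The indicator of the \<open>e/3\<close>-neighbourhood of \<open>K\<close> is averaged by
  a kernel of radius \<open>e/3\<close>: at points of \<open>K\<close> the average sees only the
  value 1, and the support stays within distance \<open>2e/3\<close> of \<open>K\<close>.\<close>

lemma smooth_cutoff:
  fixes K :: "(real^'n::finite) set"
  assumes K: "compact K" "open U" "K \<subseteq> U"
  obtains \<phi> where "\<phi> \<in> test_functions U" "\<And>x. 0 \<le> \<phi> x" "\<And>x. \<phi> x \<le> 1" "\<And>x. x \<in> K \<Longrightarrow> \<phi> x = 1"
proof -
  obtain e where e: "e > 0" "(\<Union>x\<in>K. ball x e) \<subseteq> U"
    using compact_subset_open_imp_ball_epsilon_subset[OF K] by blast
  obtain k where k: "k \<in> tests" "\<And>x. 0 \<le> k x" "\<And>x. x \<notin> cball (0::real^'n) (e/3) \<Longrightarrow> k x = 0"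
      "integral\<^sup>L lebesgue k = 1"
    using exists_kernel[of "e/3" "0::real^'n"] e(1) by force
  define S where "S = {x + y |x y. x \<in> K \<and> y \<in> cball 0 (e/3)}"
  have S: "compact S" unfolding S_def by (intro compact_sums K compact_cball)
  define u where "u = (indicator S :: real^'n \<Rightarrow> real)"
  have u: "locally_integrable u"
  proof (rule L2_locally_integrable)
    have "S \<in> lmeasurable" using S by (rule lmeasurable_compact)
    then have "integrable lebesgue (indicator S :: real^'n \<Rightarrow> real)"
      unfolding fmeasurable_def by (intro integrable_real_indicator) auto
    moreover have "(\<lambda>x. (norm (indicator S x :: real))\<^sup>2) = indicator S" by (auto simp: indicator_def)
    ultimately show "u \<in> L2 lebesgue" unfolding u_def L2_def by auto
  qed
  have int: "integrable lebesgue (\<lambda>y. u y * k (x - y))" for x by (rule conv_integrable[OF u k(1)])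
  have k_int: "integrable lebesgue (\<lambda>y. k (x - y))" for x
    by (intro test_integrable test_reflect k(1))
  have k_1: "(\<integral>y. k (x - y) \<partial>lebesgue) = 1" for x
    using integral_reflect[OF smooth_measurable[OF test_smooth[OF k(1)]]] k(4) by simp
  show thesis
  proof (rule that)
    show "conv u k \<in> test_functions U"
    proof (rule conv_test[OF u k(1) S _ compact_cball k(3)])
      show "AE y in lebesgue. y \<notin> S \<longrightarrow> u y = 0" by (simp add: u_def)
      fix s t assume "s \<in> S" "t \<in> cball (0::real^'n) (e/3)"
      then obtain x y where "x \<in> K" "norm y \<le> e/3" "norm t \<le> e/3" "s = x + y" by (auto simp: S_def)
      moreover from this have "norm (y + t) < e" using norm_triangle_ineq[of y t] e(1) by linarith
      ultimately have "s + t \<in> ball x e" by (simp add: dist_norm norm_minus_commute add.assoc add.commute[of t])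
      then show "s + t \<in> U" using e(2) \<open>x \<in> K\<close> by blast
    qed
    show "0 \<le> conv u k x" for x
      unfolding conv_def by (intro integral_nonneg_AE) (simp add: u_def k)
    have "conv u k x \<le> (\<integral>y. k (x - y) \<partial>lebesgue)" for x
      unfolding conv_def by (intro integral_mono int k_int) (simp add: u_def indicator_def k)
    then show "conv u k x \<le> 1" for x by (simp add: k_1)
    show "conv u k x = 1" if "x \<in> K" for x
    proof -
      have "u y * k (x - y) = k (x - y)" for y
      proof (cases "norm (x - y) \<le> e/3")
        case True
        then have "x + (y - x) \<in> S" unfolding S_def using that
          by (intro CollectI exI[of _ x] exI[of _ "y - x"]) (auto simp: norm_minus_commute)
        then show ?thesis by (simp add: u_def)
      next
        case False
        then show ?thesis using k(3)[of "x - y"] by simp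
      qed
      then have "conv u k x = (\<integral>y. k (x - y) \<partial>lebesgue)" unfolding conv_def by presburger
      then show ?thesis by (simp add: k_1)
    qed
  qed
qed

subsection \<open>The fundamental lemma of the calculus of variations\<close>

lemma locally_integrable_measurable:
  fixes u :: "'a::euclidean_space \<Rightarrow> 'b::euclidean_space"
  assumes "locally_integrable u"
  shows "u \<in> borel_measurable lebesgue"
proof (rule borel_measurable_LIMSEQ_metric)
  show "(\<lambda>x. indicator (cball 0 (real n)) x *\<^sub>R u x) \<in> borel_measurable lebesgue" for n
    using assms borel_measurable_integrable compact_cball
    unfolding locally_integrable_def set_integrable_def by blast
  fix x :: 'a
  obtain N where "norm x \<le> real N" using real_arch_simple by blast
  then have "\<forall>\<^sub>F n in sequentially. indicator (cball 0 (real n)) x *\<^sub>R u x = u x"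
    by (intro eventually_sequentiallyI[of N]) (auto simp: indicator_def)
  then show "(\<lambda>n. indicator (cball 0 (real n)) x *\<^sub>R u x) \<longlonglongrightarrow> u x"
    by (rule tendsto_eventually)
qed

text \<open>Inner regularity: up to measure \<open>e\<close>, the part of a ball where
  \<open>d > 0\<close> is a compact set \<open>T\<close>. The integral of the positive function
  \<open>d\<close> over \<open>T\<close> is 0, so \<open>T\<close> is null and the whole part has
  measure at most \<open>e\<close>.\<close>

lemma AE_nonpos_if_compact_integrals_zero:
  fixes d :: "'a::euclidean_space \<Rightarrow> real"
  assumes d: "locally_integrable d" and 0: "\<And>K. compact K \<Longrightarrow> (\<integral>x. indicator K x * d x \<partial>lebesgue) = 0"
  shows "AE x in lebesgue. d x \<le> 0"
proof -
  have meas [measurable]: "d \<in> borel_measurable lebesgue" by (rule locally_integrable_measurable[OF d])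
  have "AE x in lebesgue. \<not> (x \<in> cball 0 (real n) \<and> d x > 0)" for n
  proof -
    define S where "S = {x \<in> cball 0 (real n). d x > 0}"
    have "S = {x \<in> space lebesgue. x \<in> cball 0 (real n) \<and> d x > 0}" by (auto simp: S_def)
    also have "\<dots> = cball 0 (real n) \<inter> (d -` {0<..} \<inter> space lebesgue)" by auto
    also have "\<dots> \<in> sets lebesgue"
      using measurable_sets[OF meas, of "{0<..}"] by (intro sets.Int) auto
    finally have S: "S \<in> sets lebesgue" .
    have "emeasure lebesgue S \<le> ennreal e" if e: "e > 0" for e
    proof -
      obtain T where T: "closed T" "T \<subseteq> S" "S - T \<in> lmeasurable" "emeasure lebesgue (S - T) < ennreal e"
        using sets_lebesgue_inner_closed[OF S e] by blast
      have "T \<subseteq> cball 0 (real n)" using T(2) by (auto simp: S_def)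
      then have "bounded T" by (rule bounded_subset[OF bounded_cball])
      then have K: "compact T" using T(1) by (simp add: compact_eq_bounded_closed)
      have "integrable lebesgue (\<lambda>x. indicator T x * d x)"
        using d K by (simp add: locally_integrable_def set_integrable_def)
      moreover have nn: "0 \<le> indicator T x * d x" for x
        using T(2) by (auto simp: indicator_def S_def less_imp_le)
      ultimately have "AE x in lebesgue. indicator T x * d x = 0"
        by (subst integral_nonneg_eq_0_iff_AE[symmetric]) (use 0[OF K] in auto)
      then have "AE x in lebesgue. x \<notin> T"
        by eventually_elim (use T(2) in \<open>auto simp: indicator_def S_def\<close>)
      then have "T \<in> null_sets lebesgue"
        using AE_iff_null_sets[OF fmeasurableD[OF lmeasurable_compact[OF K]]] by blast
      then have "emeasure lebesgue ((S - T) \<union> T) = emeasure lebesgue (S - T)"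
        using T(3) by (intro emeasure_Un_null_set) auto
      moreover have "(S - T) \<union> T = S" using T(2) by auto
      ultimately show ?thesis using T(4) by simp
    qed
    then have "emeasure lebesgue S \<le> 0 + ennreal e" if "e > 0" for e
      unfolding add_0 using that .
    then have "emeasure lebesgue S \<le> 0"
      by (rule ennreal_le_epsilon)
    then have "S \<in> null_sets lebesgue" using S by (intro null_setsI) auto
    from AE_not_in[OF this] show ?thesis by (simp add: S_def)
  qed
  then have "AE x in lebesgue. \<forall>n. \<not> (x \<in> cball 0 (real n) \<and> d x > 0)"
    by (subst AE_all_countable) blast
  then show ?thesis
  proof eventually_elim
    case (elim x)
    obtain n where "norm x \<le> real n" using real_arch_simple by blast
    then show ?case using elim by (auto simp: not_less)
  qed
qed

text \<open>Cutoffs equal to 1 on \<open>K\<close> and supported in shrinking neighbourhoods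
  converge to the indicator of \<open>K\<close>. By dominated convergence \<open>d\<close>
  integrates to 0 over every compact set, and the preceding lemma applies to \<open>d\<close> and to
  \<open>- d\<close>.\<close>

lemma fundamental_lemma:
  fixes d :: "real^'n::finite \<Rightarrow> real"
  assumes d: "locally_integrable d"
    and 0: "\<And>\<phi>. \<phi> \<in> tests \<Longrightarrow> (\<integral>x. d x * \<phi> x \<partial>lebesgue) = 0"
  shows "AE x in lebesgue. d x = 0"
proof -
  have *: "(\<integral>x. indicator K x * d x \<partial>lebesgue) = 0" if K: "compact K" for K
  proof -
    have "\<exists>\<phi>. \<phi> \<in> test_functions (\<Union>x\<in>K. ball x (inverse (real (Suc n)))) \<and> (\<forall>x. 0 \<le> \<phi> x) \<and> (\<forall>x. \<phi> x \<le> 1) \<and>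
      (\<forall>x\<in>K. \<phi> x = 1)" for n
    proof -
      have "K \<subseteq> (\<Union>x\<in>K. ball x (inverse (real (Suc n))))" by auto
      then show ?thesis
        by (rule smooth_cutoff[OF K, of "\<Union>x\<in>K. ball x (inverse (real (Suc n)))", rotated]) auto
    qed
    then obtain \<phi> where \<phi>: "\<And>n. \<phi> n \<in> test_functions (\<Union>x\<in>K. ball x (inverse (real (Suc n))))"
        "\<And>n x. 0 \<le> \<phi> n x" "\<And>n x. \<phi> n x \<le> 1" "\<And>n x. x \<in> K \<Longrightarrow> \<phi> n x = 1"
      by metis
    have \<phi>0: "\<phi> n x = 0" if "\<And>y. y \<in> K \<Longrightarrow> dist y x \<ge> inverse (real (Suc n))" for n x
    proof -
      obtain T where T: "T \<subseteq> (\<Union>x\<in>K. ball x (inverse (real (Suc n))))" "\<And>x. x \<notin> T \<Longrightarrow> \<phi> n x = 0"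
        using \<phi>(1)[of n] by (rule test_functionsE) blast
      have "x \<notin> T" using T(1) that by fastforce
      then show ?thesis by (rule T(2))
    qed
    obtain R where R: "\<And>x. x \<in> K \<Longrightarrow> norm x \<le> R"
      using compact_imp_bounded[OF K] unfolding bounded_iff by auto
    have test: "\<phi> n \<in> tests" for n using \<phi>(1) by (rule test_mono) auto
    have dR: "integrable lebesgue (\<lambda>x. indicator (cball 0 (R + 1)) x *\<^sub>R d x)"
      using d by (simp add: locally_integrable_def set_integrable_def)
    have "(\<lambda>n. \<integral>x. d x * \<phi> n x \<partial>lebesgue) \<longlonglongrightarrow> (\<integral>x. indicator K x * d x \<partial>lebesgue)"
    proof (rule integral_dominated_convergence[where w = "\<lambda>x. norm (indicator (cball 0 (R + 1)) x *\<^sub>R d x)"])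
      show "(\<lambda>x. indicator K x * d x) \<in> borel_measurable lebesgue"
        using d K borel_measurable_integrable by (fastforce simp: locally_integrable_def set_integrable_def)
      show "(\<lambda>x. d x * \<phi> n x) \<in> borel_measurable lebesgue" for n
        using locally_integrable_mult_test[OF d test] by auto
      show "integrable lebesgue (\<lambda>x. norm (indicator (cball 0 (R + 1)) x *\<^sub>R d x))"
        using dR by (rule integrable_norm)
      show "AE x in lebesgue. (\<lambda>n. d x * \<phi> n x) \<longlonglongrightarrow> indicator K x * d x"
      proof (rule AE_I2)
        fix x
        show "(\<lambda>n. d x * \<phi> n x) \<longlonglongrightarrow> indicator K x * d x"
        proof (cases "x \<in> K")
          case True
          then show ?thesis using \<phi>(4) by simp
        next
          case False
          have "open (- K)" using compact_imp_closed[OF K] by (rule open_Compl)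
          then obtain e where e: "e > 0" "ball x e \<subseteq> - K"
            using False by (metis ComplI open_contains_ball)
          then obtain N where N: "inverse (real (Suc N)) < e" using reals_Archimedean by blast
          have "\<phi> n x = 0" if "n \<ge> N" for n
          proof (rule \<phi>0)
            fix y assume "y \<in> K"
            then have "dist y x \<ge> e" using e(2) by (auto simp: dist_commute not_less[symmetric])
            moreover have "inverse (real (Suc n)) \<le> inverse (real (Suc N))"
              using that by (intro le_imp_inverse_le) auto
            ultimately show "dist y x \<ge> inverse (real (Suc n))" using N by linarith
          qed
          then have "\<forall>\<^sub>F n in sequentially. d x * \<phi> n x = indicator K x * d x"
            using False by (intro eventually_sequentiallyI[of N]) simp
          then show ?thesis by (rule tendsto_eventually)
        qed
      qed
      show "AE x in lebesgue. norm (d x * \<phi> n x) \<le> norm (indicator (cball 0 (R + 1)) x *\<^sub>R d x)" for n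
      proof (rule AE_I2)
        fix x
        show "norm (d x * \<phi> n x) \<le> norm (indicator (cball 0 (R + 1)) x *\<^sub>R d x)"
        proof (cases "norm x \<le> R + 1")
          case True
          then show ?thesis using \<phi>(2,3)[of n x] by (simp add: abs_mult mult_left_le)
        next
          case False
          have "\<phi> n x = 0"
          proof (rule \<phi>0)
            fix y assume "y \<in> K"
            then have "dist y x \<ge> 1" using R[of y] False norm_triangle_ineq2[of x y]
              by (simp add: dist_norm norm_minus_commute)
            moreover have "inverse (real (Suc n)) \<le> 1" by (simp add: inverse_eq_divide)
            ultimately show "dist y x \<ge> inverse (real (Suc n))" by linarith
          qed
          then show ?thesis by simp
        qed
      qed
    qed
    then show ?thesis using 0[OF test] by (simp add: LIMSEQ_const_iff)
  qed
  have neg: "locally_integrable (\<lambda>x. - d x)"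
    using d by (simp add: locally_integrable_def set_integrable_def)
  have "AE x in lebesgue. d x \<le> 0" by (rule AE_nonpos_if_compact_integrals_zero[OF d *])
  moreover have "AE x in lebesgue. - d x \<le> 0"
    by (rule AE_nonpos_if_compact_integrals_zero[OF neg]) (simp add: *)
  ultimately show ?thesis by eventually_elim simp
qed

text \<open>The fundamental lemma says that a function orthogonal to all test functions is 0 almost
  everywhere, which is the hypothesis of the abstract density lemma.\<close>

lemma L2_test_dense:
  fixes w :: "real^'n::finite \<Rightarrow> real"
  assumes "w \<in> L2 lebesgue" "e > 0"
  obtains \<phi> where "\<phi> \<in> tests" "L2_norm lebesgue (\<lambda>x. w x - \<phi> x) < e"
proof (rule L2.dense_if_orthogonal_zero[OF L2_complete, where D = "tests" and w = w and e = e])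
  show "L2_inner lebesgue w w = 0" if w: "w \<in> L2 lebesgue" and
      0: "\<And>v. v \<in> tests \<Longrightarrow> L2_inner lebesgue w v = 0" for w :: "real^'n \<Rightarrow> real"
  proof -
    have "AE x in lebesgue. w x = 0"
      by (rule fundamental_lemma[OF L2_locally_integrable[OF w]])
         (use 0 in \<open>simp add: L2_inner_def\<close>)
    then show ?thesis unfolding L2_inner_def by (intro integral_eq_zero_AE) auto
  qed
qed (use assms that test_L2 test_zero test_add_scale in \<open>auto simp: L2_norm_eq_inner\<close>)

text \<open>With a test function \<psi> close to \<open>w\<close>, the square of the norm of
  \<open>w\<close> is nearly the product of \<open>w\<close> and \<psi>, hence at most about
  \<open>C\<close> times the norm of \<open>w\<close>.\<close>

lemma L2_norm_le_by_duality:
  fixes w :: "real^'n::finite \<Rightarrow> real"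
  assumes w: "w \<in> L2 lebesgue"
    and C: "\<And>\<psi>. \<psi> \<in> tests \<Longrightarrow> L2_inner lebesgue w \<psi> \<le> C * L2_norm lebesgue \<psi>" "C \<ge> 0"
  shows "L2_norm lebesgue w \<le> C"
proof -
  let ?N = "L2_norm lebesgue"
  have "?N w * ?N w \<le> C * ?N w + e" if e: "e > 0" for e
  proof -
    have pos: "?N w + C + 1 > 0" using C(2) L2_norm_nonneg[of lebesgue w] by linarith
    \<comment> \<open>The two replacements of \<open>w\<close> by \<psi> cost \<open>e'\<close>
      times the norm of \<open>w\<close> and \<open>C * e'\<close>; the summand 1 keeps the
      denominator positive.\<close>
    define e' where "e' = e / (?N w + C + 1)"
    have "e' > 0" using e pos by (simp add: e'_def)
    then obtain \<psi> where \<psi>: "\<psi> \<in> tests" "?N (\<lambda>x. w x - \<psi> x) < e'"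
      using L2_test_dense[OF w] by blast
    have \<psi>L: "\<psi> \<in> L2 lebesgue" by (rule test_L2[OF \<psi>(1)])
    have "?N w * ?N w = L2_inner lebesgue w w"
      by (simp add: L2_norm_eq_inner L2.form_nonneg w)
    also have "\<dots> = L2_inner lebesgue (\<lambda>x. w x - \<psi> x) w + L2_inner lebesgue w \<psi>"
      using L2.form_diff[OF w \<psi>L w] L2.form_sym[OF w \<psi>L] by simp
    also have "L2_inner lebesgue (\<lambda>x. w x - \<psi> x) w \<le> ?N (\<lambda>x. w x - \<psi> x) * ?N w"
      using L2.Cauchy_Schwarz[OF L2.diff_mem[OF w \<psi>L] w] by (simp add: L2_norm_eq_inner)
    also have "\<dots> \<le> e' * ?N w" using \<psi>(2) by (intro mult_right_mono) auto
    also have "L2_inner lebesgue w \<psi> \<le> C * ?N \<psi>" by (rule C(1)[OF \<psi>(1)])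
    also have "?N \<psi> \<le> ?N w + e'"
      using L2.triangle_add_scaleR[OF w L2.diff_mem[OF w \<psi>L], of "-1"] \<psi>(2)
      by (simp add: L2_norm_eq_inner)
    finally have "?N w * ?N w \<le> e' * ?N w + C * (?N w + e')" using C(2) by (simp add: mult_left_mono)
    also have "\<dots> \<le> C * ?N w + e' * (?N w + C + 1)" using \<open>e' > 0\<close> by (simp add: algebra_simps)
    also have "\<dots> = C * ?N w + e" using pos by (simp add: e'_def)
    finally show ?thesis .
  qed
  then have "?N w * ?N w \<le> C * ?N w" by (rule field_le_epsilon)
  then show ?thesis using C(2) L2_norm_nonneg[of lebesgue w]
    by (cases "?N w = 0") (auto simp: mult_le_cancel_right)
qed

subsection \<open>Weak gradients\<close>

lemma has_weak_gradient_iff: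
  "has_weak_gradient u g \<longleftrightarrow> locally_integrable u \<and> locally_integrable g \<and>
     (\<forall>\<phi> \<in> tests. \<forall>i.
        (\<integral>x. u x * pderivative i \<phi> x \<partial>lebesgue) = - (\<integral>x. g x $ i * \<phi> x \<partial>lebesgue))"
  unfolding has_weak_gradient_def locally_integrable_def by blast

text \<open>The fundamental lemma in each component. It makes the choice in
  \<open>weak_gradient\<close> harmless: any weak gradient that can be exhibited agrees with the
  chosen one almost everywhere.\<close>

lemma has_weak_gradient_unique:
  fixes u :: "real^'n::finite \<Rightarrow> real"
  assumes "has_weak_gradient u g" "has_weak_gradient u g'"
  shows "AE x in lebesgue. g x = g' x"
proof -
  have "AE x in lebesgue. g x $ i - g' x $ i = 0" for i
  proof (rule fundamental_lemma)
    have g: "locally_integrable (\<lambda>x. g x $ i)" "locally_integrable (\<lambda>x. g' x $ i)"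
      using assms by (auto simp: has_weak_gradient_iff intro: locally_integrable_component)
    then show "locally_integrable (\<lambda>x. g x $ i - g' x $ i)"
      by (simp add: locally_integrable_def set_integral_diff)
    fix \<phi> :: "real^'n \<Rightarrow> real" assume \<phi>: "\<phi> \<in> tests"
    show "(\<integral>x. (g x $ i - g' x $ i) * \<phi> x \<partial>lebesgue) = 0"
      using assms \<phi> g by (simp add: has_weak_gradient_iff left_diff_distrib locally_integrable_mult_test)
  qed
  then have "AE x in lebesgue. \<forall>i. g x $ i - g' x $ i = 0"
    by (rule eventually_all_finite)
  then show ?thesis by eventually_elim (simp add: vec_eq_iff)
qed

lemma weak_gradient_AE_eq:
  assumes "has_weak_gradient u g"
  shows "AE x in lebesgue. weak_gradient u x = g x" and "has_weak_gradient u (weak_gradient u)"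
proof -
  show "has_weak_gradient u (weak_gradient u)"
    unfolding weak_gradient_def by (rule someI[of "has_weak_gradient u", OF assms])
  then show "AE x in lebesgue. weak_gradient u x = g x"
    using assms by (rule has_weak_gradient_unique)
qed

section \<open>L2 functions up to null sets and by components\<close>

lemma L2_cong_AE:
  assumes "f \<in> L2 M" "g \<in> borel_measurable M" "AE x in M. f x = g x"
  shows "g \<in> L2 M"
proof -
  have "integrable M (\<lambda>x. (norm (g x))\<^sup>2)"
    by (rule integrable_cong_AE_imp[OF L2_integrable_square[OF assms(1)]])
       (use assms in \<open>auto elim!: eventually_mono\<close>)
  then show ?thesis using assms(2) by (simp add: L2_def)
qed

lemma L2_norm_cong_AE:
  assumes "f \<in> borel_measurable M" "g \<in> borel_measurable M" "AE x in M. f x = g x"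
  shows "L2_norm M f = L2_norm M g"
  unfolding L2_norm_def
  by (intro arg_cong[of _ _ sqrt] integral_cong_AE) (use assms in \<open>auto elim!: eventually_mono\<close>)

lemma L2_component:
  fixes g :: "'a \<Rightarrow> real^'n::finite"
  assumes "g \<in> L2 M"
  shows "(\<lambda>x. g x $ i) \<in> L2 M"
proof -
  have m: "(\<lambda>x. g x $ i) \<in> borel_measurable M"
    using measurable_compose[OF L2_measurable[OF assms] borel_measurable_continuous_onI, of "\<lambda>v. v $ i"]
    by (simp add: continuous_on_component)
  have "integrable M (\<lambda>x. (norm (g x $ i))\<^sup>2)"
    by (rule Bochner_Integration.integrable_bound[OF L2_integrable_square[OF assms]])
       (use m power_mono[OF component_le_norm_cart abs_ge_zero, of _ _ 2] in auto)
  then show ?thesis using m by (simp add: L2_def)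
qed

lemma norm_square_vec: "(norm (v :: real^'n::finite))\<^sup>2 = (\<Sum>i\<in>UNIV. (v $ i)\<^sup>2)"
  unfolding power2_norm_eq_inner by (simp add: inner_vec_def power2_eq_square)

lemma L2_vecI:
  fixes g :: "'a \<Rightarrow> real^'n::finite"
  assumes "\<And>i. (\<lambda>x. g x $ i) \<in> L2 M"
  shows "g \<in> L2 M"
proof -
  have "g = (\<lambda>x. \<Sum>i\<in>UNIV. g x $ i *\<^sub>R axis i 1)"
    by (simp add: basis_expansion scalar_mult_eq_scaleR[symmetric])
  also have "\<dots> \<in> borel_measurable M"
    using assms by (intro borel_measurable_sum borel_measurable_scaleR) (auto simp: L2_def)
  finally have "g \<in> borel_measurable M" .
  then show ?thesis using assms by (simp add: L2_def norm_square_vec)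
qed

lemma L2_norm_vec:
  fixes g :: "'a \<Rightarrow> real^'n::finite"
  assumes "g \<in> L2 M"
  shows "(L2_norm M g)\<^sup>2 = (\<Sum>i\<in>UNIV. (L2_norm M (\<lambda>x. g x $ i))\<^sup>2)"
proof -
  have "integrable M (\<lambda>x. (g x $ i)\<^sup>2)" for i
    using L2_integrable_square[OF L2_component[OF assms, of i]] by simp
  then show ?thesis by (simp add: L2_norm_square norm_square_vec)
qed

subsection \<open>The space \<open>H\<^sup>1\<close>\<close>

text \<open>\<open>H1\<close> asks only that some weak gradient be square integrable; the chosen one
  inherits this by uniqueness almost everywhere.\<close>

lemma H1_D:
  fixes u :: "real^'n::finite \<Rightarrow> real"
  assumes "u \<in> H1"
  shows "u \<in> L2 lebesgue" "has_weak_gradient u (weak_gradient u)" "weak_gradient u \<in> L2 lebesgue"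
proof -
  obtain g where g: "u \<in> L2 lebesgue" "g \<in> L2 lebesgue" "has_weak_gradient u g"
    using assms by (auto simp: H1_def)
  then show "u \<in> L2 lebesgue" by simp
  show *: "has_weak_gradient u (weak_gradient u)" by (rule weak_gradient_AE_eq(2)[OF g(3)])
  show "weak_gradient u \<in> L2 lebesgue"
  proof (rule L2_cong_AE[OF g(2)])
    show "weak_gradient u \<in> borel_measurable lebesgue"
      using * by (intro locally_integrable_measurable) (simp add: has_weak_gradient_iff)
    show "AE x in lebesgue. g x = weak_gradient u x"
      by (rule has_weak_gradient_unique[OF g(3) *])
  qed
qed

lemma H1_I: "u \<in> L2 lebesgue \<Longrightarrow> g \<in> L2 lebesgue \<Longrightarrow> has_weak_gradient u g \<Longrightarrow> u \<in> H1"
  by (auto simp: H1_def)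

lemma L2_weak_gradientI:
  fixes u :: "real^'n::finite \<Rightarrow> real"
  assumes "u \<in> L2 lebesgue" "g \<in> L2 lebesgue"
    and "\<And>\<phi> i. \<phi> \<in> tests \<Longrightarrow>
        (\<integral>x. u x * pderivative i \<phi> x \<partial>lebesgue) = - (\<integral>x. g x $ i * \<phi> x \<partial>lebesgue)"
  shows "has_weak_gradient u g"
  using assms by (simp add: has_weak_gradient_iff L2_locally_integrable)

lemma weak_gradient_eqD:
  assumes "has_weak_gradient u g" "\<phi> \<in> tests"
  shows "(\<integral>x. u x * pderivative i \<phi> x \<partial>lebesgue) = - (\<integral>x. g x $ i * \<phi> x \<partial>lebesgue)"
  using assms by (simp add: has_weak_gradient_def)

lemma L2_integrable_test:
  fixes u :: "real^'n::finite \<Rightarrow> real"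
  shows "u \<in> L2 lebesgue \<Longrightarrow> \<phi> \<in> tests \<Longrightarrow> integrable lebesgue (\<lambda>x. u x * \<phi> x)"
  by (intro locally_integrable_mult_test L2_locally_integrable)

lemma has_weak_gradient_add_scaleR:
  fixes u v :: "real^'n::finite \<Rightarrow> real"
  assumes "u \<in> H1" "v \<in> H1"
  shows "has_weak_gradient (\<lambda>x. u x + c *\<^sub>R v x) (\<lambda>x. weak_gradient u x + c *\<^sub>R weak_gradient v x)"
proof (rule L2_weak_gradientI)
  note u = H1_D[OF assms(1)] and v = H1_D[OF assms(2)]
  show "(\<lambda>x. u x + c *\<^sub>R v x) \<in> L2 lebesgue" "(\<lambda>x. weak_gradient u x + c *\<^sub>R weak_gradient v x) \<in> L2 lebesgue"
    by (intro L2_add_scaleR u v)+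
  fix \<phi> :: "real^'n \<Rightarrow> real" and i assume \<phi>: "\<phi> \<in> tests"
  note int = L2_integrable_test[OF _ \<phi>] L2_integrable_test[OF _ test_pderivative[OF \<phi>]]
  show "(\<integral>x. (u x + c *\<^sub>R v x) * pderivative i \<phi> x \<partial>lebesgue) =
    - (\<integral>x. (weak_gradient u x + c *\<^sub>R weak_gradient v x) $ i * \<phi> x \<partial>lebesgue)"
    using weak_gradient_eqD[OF u(2) \<phi>, of i] weak_gradient_eqD[OF v(2) \<phi>, of i]
      int(1)[OF L2_component[OF u(3), of i]] int(1)[OF L2_component[OF v(3), of i]]
      int(2)[OF u(1), of i] int(2)[OF v(1), of i]
    by (simp add: distrib_right mult.assoc)
qed

lemma H1_add_scaleR:
  assumes "u \<in> H1" "v \<in> H1"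
  shows "(\<lambda>x. u x + c *\<^sub>R v x) \<in> H1"
    and "AE x in lebesgue. weak_gradient (\<lambda>x. u x + c *\<^sub>R v x) x = weak_gradient u x + c *\<^sub>R weak_gradient v x"
proof -
  note w = has_weak_gradient_add_scaleR[OF assms, of c]
  show "AE x in lebesgue. weak_gradient (\<lambda>x. u x + c *\<^sub>R v x) x = weak_gradient u x + c *\<^sub>R weak_gradient v x"
    by (rule weak_gradient_AE_eq(1)[OF w])
  show "(\<lambda>x. u x + c *\<^sub>R v x) \<in> H1"
    by (rule H1_I[OF _ _ w]) (intro L2_add_scaleR H1_D assms)+
qed

lemma H1_diff:
  assumes "u \<in> H1" "v \<in> H1"
  shows "(\<lambda>x. u x - v x) \<in> H1"
    and "AE x in lebesgue. weak_gradient (\<lambda>x. u x - v x) x = weak_gradient u x - weak_gradient v x"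
  using H1_add_scaleR[OF assms, of "-1"] by simp_all

text \<open>Test the weak gradient of \<open>u\<close> with \<eta>\<phi> and expand the derivative
  of that product. As \<eta> and its derivatives are bounded, both terms of the Leibniz formula stay
  in \<open>L2\<close>.\<close>

lemma has_weak_gradient_mult:
  fixes u :: "real^'n::finite \<Rightarrow> real"
  assumes u: "u \<in> H1" and \<eta>: "\<eta> \<in> tests"
  shows "(\<lambda>x. \<eta> x * u x) \<in> H1"
    and "has_weak_gradient (\<lambda>x. \<eta> x * u x) (\<lambda>x. u x *\<^sub>R gradient \<eta> x + \<eta> x *\<^sub>R weak_gradient u x)"
proof -
  note u = H1_D[OF u]
  have mult: "(\<lambda>x. f x * \<psi> x) \<in> L2 lebesgue"
    if f: "f \<in> L2 lebesgue" and \<psi>: "\<psi> \<in> tests" for f \<psi> :: "real^'n \<Rightarrow> real"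
  proof -
    obtain C where C: "C > 0" "\<And>x. \<bar>\<psi> x\<bar> \<le> C" using test_bounded[OF \<psi>] by blast
    have m: "(\<lambda>x. f x * \<psi> x) \<in> borel_measurable lebesgue"
      using L2_integrable_test[OF f \<psi>] by auto
    have "integrable lebesgue (\<lambda>x. (norm (f x * \<psi> x))\<^sup>2)"
    proof (rule Bochner_Integration.integrable_bound[OF integrable_mult_right[OF L2_integrable_square[OF f], of "C\<^sup>2"]])
      have "(\<psi> x)\<^sup>2 \<le> C\<^sup>2" for x using C(2)[of x] by (metis abs_ge_zero power2_abs power_mono)
      then show "AE x in lebesgue. norm ((norm (f x * \<psi> x))\<^sup>2) \<le> norm (C\<^sup>2 * (norm (f x))\<^sup>2)"
        by (auto simp: power_mult_distrib mult.commute[of "C\<^sup>2"] intro!: mult_left_mono)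
    qed (use m in auto)
    then show ?thesis using m by (simp add: L2_def)
  qed
  have L2: "(\<lambda>x. \<eta> x * u x) \<in> L2 lebesgue"
    using mult[OF u(1) \<eta>] by (simp add: mult.commute)
  have L2g: "(\<lambda>x. u x *\<^sub>R gradient \<eta> x + \<eta> x *\<^sub>R weak_gradient u x) \<in> L2 lebesgue"
  proof (rule L2_vecI)
    fix i
    have "(\<lambda>x. u x * pderivative i \<eta> x + weak_gradient u x $ i * \<eta> x) \<in> L2 lebesgue"
      by (intro L2.add_mem mult u L2_component test_pderivative \<eta>)
    then show "(\<lambda>x. (u x *\<^sub>R gradient \<eta> x + \<eta> x *\<^sub>R weak_gradient u x) $ i) \<in> L2 lebesgue"
      by (simp add: gradient_def mult.commute)
  qed
  show w: "has_weak_gradient (\<lambda>x. \<eta> x * u x) (\<lambda>x. u x *\<^sub>R gradient \<eta> x + \<eta> x *\<^sub>R weak_gradient u x)"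
  proof (rule L2_weak_gradientI[OF L2 L2g])
    fix \<phi> :: "real^'n \<Rightarrow> real" and i assume \<phi>: "\<phi> \<in> tests"
    have \<eta>\<phi>: "(\<lambda>x. \<eta> x * \<phi> x) \<in> tests"
      by (rule test_mult[OF test_smooth[OF \<eta>] \<phi>])
    have d: "pderivative i (\<lambda>x. \<eta> x * \<phi> x) x = pderivative i \<eta> x * \<phi> x + \<eta> x * pderivative i \<phi> x" for x
      by (intro pderivative_mult smooth_differentiable test_smooth[OF \<eta>] test_smooth[OF \<phi>])
    have t1: "(\<lambda>x. pderivative i \<eta> x * \<phi> x) \<in> tests"
      and t2: "(\<lambda>x. \<eta> x * pderivative i \<phi> x) \<in> tests"
      by (intro test_mult smooth_pderivative test_smooth[OF \<eta>] test_pderivative \<phi>)+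
    have "(\<integral>x. \<eta> x * u x * pderivative i \<phi> x \<partial>lebesgue) =
        (\<integral>x. u x * pderivative i (\<lambda>x. \<eta> x * \<phi> x) x - u x * (pderivative i \<eta> x * \<phi> x) \<partial>lebesgue)"
      unfolding d by (simp add: algebra_simps)
    also have "\<dots> = (\<integral>x. u x * pderivative i (\<lambda>x. \<eta> x * \<phi> x) x \<partial>lebesgue) - (\<integral>x. u x * (pderivative i \<eta> x * \<phi> x) \<partial>lebesgue)"
      by (intro Bochner_Integration.integral_diff L2_integrable_test u t1 test_pderivative \<eta>\<phi>)
    also have "\<dots> = - ((\<integral>x. weak_gradient u x $ i * (\<eta> x * \<phi> x) \<partial>lebesgue) + (\<integral>x. u x * (pderivative i \<eta> x * \<phi> x) \<partial>lebesgue))"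
      using weak_gradient_eqD[OF u(2) \<eta>\<phi>, of i] by simp
    also have "(\<integral>x. weak_gradient u x $ i * (\<eta> x * \<phi> x) \<partial>lebesgue) + (\<integral>x. u x * (pderivative i \<eta> x * \<phi> x) \<partial>lebesgue)
      = (\<integral>x. weak_gradient u x $ i * (\<eta> x * \<phi> x) + u x * (pderivative i \<eta> x * \<phi> x) \<partial>lebesgue)"
      by (intro Bochner_Integration.integral_add[symmetric] L2_integrable_test L2_component u t1 \<eta>\<phi>)
    also have "\<dots> = (\<integral>x. (u x *\<^sub>R gradient \<eta> x + \<eta> x *\<^sub>R weak_gradient u x) $ i * \<phi> x \<partial>lebesgue)"
      by (simp add: gradient_def algebra_simps)
    finally show "(\<integral>x. \<eta> x * u x * pderivative i \<phi> x \<partial>lebesgue) =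
      - (\<integral>x. (u x *\<^sub>R gradient \<eta> x + \<eta> x *\<^sub>R weak_gradient u x) $ i * \<phi> x \<partial>lebesgue)" .
  qed
  show "(\<lambda>x. \<eta> x * u x) \<in> H1" by (rule H1_I[OF L2 L2g w])
qed

lemma test_gradient_L2: "\<phi> \<in> test_functions \<Omega> \<Longrightarrow> gradient \<phi> \<in> L2 lebesgue"
  by (rule L2_vecI) (simp add: gradient_def test_L2[OF test_pderivative])

lemma has_weak_gradient_test:
  assumes "\<phi> \<in> test_functions \<Omega>"
  shows "has_weak_gradient \<phi> (gradient \<phi>)"
  by (rule L2_weak_gradientI[OF test_L2[OF assms] test_gradient_L2[OF assms]])
     (simp add: gradient_def integral_by_parts_test[OF test_smooth[OF assms]])

lemma test_H1: "\<phi> \<in> test_functions \<Omega> \<Longrightarrow> \<phi> \<in> H1"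
  by (rule H1_I[OF test_L2 test_gradient_L2 has_weak_gradient_test])

subsection \<open>Translates of \<open>H\<^sup>1\<close> functions\<close>

text \<open>The function \<open>y \<mapsto> k (x - y)\<close> is itself a test function; the sign
  from the reflection cancels the sign in the definition of a weak gradient. So mollification
  commutes with the weak gradient.\<close>

lemma conv_pderivative_weak:
  fixes u :: "real^'n::finite \<Rightarrow> real"
  assumes u: "has_weak_gradient u g" and k: "k \<in> tests"
  shows "conv u (pderivative i k) = conv (\<lambda>x. g x $ i) k"
proof
  fix x
  have "pderivative i (\<lambda>y. k (x - y)) y = - pderivative i k (x - y)" for y
    by (intro pderivative_reflect smooth_differentiable test_smooth[OF k])
  then show "conv u (pderivative i k) x = conv (\<lambda>x. g x $ i) k x"
    using weak_gradient_eqD[OF u test_reflect[OF k], of i x] by (simp add: conv_def)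
qed

text \<open>The gradient of the convolution at \<open>z\<close> is the integral of the weak gradient
  against \<open>k (z - y)\<close>, and Cauchy-Schwarz bounds it independently of
  \<open>z\<close>.\<close>

lemma conv_H1_Lipschitz:
  fixes u :: "real^'n::finite \<Rightarrow> real"
  assumes u: "u \<in> H1" and k: "k \<in> tests"
  shows "\<bar>conv u k x - conv u k y\<bar> \<le> L2_norm lebesgue (weak_gradient u) * L2_norm lebesgue k * norm (x - y)"
proof -
  note u = H1_D[OF u]
  have "norm (conv u k x - conv u k y) \<le> L2_norm lebesgue (weak_gradient u) * L2_norm lebesgue k * norm (x - y)"
  proof (rule differentiable_bound[of UNIV])
    show "(conv u k has_derivative (\<lambda>h. \<Sum>i\<in>UNIV. h $ i * conv u (pderivative i k) z)) (at z within UNIV)" for z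
      by (rule has_derivative_conv[OF L2_locally_integrable[OF u(1)] k])
    show "onorm (\<lambda>h. \<Sum>i\<in>UNIV. h $ i * conv u (pderivative i k) z) \<le> L2_norm lebesgue (weak_gradient u) * L2_norm lebesgue k" for z
    proof (rule onorm_le)
      fix h :: "real^'n"
      have kz: "(\<lambda>y. k (z - y)) \<in> L2 lebesgue" "L2_norm lebesgue (\<lambda>y. k (z - y)) = L2_norm lebesgue k"
        using L2_isometry[of "-1" k z] test_L2[OF k] by simp_all
      have int: "integrable lebesgue (\<lambda>y. weak_gradient u y $ i * k (z - y))" for i
        by (rule conv_integrable[OF L2_locally_integrable[OF L2_component[OF u(3)]] k])
      \<comment> \<open>Pairing with the vector field \<open>k (z - y) h\<close> applies
        Cauchy-Schwarz once in the vector-valued \<open>L2\<close>, so no factor depending on the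
        dimension arises.\<close>
      have kh: "(\<lambda>y. k (z - y) *\<^sub>R h) \<in> L2 lebesgue"
        by (rule L2_vecI) (use L2.scaleR_mem[OF kz(1)] in \<open>simp add: mult.commute\<close>)
      have "(\<Sum>i\<in>UNIV. h $ i * conv u (pderivative i k) z)
          = (\<integral>y. (\<Sum>i\<in>UNIV. h $ i * (weak_gradient u y $ i * k (z - y))) \<partial>lebesgue)"
        unfolding conv_pderivative_weak[OF u(2) k] conv_def using int by simp
      also have "\<dots> = L2_inner lebesgue (weak_gradient u) (\<lambda>y. k (z - y) *\<^sub>R h)"
        unfolding L2_inner_def by (simp add: inner_vec_def sum_distrib_left mult_ac)
      also have "\<bar>\<dots>\<bar> \<le> L2_norm lebesgue (weak_gradient u) * L2_norm lebesgue (\<lambda>y. k (z - y) *\<^sub>R h)"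
        unfolding L2_norm_eq_inner by (rule L2.Cauchy_Schwarz[OF u(3) kh])
      also have "L2_norm lebesgue (\<lambda>y. k (z - y) *\<^sub>R h) = L2_norm lebesgue k * norm h"
        unfolding kz(2)[symmetric] by (simp add: L2_norm_def power_mult_distrib real_sqrt_mult)
      finally show "norm (\<Sum>i\<in>UNIV. h $ i * conv u (pderivative i k) z)
          \<le> L2_norm lebesgue (weak_gradient u) * L2_norm lebesgue k * norm h"
        by (simp add: mult.assoc)
    qed
  qed auto
  then show ?thesis by simp
qed

lemma L2_translate:
  fixes u :: "'a::euclidean_space \<Rightarrow> 'b::euclidean_space"
  assumes "u \<in> L2 lebesgue"
  shows "(\<lambda>x. u (x + h)) \<in> L2 lebesgue" "L2_norm lebesgue (\<lambda>x. u (x + h)) = L2_norm lebesgue u"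
  using L2_isometry[OF _ assms, of 1 h] by (simp_all add: add.commute)

text \<open>Against a test function \<psi> the increment equals
  \<open>conv u k h - conv u k 0\<close> with \<open>k\<close> the reflected \<psi>. The Lipschitz
  bound for convolutions is then exactly the estimate needed for duality.\<close>

lemma H1_translation_le:
  fixes u :: "real^'n::finite \<Rightarrow> real"
  assumes "u \<in> H1"
  shows "L2_norm lebesgue (\<lambda>x. u (x + h) - u x) \<le> norm h * L2_norm lebesgue (weak_gradient u)"
proof (rule L2_norm_le_by_duality)
  note u = H1_D[OF assms]
  show "(\<lambda>x. u (x + h) - u x) \<in> L2 lebesgue"
    by (intro L2.diff_mem L2_translate u)
  fix \<psi> :: "real^'n \<Rightarrow> real" assume \<psi>: "\<psi> \<in> tests"
  define k where "k z = \<psi> (0 - z)" for z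
  have k: "k \<in> tests" unfolding k_def by (rule test_reflect[OF \<psi>])
  have k_norm: "L2_norm lebesgue k = L2_norm lebesgue \<psi>"
    using L2_isometry[of "-1" \<psi> 0] test_L2[OF \<psi>] by (simp add: k_def[abs_def])
  have int: "integrable lebesgue (\<lambda>y. u y * k (h - y))"
    by (rule conv_integrable[OF L2_locally_integrable[OF u(1)] k])
  have "L2_inner lebesgue (\<lambda>x. u (x + h) - u x) \<psi>
      = L2_inner lebesgue (\<lambda>x. u (x + h)) \<psi> - L2_inner lebesgue u \<psi>"
    by (intro L2.form_diff L2_translate u test_L2[OF \<psi>])
  also have "L2_inner lebesgue (\<lambda>x. u (x + h)) \<psi> = conv u k h"
    using integral_isometry[of 1 "\<lambda>y. u y * k (h - y)" h] int
    by (simp add: L2_inner_def conv_def k_def add.commute)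
  also have "L2_inner lebesgue u \<psi> = conv u k 0"
    by (simp add: L2_inner_def conv_def k_def)
  also have "conv u k h - conv u k 0 \<le> L2_norm lebesgue (weak_gradient u) * L2_norm lebesgue k * norm (h - 0)"
    using conv_H1_Lipschitz[OF assms k, of h 0] by linarith
  finally show "L2_inner lebesgue (\<lambda>x. u (x + h) - u x) \<psi>
      \<le> norm h * L2_norm lebesgue (weak_gradient u) * L2_norm lebesgue \<psi>"
    by (simp add: k_norm mult_ac)
qed auto

text \<open>For a test function this is the \<open>H1\<close> translation estimate; density and the
  invariance of the norm under translation carry it over to all of \<open>L2\<close>.\<close>

lemma L2_translation_continuous:
  fixes u :: "real^'n::finite \<Rightarrow> real"
  assumes u: "u \<in> L2 lebesgue" and e: "e > 0"
  obtains \<delta> where "\<delta> > 0" "\<And>h. norm h < \<delta> \<Longrightarrow> L2_norm lebesgue (\<lambda>x. u (x + h) - u x) < e"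
proof -
  let ?N = "L2_norm lebesgue"
  obtain \<phi> where \<phi>: "\<phi> \<in> tests" "?N (\<lambda>x. u x - \<phi> x) < e / 3"
    using L2_test_dense[OF u, of "e/3"] e by auto
  note \<phi>L = test_L2[OF \<phi>(1)]
  define G where "G = ?N (weak_gradient \<phi>) + 1"
  have G: "G > 0" unfolding G_def using L2_norm_nonneg[of lebesgue "weak_gradient \<phi>"] by linarith
  show thesis
  proof (rule that)
    show "e / 3 / G > 0" using e G by simp
    fix h :: "real^'n" assume h: "norm h < e / 3 / G"
    note uh = L2_translate(1)[OF u, of h] and \<phi>h = L2_translate(1)[OF \<phi>L, of h]
    have 1: "?N (\<lambda>x. u (x + h) - \<phi> (x + h)) < e / 3"
      using L2_translate(2)[OF L2.diff_mem[OF u \<phi>L], of h] \<phi>(2) by simp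
    have "?N (\<lambda>x. \<phi> (x + h) - \<phi> x) \<le> norm h * ?N (weak_gradient \<phi>)"
      by (rule H1_translation_le[OF test_H1[OF \<phi>(1)]])
    also have "\<dots> \<le> norm h * G" unfolding G_def by (intro mult_left_mono) auto
    also have "\<dots> < e / 3" using h G by (simp add: field_simps)
    finally have 2: "?N (\<lambda>x. \<phi> (x + h) - \<phi> x) < e / 3" .
    have 3: "?N (\<lambda>x. \<phi> x - u x) < e / 3"
      using \<phi>(2) L2.form_square_diff_commute[OF u \<phi>L] by (simp add: L2_norm_eq_inner)
    have "?N (\<lambda>x. u (x + h) - u x) \<le> ?N (\<lambda>x. u (x + h) - \<phi> (x + h)) + ?N (\<lambda>x. \<phi> (x + h) - u x)"
      unfolding L2_norm_eq_inner by (rule L2.triangle_diff[OF uh \<phi>h u])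
    also have "?N (\<lambda>x. \<phi> (x + h) - u x) \<le> ?N (\<lambda>x. \<phi> (x + h) - \<phi> x) + ?N (\<lambda>x. \<phi> x - u x)"
      unfolding L2_norm_eq_inner by (rule L2.triangle_diff[OF \<phi>h \<phi>L u])
    finally show "?N (\<lambda>x. u (x + h) - u x) < e" using 1 2 3 by linarith
  qed
qed

text \<open>A translate by more than the diameter of the support is orthogonal to \<open>u\<close>.\<close>
lemma Poincare:
  fixes u :: "real^'n::finite \<Rightarrow> real"
  assumes u: "u \<in> H1" and R: "R > 0" "AE x in lebesgue. norm x > R \<longrightarrow> u x = 0"
  shows "L2_norm lebesgue u \<le> 3 * R * L2_norm lebesgue (weak_gradient u)"
proof -
  let ?N = "L2_norm lebesgue"
  note uL = H1_D(1)[OF u]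
  \<comment> \<open>Any direction works. With length \<open>3 R\<close> the points \<open>x\<close>
    and \<open>x + h\<close> cannot both have norm at most \<open>R\<close>, so the product of the
    two values is 0 and Pythagoras applies.\<close>
  define h where "h = (3 * R) *\<^sub>R (axis undefined 1 :: real^'n)"
  have h: "norm h = 3 * R" using R by (simp add: h_def)
  note uh = L2_translate[OF uL, of h]
  have "AE x in lebesgue. norm (h + 1 *\<^sub>R x) > R \<longrightarrow> u (h + 1 *\<^sub>R x) = 0"
    by (rule AE_isometry[OF _ R(2)]) simp
  with R(2) have "AE x in lebesgue. u (x + h) * u x = 0"
  proof eventually_elim
    case (elim x)
    have "3 * R \<le> norm (h + x) + norm x" using norm_triangle_ineq4[of "h + x" x] h by simp
    then have "norm x > R \<or> norm (h + x) > R" using R(1) by linarith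
    then show ?case using elim by (auto simp: add.commute)
  qed
  then have 0: "L2_inner lebesgue (\<lambda>x. u (x + h)) u = 0"
    unfolding L2_inner_def by (intro integral_eq_zero_AE) auto
  have "(?N (\<lambda>x. u (x + h) - u x))\<^sup>2 = (?N (\<lambda>x. u (x + h)))\<^sup>2 + (?N u)\<^sup>2"
    using L2.form_square_diff[OF uh(1) uL] 0 uL uh(1)
    by (simp add: L2_norm_eq_inner L2.form_nonneg L2.diff_mem)
  then have "(?N u)\<^sup>2 \<le> (?N (\<lambda>x. u (x + h) - u x))\<^sup>2" by simp
  then have "?N u \<le> ?N (\<lambda>x. u (x + h) - u x)" by (rule power2_le_imp_le) simp
  also have "\<dots> \<le> norm h * ?N (weak_gradient u)" by (rule H1_translation_le[OF u])
  finally show ?thesis by (simp add: h)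
qed

subsection \<open>Mollification in \<open>L\<^sup>2\<close>\<close>

text \<open>Exchanging integrals requires \<open>v (x - z)\<close> to be jointly measurable in
  \<open>x\<close> and \<open>z\<close>, which Borel measurability of \<open>v\<close>
  provides.\<close>

lemma L2_borel_representative:
  fixes u :: "'a::euclidean_space \<Rightarrow> real"
  assumes "u \<in> L2 lebesgue"
  obtains u' where "u' \<in> borel_measurable borel" "AE x in lborel. u x = u' x"
    "AE x in lebesgue. u x = u' x" "u' \<in> L2 lebesgue"
proof -
  obtain u' where u': "u' \<in> borel_measurable lborel" "AE x in lborel. u x = u' x"
    using completion_ex_borel_measurable_real[of u lborel] L2_measurable[OF assms] by auto
  have AE: "AE x in lebesgue. u x = u' x" by (rule AE_completion[OF u'(2)])
  moreover have "u' \<in> borel_measurable lebesgue" using u'(1) by (rule measurable_completion)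
  ultimately have "u' \<in> L2 lebesgue" by (intro L2_cong_AE[OF assms])
  then show thesis using that u' AE by simp
qed

lemma integrable_locally_integrable:
  fixes f :: "'a::euclidean_space \<Rightarrow> 'b::euclidean_space"
  assumes "integrable lebesgue f"
  shows "locally_integrable f"
  unfolding locally_integrable_def set_integrable_def
proof (intro allI impI)
  fix K :: "'a set" assume "compact K"
  then have "K \<in> sets lebesgue" by (intro fmeasurableD lmeasurable_compact)
  then show "integrable lebesgue (\<lambda>x. indicator K x *\<^sub>R f x)"
    by (intro integrable_mult_indicator assms)
qed

lemma nn_integral_L2_norm:
  fixes f :: "'a::euclidean_space \<Rightarrow> real"
  assumes "f \<in> L2 lebesgue"
  shows "(\<integral>\<^sup>+x. ennreal ((f x)\<^sup>2) \<partial>lborel) = ennreal ((L2_norm lebesgue f)\<^sup>2)"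
proof -
  have "(\<integral>\<^sup>+x. ennreal ((f x)\<^sup>2) \<partial>lborel) = (\<integral>\<^sup>+x. ennreal ((f x)\<^sup>2) \<partial>lebesgue)"
    by (simp add: nn_integral_completion)
  also have "\<dots> = ennreal (\<integral>x. (f x)\<^sup>2 \<partial>lebesgue)"
    using L2_integrable_square[OF assms] by (intro nn_integral_eq_integral) auto
  finally show ?thesis by (simp add: L2_norm_square)
qed

lemma L2_nn_integralI:
  fixes f :: "'a::euclidean_space \<Rightarrow> real"
  assumes "f \<in> borel_measurable lebesgue" "(\<integral>\<^sup>+x. ennreal ((f x)\<^sup>2) \<partial>lborel) \<le> ennreal C" "C \<ge> 0"
  shows "f \<in> L2 lebesgue" "(L2_norm lebesgue f)\<^sup>2 \<le> C"
proof -
  have le: "(\<integral>\<^sup>+x. ennreal ((f x)\<^sup>2) \<partial>lebesgue) \<le> ennreal C"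
    using assms(2) by (simp add: nn_integral_completion)
  have "integrable lebesgue (\<lambda>x. (norm (f x))\<^sup>2)"
    using assms(1) le_less_trans[OF le] by (intro integrableI_bounded) auto
  then show f: "f \<in> L2 lebesgue" using assms(1) by (simp add: L2_def)
  show "(L2_norm lebesgue f)\<^sup>2 \<le> C"
    using assms(2,3) nn_integral_L2_norm[OF f] by simp
qed

text \<open>Jensen's inequality, written as nonnegativity of a variance.\<close>
lemma conv_diff_square_le:
  fixes u :: "real^'n::finite \<Rightarrow> real"
  assumes u: "u \<in> L2 lebesgue" and k: "k \<in> tests" "\<And>x. 0 \<le> k x" "integral\<^sup>L lebesgue k = 1"
  shows "ennreal ((conv u k x - u x)\<^sup>2) \<le> (\<integral>\<^sup>+z. ennreal (k z * (u (x - z) - u x)\<^sup>2) \<partial>lborel)"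
proof -
  have ux: "(\<lambda>z. u (x - z)) \<in> L2 lebesgue"
    using L2_isometry(1)[of "-1" u x] u by simp
  have k_int: "integrable lebesgue k" by (rule test_integrable[OF k(1)])
  have int1: "integrable lebesgue (\<lambda>z. u (x - z) * k z)"
    by (rule L2_integrable_test[OF ux k(1)])
  have int2: "integrable lebesgue (\<lambda>z. (u (x - z))\<^sup>2 * k z)"
    using L2_integrable_square[OF ux]
    by (intro locally_integrable_mult_test[OF integrable_locally_integrable k(1)]) simp
  have "integrable lebesgue (\<lambda>z. (u (x - z))\<^sup>2 * k z - 2 * u x * (u (x - z) * k z) + (u x)\<^sup>2 * k z)"
    by (intro Bochner_Integration.integrable_add Bochner_Integration.integrable_diff integrable_mult_right int1 int2 k_int)
  then have int3: "integrable lebesgue (\<lambda>z. k z * (u (x - z) - u x)\<^sup>2)"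
    by (simp add: power2_eq_square algebra_simps)
  \<comment> \<open>The mean of \<open>u (x - z) - u x\<close> under the probability density
    \<open>k\<close>.\<close>
  define m where "m = conv u k x - u x"
  have conv: "conv u k x = (\<integral>z. u (x - z) * k z \<partial>lebesgue)"
    using integral_reflect[of "\<lambda>z. u (x - z) * k z" x] int1 by (simp add: conv_def)
  have "0 \<le> (\<integral>z. k z * (u (x - z) - u x - m)\<^sup>2 \<partial>lebesgue)"
    by (intro integral_nonneg_AE) (simp add: k)
  also have "\<dots> = (\<integral>z. k z * (u (x - z) - u x)\<^sup>2 - 2 * m * (u (x - z) * k z) + (2 * m * u x + m\<^sup>2) * k z \<partial>lebesgue)"
    by (intro arg_cong[of _ _ "integral\<^sup>L lebesgue"] ext) (simp add: power2_eq_square algebra_simps)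
  also have "\<dots> = (\<integral>z. k z * (u (x - z) - u x)\<^sup>2 \<partial>lebesgue) - 2 * m * (\<integral>z. u (x - z) * k z \<partial>lebesgue) + (2 * m * u x + m\<^sup>2)"
  using int1 int3 k_int k(3) by simp
  finally have "m\<^sup>2 \<le> (\<integral>z. k z * (u (x - z) - u x)\<^sup>2 \<partial>lebesgue)"
    unfolding conv[symmetric] by (simp add: m_def power2_eq_square algebra_simps)
  with int3 have "ennreal (m\<^sup>2) \<le> (\<integral>\<^sup>+z. ennreal (k z * (u (x - z) - u x)\<^sup>2) \<partial>lebesgue)"
    by (subst nn_integral_eq_integral) (auto simp: k intro: ennreal_leI)
  then show ?thesis by (simp add: m_def nn_integral_completion)
qed

lemma L2_norm_translation_diff_cong_AE:
  fixes u v :: "'a::euclidean_space \<Rightarrow> 'b::euclidean_space"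
  assumes "u \<in> L2 lebesgue" "v \<in> L2 lebesgue" "AE x in lebesgue. u x = v x"
  shows "L2_norm lebesgue (\<lambda>x. u (x + h) - u x) = L2_norm lebesgue (\<lambda>x. v (x + h) - v x)"
proof (rule L2_norm_cong_AE)
  have "AE x in lebesgue. u (h + 1 *\<^sub>R x) = v (h + 1 *\<^sub>R x)"
    by (rule AE_isometry[OF _ assms(3)]) simp
  with assms(3) show "AE x in lebesgue. u (x + h) - u x = v (x + h) - v x"
    by eventually_elim (simp add: add.commute)
qed (intro borel_measurable_diff L2_measurable L2_translate assms)+

text \<open>Jensen and Tonelli bound the squared norm of the difference by the
  \<open>k\<close>-average over \<open>z\<close> of squared translation norms. The set
  \<open>T\<close> is not tied to the origin, so shifted kernels are allowed.\<close>

lemma conv_diff_L2_norm_le: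
  fixes u :: "real^'n::finite \<Rightarrow> real"
  assumes u: "u \<in> L2 lebesgue" and k: "k \<in> tests" "\<And>x. 0 \<le> k x" "integral\<^sup>L lebesgue k = 1"
    "\<And>z. z \<notin> T \<Longrightarrow> k z = 0"
    and e: "e \<ge> 0" "\<And>z. z \<in> T \<Longrightarrow> L2_norm lebesgue (\<lambda>x. u (x + (- z)) - u x) \<le> e"
  shows "(\<lambda>x. conv u k x - u x) \<in> L2 lebesgue" "L2_norm lebesgue (\<lambda>x. conv u k x - u x) \<le> e"
proof -
  obtain v where v [measurable]: "v \<in> borel_measurable borel" and
    AE: "AE x in lebesgue. u x = v x" and vL: "v \<in> L2 lebesgue"
    using L2_borel_representative[OF u] by blast
  have [measurable]: "k \<in> borel_measurable borel"
    by (intro borel_measurable_continuous_onI smooth_continuous test_smooth[OF k(1)])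
  \<comment> \<open>The convolutions agree at every point, because each value is an
    integral.\<close>
  have conv_eq: "conv u k x = conv v k x" for x
    unfolding conv_def
  proof (rule integral_cong_AE)
    show "(\<lambda>y. u y * k (x - y)) \<in> borel_measurable lebesgue" "(\<lambda>y. v y * k (x - y)) \<in> borel_measurable lebesgue"
      using conv_integrable[OF L2_locally_integrable[OF u] k(1)] conv_integrable[OF L2_locally_integrable[OF vL] k(1)]
      by auto
    show "AE y in lebesgue. u y * k (x - y) = v y * k (x - y)"
      using AE by eventually_elim simp
  qed
  have translate: "L2_norm lebesgue (\<lambda>x. v (x + (- z)) - v x) \<le> e" if "z \<in> T" for z
  using e(2)[OF that] L2_norm_translation_diff_cong_AE[OF u vL AE, of "- z"] by simp
  have "(\<integral>\<^sup>+x. ennreal ((conv v k x - v x)\<^sup>2) \<partial>lborel)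
      \<le> (\<integral>\<^sup>+x. (\<integral>\<^sup>+z. ennreal (k z * (v (x - z) - v x)\<^sup>2) \<partial>lborel) \<partial>lborel)"
    by (intro nn_integral_mono conv_diff_square_le vL k)
  also have "\<dots> = (\<integral>\<^sup>+z. (\<integral>\<^sup>+x. ennreal (k z * (v (x - z) - v x)\<^sup>2) \<partial>lborel) \<partial>lborel)"
    by (rule lborel_pair.Fubini') measurable
  also have "\<dots> \<le> (\<integral>\<^sup>+z. ennreal (k z) * ennreal (e\<^sup>2) \<partial>lborel)"
  proof (rule nn_integral_mono)
    fix z
    show "(\<integral>\<^sup>+x. ennreal (k z * (v (x - z) - v x)\<^sup>2) \<partial>lborel) \<le> ennreal (k z) * ennreal (e\<^sup>2)"
    proof (cases "z \<in> T")
      case True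
      have L: "(\<lambda>x. v (x + (- z)) - v x) \<in> L2 lebesgue" by (intro L2.diff_mem L2_translate vL)
      have "(\<integral>\<^sup>+x. ennreal (k z * (v (x - z) - v x)\<^sup>2) \<partial>lborel)
          = ennreal (k z) * (\<integral>\<^sup>+x. ennreal ((v (x + (- z)) - v x)\<^sup>2) \<partial>lborel)"
        by (subst nn_integral_cmult[symmetric]) (auto simp: ennreal_mult k)
      also have "(\<integral>\<^sup>+x. ennreal ((v (x + (- z)) - v x)\<^sup>2) \<partial>lborel) \<le> ennreal (e\<^sup>2)"
        unfolding nn_integral_L2_norm[OF L] by (intro ennreal_leI power_mono translate True) auto
      finally show ?thesis by (simp add: mult_left_mono)
    qed (simp add: k(4))
  qed
  also have "\<dots> = ennreal (e\<^sup>2)"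
  proof -
    have "(\<integral>\<^sup>+z. ennreal (k z) \<partial>lborel) = (\<integral>\<^sup>+z. ennreal (k z) \<partial>lebesgue)"
      by (simp add: nn_integral_completion)
    also have "\<dots> = 1" using test_integrable[OF k(1)] k(2,3) by (simp add: nn_integral_eq_integral)
    finally show ?thesis by (simp add: nn_integral_multc)
  qed
  finally have le: "(\<integral>\<^sup>+x. ennreal ((conv v k x - v x)\<^sup>2) \<partial>lborel) \<le> ennreal (e\<^sup>2)" .
  have meas: "(\<lambda>x. conv w k x - w x) \<in> borel_measurable lebesgue" if "w \<in> L2 lebesgue" for w
    using that by (intro borel_measurable_diff L2_measurable smooth_measurable
      smooth_conv L2_locally_integrable k(1))
  note v2 = L2_nn_integralI[OF meas[OF vL] le]
  have AE': "AE x in lebesgue. conv v k x - v x = conv u k x - u x"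
    using AE by eventually_elim (simp add: conv_eq)
  show "(\<lambda>x. conv u k x - u x) \<in> L2 lebesgue"
    by (rule L2_cong_AE[OF v2(1) meas[OF u] AE']) simp
  have "L2_norm lebesgue (\<lambda>x. conv u k x - u x) = L2_norm lebesgue (\<lambda>x. conv v k x - v x)"
    using L2_norm_cong_AE[OF meas[OF vL] meas[OF u] AE'] by simp
  also have "\<dots> \<le> e" using v2(2) e(1) power2_le_imp_le by auto
  finally show "L2_norm lebesgue (\<lambda>x. conv u k x - u x) \<le> e" .
qed

subsection \<open>The Gagliardo seminorm\<close>

lemma power_powr_commute: "x > 0 \<Longrightarrow> (x ^ n) powr a = (x powr a) ^ n" for x a :: real
  by (simp add: powr_realpow[symmetric] powr_powr mult.commute)

text \<open>The kernel is split into dyadic annuli, both towards the origin and towards infinity.\<close>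
lemma nn_integral_kernel_finite:
  fixes s :: real
  assumes s: "0 < s" "s < 1"
  shows "(\<integral>\<^sup>+h. ennreal (min ((norm h)\<^sup>2) 1 / norm h powr (real DIM('a) + 2 * s)) \<partial>(lborel :: 'a::euclidean_space measure)) < \<infinity>"
proof -
  define N where "N = DIM('a)"
  define \<alpha> where "\<alpha> = real N + 2 * s"
  define V where "V = unit_ball_vol (real N)"
  have V: "V \<ge> 0" by (simp add: V_def)
  have \<alpha>: "\<alpha> > 0" using s by (simp add: \<alpha>_def)
  \<comment> \<open>\<open>c k\<close> bounds the kernel for \<open>2^-(k+1) < |h| <= 2^-k\<close>
    and \<open>d k\<close> for \<open>2^k <= |h| < 2^(k+1)\<close>: the numerator is estimated at
    the outer radius or by 1, the denominator at the inner radius. Below, each annulus is enlarged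
    to a ball, whose volume is known.\<close>
  define c where "c k = (1/4) ^ k / ((1/2) ^ Suc k) powr \<alpha>" for k :: nat
  define d where "d k = 1 / (2 ^ k) powr \<alpha>" for k :: nat
  have cd: "c k \<ge> 0" "d k \<ge> 0" for k by (auto simp: c_def d_def)
  let ?c = "\<lambda>k h. ennreal (c k) * indicator (cball (0::'a) ((1/2) ^ k)) h"
  let ?d = "\<lambda>k h. ennreal (d k) * indicator (cball (0::'a) (2 ^ Suc k)) h"
  have bound: "ennreal (min ((norm h)\<^sup>2) 1 / norm h powr \<alpha>) \<le> (\<Sum>k. ?c k h) + (\<Sum>k. ?d k h)" for h :: 'a
  proof -
    have le_suminf: "F k \<le> suminf F" for F :: "nat \<Rightarrow> ennreal" and k
      using sum_le_suminf[of F "{k}"] by simp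
    consider "h = 0" | "h \<noteq> 0" "norm h \<le> 1" | "norm h > 1" by fastforce
    then show ?thesis
    proof cases
      case 1
      then show ?thesis by simp
    next
      case 2
      have "\<exists>n. (1/2) ^ n < norm h" using real_arch_pow_inv[of "norm h" "1/2"] 2 by simp
      define n where "n = (LEAST n. (1/2) ^ n < norm h)"
      have n: "(1/2) ^ n < norm h" unfolding n_def by (rule LeastI_ex) fact
      with 2 have "n \<noteq> 0" by (intro notI) simp
      then obtain k where k: "n = Suc k" by (cases n) auto
      have "\<not> (1/2) ^ k < norm h"
        by (rule not_less_Least) (simp add: n_def[symmetric] k)
      then have h_le: "norm h \<le> (1/2) ^ k" by simp
      have "min ((norm h)\<^sup>2) 1 / norm h powr \<alpha> \<le> ((1/2) ^ k)\<^sup>2 / ((1/2) ^ Suc k) powr \<alpha>"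
        using h_le n \<alpha> unfolding k
        by (intro frac_le powr_mono2 min.coboundedI1 power_mono) auto
      also have "((1/2) ^ k)\<^sup>2 = (1/4 :: real) ^ k"
        by (simp add: power_mult[symmetric] power_mult_distrib power2_eq_square flip: power_mult_distrib)
      finally have "ennreal (min ((norm h)\<^sup>2) 1 / norm h powr \<alpha>) \<le> ?c k h"
        using h_le by (simp add: c_def ennreal_leI)
      also have "\<dots> \<le> (\<Sum>k. ?c k h)" by (rule le_suminf)
      finally show ?thesis by (simp add: add_increasing2)
    next
      case 3
      have "\<exists>n. norm h < 2 ^ n" using real_arch_pow[of 2 "norm h"] by simp
      define n where "n = (LEAST n. norm h < 2 ^ n)"
      have n: "norm h < 2 ^ n" unfolding n_def by (rule LeastI_ex) fact
      with 3 have "n \<noteq> 0" by (intro notI) simp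
      then obtain k where k: "n = Suc k" by (cases n) auto
      have "\<not> norm h < 2 ^ k"
        by (rule not_less_Least) (simp add: n_def[symmetric] k)
      then have h_ge: "norm h \<ge> 2 ^ k" by simp
      have "min ((norm h)\<^sup>2) 1 / norm h powr \<alpha> \<le> 1 / (2 ^ k) powr \<alpha>"
        using h_ge \<alpha> by (intro frac_le powr_mono2) auto
      then have "ennreal (min ((norm h)\<^sup>2) 1 / norm h powr \<alpha>) \<le> ?d k h"
        using n unfolding k by (simp add: d_def ennreal_leI)
      also have "\<dots> \<le> (\<Sum>k. ?d k h)" by (rule le_suminf)
      finally show ?thesis by (simp add: add_increasing)
    qed
  qed
  have c_sum: "(\<integral>\<^sup>+h. (\<Sum>k. ?c k h) \<partial>lborel) < \<infinity>"
  proof -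
    \<comment> \<open>The ratio of consecutive terms near the origin; it is below 1 because
      \<open>s < 1\<close>.\<close>
    define q where "q = (1/2 :: real) powr (2 - 2 * s)"
    have q: "0 \<le> q" "q < 1" unfolding q_def using s powr_less_mono'[of "1/2" 0 "2 - 2 * s"] by auto
    have "(\<integral>\<^sup>+h. ?c k h \<partial>lborel) = ennreal (V / (1/2) powr \<alpha> * q ^ k)" for k
    proof -
      have "(\<integral>\<^sup>+h. ?c k h \<partial>lborel) = ennreal (c k * (V * ((1/2) ^ k) ^ N))"
        using cd V by (subst nn_integral_cmult_indicator) (simp_all add: emeasure_cball V_def N_def ennreal_mult)
      also have "c k * (V * ((1/2) ^ k) ^ N) = V / (1/2) powr \<alpha> * ((1/4) * (1/2) ^ N / (1/2) powr \<alpha>) ^ k"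
        unfolding c_def power_powr_commute[of "1/2", simplified, unfolded power_one_over[symmetric]]
        by (simp add: power_powr_commute power_mult_distrib power_divide power_commutes flip: power_mult)
      also have "(1/4) * (1/2) ^ N / (1/2) powr \<alpha> = q"
        unfolding q_def \<alpha>_def
        by (simp add: powr_realpow[symmetric] powr_diff powr_add field_simps) (simp flip: powr_mult)
      finally show ?thesis .
    qed
    moreover have "?c k \<in> borel_measurable lborel" for k
      by (intro borel_measurable_times_ennreal borel_measurable_const borel_measurable_indicator) simp
    ultimately have "(\<integral>\<^sup>+h. (\<Sum>k. ?c k h) \<partial>lborel) = (\<Sum>k. ennreal (V / (1/2) powr \<alpha> * q ^ k))"
      by (subst nn_integral_suminf) presburger+
    also have "\<dots> = ennreal (\<Sum>k. V / (1/2) powr \<alpha> * q ^ k)"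
      using q V by (intro suminf_ennreal2 summable_mult summable_geometric) auto
    finally show ?thesis by simp
  qed
  have d_sum: "(\<integral>\<^sup>+h. (\<Sum>k. ?d k h) \<partial>lborel) < \<infinity>"
  proof -
    \<comment> \<open>The ratio towards infinity; it is below 1 because
      \<open>s > 0\<close>.\<close>
    define q where "q = (2 :: real) powr (- 2 * s)"
    have q: "0 \<le> q" "q < 1" unfolding q_def using s powr_less_mono[of "- 2 * s" 0 2] by auto
    have "(\<integral>\<^sup>+h. ?d k h \<partial>lborel) = ennreal (V * 2 ^ N * q ^ k)" for k
    proof -
      have "(\<integral>\<^sup>+h. ?d k h \<partial>lborel) = ennreal (d k * (V * (2 ^ Suc k) ^ N))"
        using cd V by (subst nn_integral_cmult_indicator) (simp_all add: emeasure_cball V_def N_def ennreal_mult)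
      also have "d k * (V * (2 ^ Suc k) ^ N) = V * 2 ^ N * (2 ^ N / 2 powr \<alpha>) ^ k"
        unfolding d_def by (simp add: power_powr_commute power_mult_distrib power_divide mult_ac flip: power_mult)
      also have "2 ^ N / 2 powr \<alpha> = q"
        unfolding q_def \<alpha>_def by (simp add: powr_realpow[symmetric] powr_minus powr_add field_simps)
      finally show ?thesis .
    qed
    moreover have "?d k \<in> borel_measurable lborel" for k
      by (intro borel_measurable_times_ennreal borel_measurable_const borel_measurable_indicator) simp
    ultimately have "(\<integral>\<^sup>+h. (\<Sum>k. ?d k h) \<partial>lborel) = (\<Sum>k. ennreal (V * 2 ^ N * q ^ k))"
      by (subst nn_integral_suminf) presburger+
    also have "\<dots> = ennreal (\<Sum>k. V * 2 ^ N * q ^ k)"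
      using q V by (intro suminf_ennreal2 summable_mult summable_geometric) auto
    finally show ?thesis by simp
  qed
  have "(\<integral>\<^sup>+h. ennreal (min ((norm h)\<^sup>2) 1 / norm h powr \<alpha>) \<partial>(lborel :: 'a measure))
      \<le> (\<integral>\<^sup>+h. (\<Sum>k. ?c k h) + (\<Sum>k. ?d k h) \<partial>lborel)"
    by (intro nn_integral_mono bound)
  also have "\<dots> = (\<integral>\<^sup>+h. (\<Sum>k. ?c k h) \<partial>lborel) + (\<integral>\<^sup>+h. (\<Sum>k. ?d k h) \<partial>lborel)"
    by (intro nn_integral_add borel_measurable_suminf_order borel_measurable_times_ennreal
        borel_measurable_const borel_measurable_indicator) simp_all
  also have "\<dots> < \<infinity>" using c_sum d_sum by simp
  finally show ?thesis by (simp add: \<alpha>_def N_def)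
qed

text \<open>Half of the exponent is used, so that the product of two quotients is the integrand of
  the fractional form. The Gagliardo form becomes an \<open>L2\<close> product on the doubled space
  and inherits linearity, symmetry and Cauchy-Schwarz from there.\<close>

definition Gagliardo_quotient :: "real \<Rightarrow> (real^'n::finite \<Rightarrow> real) \<Rightarrow> (real^'n) \<times> (real^'n) \<Rightarrow> real" where
  "Gagliardo_quotient s u z =
     (u (fst z) - u (snd z)) / norm (fst z - snd z) powr ((real CARD('n) + 2 * s) / 2)"

lemma Gagliardo_quotient_mult:
  fixes u v :: "real^'n::finite \<Rightarrow> real"
  shows "Gagliardo_quotient s u (x, y) * Gagliardo_quotient s v (x, y) =
    (u x - u y) * (v x - v y) / norm (x - y) powr (real CARD('n) + 2 * s)"
proof -
  have "(real CARD('n) + 2 * s) / 2 + (real CARD('n) + 2 * s) / 2 = real CARD('n) + 2 * s" by simp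
  then show ?thesis by (simp add: Gagliardo_quotient_def powr_add[symmetric])
qed

lemma AE_lborel_pair:
  fixes P :: "'a::euclidean_space \<Rightarrow> bool"
  assumes "AE x in lborel. P x"
  shows "AE z in (lborel :: ('a \<times> 'a) measure). P (fst z) \<and> P (snd z)"
proof -
  obtain N where N: "\<And>x. \<not> P x \<Longrightarrow> x \<in> N" "N \<in> null_sets lborel"
    by (rule AE_E3[OF assms]) (auto simp: set_eq_iff)
  have "N \<times> UNIV \<in> null_sets (lborel :: ('a \<times> 'a) measure)" "UNIV \<times> N \<in> null_sets (lborel :: ('a \<times> 'a) measure)"
    unfolding lborel_prod[symmetric] using N(2)
    by (auto intro: lborel.times_in_null_sets1 lborel.times_in_null_sets2)
  then have "(N \<times> UNIV) \<union> (UNIV \<times> N) \<in> null_sets (lborel :: ('a \<times> 'a) measure)" by (rule null_sets.Un)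
  then show ?thesis by (rule AE_I') (use N(1) in auto)
qed

lemma nn_integral_lborel_translate:
  fixes a :: "'a::euclidean_space"
  assumes [measurable]: "f \<in> borel_measurable borel"
  shows "(\<integral>\<^sup>+y. f y \<partial>lborel) = (\<integral>\<^sup>+h. f (a + h) \<partial>lborel)"
  by (subst lborel_distr_plus[of a, symmetric]) (simp add: nn_integral_distr)

text \<open>Substituting \<open>y = x + h\<close> and exchanging the integrals leaves, for each
  \<open>h\<close>, a squared translation norm over a power of \<open>|h|\<close>. The computation
  is done for a Borel representative, whose quotient agrees with that of \<open>u\<close> off a null
  set of pairs.\<close>

lemma Gagliardo_quotient_bound:
  fixes s :: real
  assumes s: "0 < s" "s < 1"
  obtains C where "C \<ge> 0" "\<And>u :: real^'n::finite \<Rightarrow> real. u \<in> H1 \<Longrightarrow> Gagliardo_quotient s u \<in> L2 lebesgue"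
    "\<And>u :: real^'n::finite \<Rightarrow> real. u \<in> H1 \<Longrightarrow>
      (L2_norm lebesgue (Gagliardo_quotient s u))\<^sup>2 \<le> C * ((L2_norm lebesgue u)\<^sup>2 + (L2_norm lebesgue (weak_gradient u))\<^sup>2)"
proof -
  define \<alpha> where "\<alpha> = real CARD('n) + 2 * s"
  let ?\<kappa> = "\<lambda>h :: real^'n. min ((norm h)\<^sup>2) 1 / norm h powr \<alpha>"
  define I where "I = (\<integral>\<^sup>+h. ennreal (?\<kappa> h) \<partial>lborel)"
  have "I < \<infinity>" using nn_integral_kernel_finite[OF s, where 'a = "real^'n"] by (simp add: I_def \<alpha>_def)
  define C where "C = 4 * enn2real I"
  have C: "C \<ge> 0" by (simp add: C_def)
  have main: "Gagliardo_quotient s u \<in> L2 lebesgue \<and> (L2_norm lebesgue (Gagliardo_quotient s u))\<^sup>2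
      \<le> C * ((L2_norm lebesgue u)\<^sup>2 + (L2_norm lebesgue (weak_gradient u))\<^sup>2)" if u: "u \<in> H1" for u :: "real^'n \<Rightarrow> real"
  proof -
    let ?N = "L2_norm lebesgue"
    note uL = H1_D(1)[OF u]
    \<comment> \<open>The factor 4 comes from the trivial bound of the increment by twice the norm
      of \<open>u\<close>; it also covers the gradient bound.\<close>
    define M where "M = 4 * ((?N u)\<^sup>2 + (?N (weak_gradient u))\<^sup>2)"
    have M: "M \<ge> 0" by (simp add: M_def)
    obtain v where v [measurable]: "v \<in> borel_measurable borel" and AE_lborel: "AE x in lborel. u x = v x"
      and AE: "AE x in lebesgue. u x = v x" and vL: "v \<in> L2 lebesgue"
      using L2_borel_representative[OF uL] by blast
    have trans: "(?N (\<lambda>x. v (x + h) - v x))\<^sup>2 \<le> min ((norm h)\<^sup>2) 1 * M" for h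
    proof -
      have eq: "?N (\<lambda>x. v (x + h) - v x) = ?N (\<lambda>x. u (x + h) - u x)"
        by (rule L2_norm_translation_diff_cong_AE[OF uL vL AE, symmetric])
      have "?N (\<lambda>x. u (x + h) - u x) \<le> norm h * ?N (weak_gradient u)"
        by (rule H1_translation_le[OF u])
      then have "(?N (\<lambda>x. u (x + h) - u x))\<^sup>2 \<le> (norm h * ?N (weak_gradient u))\<^sup>2"
        by (rule power_mono) simp
      also have "\<dots> \<le> (norm h)\<^sup>2 * M"
        unfolding power_mult_distrib M_def by (intro mult_left_mono) auto
      finally have 1: "(?N (\<lambda>x. u (x + h) - u x))\<^sup>2 \<le> (norm h)\<^sup>2 * M" .
      have "?N (\<lambda>x. u (x + h) - u x) \<le> ?N (\<lambda>x. u (x + h)) + ?N u"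
        using L2.triangle_add_scaleR[OF L2_translate(1)[OF uL] uL, of h "-1"] by (simp add: L2_norm_eq_inner)
      then have "?N (\<lambda>x. u (x + h) - u x) \<le> 2 * ?N u" by (simp add: L2_translate(2)[OF uL])
      then have "(?N (\<lambda>x. u (x + h) - u x))\<^sup>2 \<le> (2 * ?N u)\<^sup>2" by (rule power_mono) simp
      also have "\<dots> \<le> M" by (simp add: M_def power_mult_distrib)
      finally have 2: "(?N (\<lambda>x. u (x + h) - u x))\<^sup>2 \<le> M" .
      show ?thesis using 1 2 by (simp add: eq min_def)
    qed
    have [measurable]: "Gagliardo_quotient s v \<in> borel_measurable borel"
      unfolding Gagliardo_quotient_def borel_prod[symmetric] by measurable
    have sq: "(Gagliardo_quotient s v (x, y))\<^sup>2 = (v x - v y)\<^sup>2 / norm (x - y) powr \<alpha>" for x y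
      unfolding power2_eq_square Gagliardo_quotient_mult \<alpha>_def ..
    have "(\<integral>\<^sup>+z. ennreal ((Gagliardo_quotient s v z)\<^sup>2) \<partial>lborel)
        = (\<integral>\<^sup>+x. (\<integral>\<^sup>+y. ennreal ((Gagliardo_quotient s v (x, y))\<^sup>2) \<partial>lborel) \<partial>lborel)"
      unfolding lborel_prod[symmetric]
      by (subst lborel.nn_integral_fst) (auto simp: lborel_prod)
    also have "\<dots> = (\<integral>\<^sup>+x. (\<integral>\<^sup>+h. ennreal ((v x - v (x + h))\<^sup>2 / norm h powr \<alpha>) \<partial>lborel) \<partial>lborel)"
      unfolding sq
    proof (rule nn_integral_cong)
      fix x
      show "(\<integral>\<^sup>+y. ennreal ((v x - v y)\<^sup>2 / norm (x - y) powr \<alpha>) \<partial>lborel)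
          = (\<integral>\<^sup>+h. ennreal ((v x - v (x + h))\<^sup>2 / norm h powr \<alpha>) \<partial>lborel)"
        by (subst nn_integral_lborel_translate[of _ x]) simp_all
    qed
    also have "\<dots> = (\<integral>\<^sup>+h. (\<integral>\<^sup>+x. ennreal ((v x - v (x + h))\<^sup>2 / norm h powr \<alpha>) \<partial>lborel) \<partial>lborel)"
      by (rule lborel_pair.Fubini') measurable
    also have "\<dots> \<le> (\<integral>\<^sup>+h. ennreal M * ennreal (?\<kappa> h) \<partial>lborel)"
    proof (rule nn_integral_mono)
      fix h :: "real^'n"
      have L: "(\<lambda>x. v (x + h) - v x) \<in> L2 lebesgue" by (intro L2.diff_mem L2_translate vL)
      have "(\<integral>\<^sup>+x. ennreal ((v x - v (x + h))\<^sup>2 / norm h powr \<alpha>) \<partial>lborel)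
          = ennreal (1 / norm h powr \<alpha>) * (\<integral>\<^sup>+x. ennreal ((v (x + h) - v x)\<^sup>2) \<partial>lborel)"
        by (subst nn_integral_cmult[symmetric]) (auto simp: power2_commute ennreal_mult[symmetric])
      also have "\<dots> \<le> ennreal (1 / norm h powr \<alpha>) * ennreal (min ((norm h)\<^sup>2) 1 * M)"
        unfolding nn_integral_L2_norm[OF L] by (intro mult_left_mono ennreal_leI trans) auto
      also have "\<dots> = ennreal M * ennreal (?\<kappa> h)"
        using M by (simp add: ennreal_mult[symmetric] mult_ac)
      finally show "(\<integral>\<^sup>+x. ennreal ((v x - v (x + h))\<^sup>2 / norm h powr \<alpha>) \<partial>lborel) \<le> ennreal M * ennreal (?\<kappa> h)" .
    qed
    also have "\<dots> = ennreal M * I"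
      unfolding I_def by (rule nn_integral_cmult) measurable
    also have "\<dots> = ennreal (M * enn2real I)"
      using M \<open>I < \<infinity>\<close> by (simp add: ennreal_mult)
    also have "M * enn2real I = C * ((?N u)\<^sup>2 + (?N (weak_gradient u))\<^sup>2)"
      by (simp add: M_def C_def)
    finally have le: "(\<integral>\<^sup>+z. ennreal ((Gagliardo_quotient s v z)\<^sup>2) \<partial>lborel)
        \<le> ennreal (C * ((?N u)\<^sup>2 + (?N (weak_gradient u))\<^sup>2))" .
    have meas: "Gagliardo_quotient s v \<in> borel_measurable lebesgue"
      by (intro measurable_completion) simp
    note vG = L2_nn_integralI[OF meas le mult_nonneg_nonneg[OF C add_nonneg_nonneg[OF zero_le_power2 zero_le_power2]]]
    have AEG: "AE z in lebesgue. Gagliardo_quotient s v z = Gagliardo_quotient s u z"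
      using AE_completion[OF AE_lborel_pair[OF AE_lborel]]
      by eventually_elim (simp add: Gagliardo_quotient_def)
    \<comment> \<open>The quotient of \<open>u\<close> is measurable because it agrees almost
      everywhere with a measurable function and the measure is complete.\<close>
    have meas_u: "Gagliardo_quotient s u \<in> borel_measurable lebesgue"
      by (rule borel_measurable_AE[OF meas AEG])
    show ?thesis
      using L2_cong_AE[OF vG(1) meas_u AEG] L2_norm_cong_AE[OF meas meas_u AEG] vG(2) by simp
  qed
  show thesis using that[OF C] main by blast
qed

subsection \<open>The energy form\<close>

definition H1_inner :: "(real^'n::finite \<Rightarrow> real) \<Rightarrow> (real^'n \<Rightarrow> real) \<Rightarrow> real" where
  "H1_inner u v = L2_inner lebesgue u v + L2_inner lebesgue (weak_gradient u) (weak_gradient v)"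

lemma H1_norm_eq_inner: "u \<in> H1 \<Longrightarrow> H1_norm u = sqrt (H1_inner u u)"
  by (simp add: H1_norm_def H1_inner_def L2_norm_eq_inner H1_D L2.form_nonneg)

lemma H1_norm_square: "(H1_norm u)\<^sup>2 = (L2_norm lebesgue u)\<^sup>2 + (L2_norm lebesgue (weak_gradient u))\<^sup>2"
  by (simp add: H1_norm_def)

lemma H1_norm_nonneg: "0 \<le> H1_norm u"
  by (simp add: H1_norm_def)

text \<open>The chosen gradients are additive only almost everywhere, but the integrated product is
  exactly linear, as the form axioms require.\<close>

lemma L2_inner_weak_gradient_add_scaleR:
  assumes "u \<in> H1" "v \<in> H1" "g \<in> L2 lebesgue"
  shows "L2_inner lebesgue (weak_gradient (\<lambda>x. u x + c *\<^sub>R v x)) g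
    = L2_inner lebesgue (weak_gradient u) g + c * L2_inner lebesgue (weak_gradient v) g"
proof -
  note w = H1_add_scaleR[OF assms(1,2), of c]
  have "L2_inner lebesgue (weak_gradient (\<lambda>x. u x + c *\<^sub>R v x)) g
    = L2_inner lebesgue (\<lambda>x. weak_gradient u x + c *\<^sub>R weak_gradient v x) g"
    unfolding L2_inner_def
    by (intro integral_cong_AE borel_measurable_inner borel_measurable_add borel_measurable_scaleR
        borel_measurable_const L2_measurable H1_D(3) w(1) assms)
       (use w(2) in \<open>auto elim!: eventually_mono\<close>)
  then show ?thesis using assms by (simp add: L2.form_add_scaleR H1_D)
qed

lemma semi_inner_space_H1: "semi_inner_space H1 (H1_inner :: (real^'n::finite \<Rightarrow> real) \<Rightarrow> _)"
proof
  show "(\<lambda>_. 0) \<in> H1" by (rule test_H1[OF test_zero])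
  show "H1_inner (\<lambda>x. u x + c *\<^sub>R v x) w = H1_inner u w + c * H1_inner v w"
    if "u \<in> H1" "v \<in> H1" "w \<in> H1" for u v w :: "real^'n \<Rightarrow> real" and c
    unfolding H1_inner_def L2_inner_weak_gradient_add_scaleR[OF that(1,2) H1_D(3)[OF that(3)]]
    using that L2.form_add_scaleR[of u lebesgue v w c] by (simp add: H1_D distrib_left)
  show "(\<lambda>x. u x + c *\<^sub>R v x) \<in> H1" if "u \<in> H1" "v \<in> H1" for u v :: "real^'n \<Rightarrow> real" and c
    by (rule H1_add_scaleR(1)[OF that])
qed (auto simp: H1_inner_def L2.form_sym L2.form_nonneg H1_D)

interpretation H1: semi_inner_space H1 H1_inner
  by (rule semi_inner_space_H1)

text \<open>Unlike \<open>weak_form\<close>, it uses the weak gradient in both arguments and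
  integrates over the whole space, so that it makes sense symmetrically on \<open>H1\<close>. The
  two agree when the second argument is a test function.\<close>

definition energy :: "real \<Rightarrow> (real^'n::finite \<Rightarrow> real) \<Rightarrow> (real^'n \<Rightarrow> real) \<Rightarrow> real" where
  "energy s u v = L2_inner lebesgue (weak_gradient u) (weak_gradient v) +
     c_Ns TYPE('n) s / 2 * L2_inner lebesgue (Gagliardo_quotient s u) (Gagliardo_quotient s v)"

text \<open>The integrand is nonnegative since \<open>cos\<close> is at most 1. This sign makes the
  energy semidefinite and lets it dominate its gradient part.\<close>

lemma c_Ns_nonneg: "0 \<le> c_Ns TYPE('n::finite) s"
  unfolding c_Ns_def by (simp add: integral_nonneg_AE)

lemma semi_inner_space_energy:
  assumes s: "0 < s" "s < 1"
  shows "semi_inner_space H1 (energy s :: (real^'n::finite \<Rightarrow> real) \<Rightarrow> _)"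
proof
  have G: "Gagliardo_quotient s u \<in> L2 lebesgue" if "u \<in> H1" for u :: "real^'n \<Rightarrow> real"
    using Gagliardo_quotient_bound[OF s, where 'n = 'n] that by metis
  have G_add: "Gagliardo_quotient s (\<lambda>x. u x + c *\<^sub>R v x)
      = (\<lambda>z. Gagliardo_quotient s u z + c *\<^sub>R Gagliardo_quotient s v z)" for u v :: "real^'n \<Rightarrow> real" and c
    by (rule ext) (simp add: Gagliardo_quotient_def field_simps add_divide_distrib[symmetric])
  show "(\<lambda>_. 0) \<in> H1" by (rule test_H1[OF test_zero])
  show "energy s (\<lambda>x. u x + c *\<^sub>R v x) w = energy s u w + c * energy s v w"
    if "u \<in> H1" "v \<in> H1" "w \<in> H1" for u v w :: "real^'n \<Rightarrow> real" and c
    unfolding energy_def G_add L2_inner_weak_gradient_add_scaleR[OF that(1,2) H1_D(3)[OF that(3)]]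
      L2.form_add_scaleR[OF G[OF that(1)] G[OF that(2)] G[OF that(3)]]
    by (simp add: algebra_simps)
  show "energy s u v = energy s v u" if "u \<in> H1" "v \<in> H1" for u v :: "real^'n \<Rightarrow> real"
    using that by (simp add: energy_def L2.form_sym[OF H1_D(3) H1_D(3)] L2.form_sym[OF G G])
  show "0 \<le> energy s u u" if "u \<in> H1" for u :: "real^'n \<Rightarrow> real"
    using that by (simp add: energy_def L2.form_nonneg H1_D G c_Ns_nonneg)
qed (rule H1_add_scaleR)

text \<open>The upper bound gives continuity in the \<open>H1\<close> norm. The lower bound drops
  the fractional term; together with the Poincare inequality it becomes coercivity on
  \<open>X_space\<close>.\<close>

lemma energy_bounds:
  assumes s: "0 < s" "s < 1"
  obtains C where "C > 0" "\<And>u :: real^'n::finite \<Rightarrow> real. u \<in> H1 \<Longrightarrow> energy s u u \<le> C * (H1_norm u)\<^sup>2"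
    "\<And>u :: real^'n::finite \<Rightarrow> real. u \<in> H1 \<Longrightarrow> (L2_norm lebesgue (weak_gradient u))\<^sup>2 \<le> energy s u u"
proof -
  obtain C where C: "C \<ge> 0" "\<And>u :: real^'n \<Rightarrow> real. u \<in> H1 \<Longrightarrow> Gagliardo_quotient s u \<in> L2 lebesgue"
    "\<And>u :: real^'n \<Rightarrow> real. u \<in> H1 \<Longrightarrow>
      (L2_norm lebesgue (Gagliardo_quotient s u))\<^sup>2 \<le> C * ((L2_norm lebesgue u)\<^sup>2 + (L2_norm lebesgue (weak_gradient u))\<^sup>2)"
    using Gagliardo_quotient_bound[OF s, where 'n = 'n] by metis
  define c where "c = c_Ns TYPE('n) s / 2"
  have c: "c \<ge> 0" using c_Ns_nonneg[where 'n = 'n, of s] by (simp add: c_def)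
  have eq: "energy s u u = (L2_norm lebesgue (weak_gradient u))\<^sup>2 + c * (L2_norm lebesgue (Gagliardo_quotient s u))\<^sup>2"
    if "u \<in> H1" for u :: "real^'n \<Rightarrow> real"
    using that by (simp add: energy_def c_def L2_norm_eq_inner L2.form_nonneg H1_D C(2))
  show thesis
  proof (rule that)
    show "1 + c * C > 0" using c C(1) by (simp add: add_pos_nonneg)
    fix u :: "real^'n \<Rightarrow> real" assume u: "u \<in> H1"
    have "energy s u u \<le> (H1_norm u)\<^sup>2 + c * (C * (H1_norm u)\<^sup>2)"
      unfolding eq[OF u] H1_norm_square by (intro add_mono mult_left_mono C(3) u c) simp
    then show "energy s u u \<le> (1 + c * C) * (H1_norm u)\<^sup>2" by (simp add: algebra_simps)
    show "(L2_norm lebesgue (weak_gradient u))\<^sup>2 \<le> energy s u u"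
      unfolding eq[OF u] using c by simp
  qed
qed

subsection \<open>Density of test functions\<close>

text \<open>The space usually written \<open>H_0^1(\<Omega>)\<close>, with its elements extended by
  zero.\<close>

definition test_closure :: "(real^'n::finite) set \<Rightarrow> (real^'n \<Rightarrow> real) set" where
  "test_closure \<Omega> = {w \<in> H1. \<forall>e>0. \<exists>\<phi>\<in>test_functions \<Omega>. H1_norm (\<lambda>x. w x - \<phi> x) < e}"

lemma test_closureD:
  assumes "w \<in> test_closure \<Omega>" "e > 0"
  obtains \<phi> where "\<phi> \<in> test_functions \<Omega>" "H1_norm (\<lambda>x. w x - \<phi> x) < e"
  using assms by (auto simp: test_closure_def)

lemma test_closure_add:
  fixes v w :: "real^'n::finite \<Rightarrow> real"
  assumes "v \<in> test_closure \<Omega>" "w \<in> test_closure \<Omega>"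
  shows "(\<lambda>x. v x + w x) \<in> test_closure \<Omega>"
proof -
  have vw: "v \<in> H1" "w \<in> H1" using assms by (auto simp: test_closure_def)
  have "\<exists>\<phi>\<in>test_functions \<Omega>. H1_norm (\<lambda>x. v x + w x - \<phi> x) < e" if e: "e > 0" for e
  proof -
    obtain \<phi> where \<phi>: "\<phi> \<in> test_functions \<Omega>" "H1_norm (\<lambda>x. v x - \<phi> x) < e / 2"
      using test_closureD[OF assms(1) half_gt_zero[OF e]] by blast
    obtain \<psi> where \<psi>: "\<psi> \<in> test_functions \<Omega>" "H1_norm (\<lambda>x. w x - \<psi> x) < e / 2"
      using test_closureD[OF assms(2) half_gt_zero[OF e]] by blast
    have d: "(\<lambda>x. v x - \<phi> x) \<in> H1" "(\<lambda>x. w x - \<psi> x) \<in> H1"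
      by (intro H1.diff_mem vw test_H1[OF \<phi>(1)] test_H1[OF \<psi>(1)])+
    have "H1_norm (\<lambda>x. (v x - \<phi> x) + 1 *\<^sub>R (w x - \<psi> x)) \<le> H1_norm (\<lambda>x. v x - \<phi> x) + \<bar>1\<bar> * H1_norm (\<lambda>x. w x - \<psi> x)"
      using H1.triangle_add_scaleR[OF d, of 1] H1.add_mem[OF d] by (simp add: H1_norm_eq_inner d)
    then have "H1_norm (\<lambda>x. v x + w x - (\<phi> x + 1 * \<psi> x)) < e"
      using \<phi>(2) \<psi>(2) by (simp add: algebra_simps)
    then show ?thesis
      using test_add_scale[OF \<phi>(1) \<psi>(1), of 1] by (intro bexI[of _ "\<lambda>x. \<phi> x + 1 * \<psi> x"])
  qed
  then show ?thesis using H1.add_mem[OF vw] by (simp add: test_closure_def)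
qed

text \<open>Convolution with a kernel concentrated near \<open>z\<close> smooths and translates by \<open>z\<close> at once.\<close>
lemma shifted_support_in_test_closure:
  fixes w :: "real^'n::finite \<Rightarrow> real"
  assumes w: "w \<in> H1" and \<Omega>: "open \<Omega>" and S: "compact S" "AE x in lebesgue. x \<notin> S \<longrightarrow> w x = 0"
    and shift: "\<And>\<delta>. \<delta> > 0 \<Longrightarrow> \<exists>z. norm z < \<delta> \<and> (\<forall>x\<in>S. x + z \<in> \<Omega>)"
  shows "w \<in> test_closure \<Omega>"
proof -
  let ?N = "L2_norm lebesgue"
  let ?g = "\<lambda>i x. weak_gradient w x $ i"
  note wD = H1_D[OF w]
  have "\<exists>\<phi>\<in>test_functions \<Omega>. H1_norm (\<lambda>x. w x - \<phi> x) < e" if e: "e > 0" for e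
  proof -
    define n where "n = real CARD('n)"
    \<comment> \<open>The function and its \<open>n\<close> partial derivatives are each
      approximated within \<open>e'\<close>. The squared \<open>H1\<close> norm is then at most
      \<open>(n + 1) e'^2\<close>, bounded by the square of \<open>(n + 1) e'\<close>, which is less
      than \<open>e\<close>.\<close>
    define e' where "e' = e / (n + 2)"
    have n: "n \<ge> 0" by (simp add: n_def)
    have e': "e' > 0" using e n by (simp add: e'_def)
    obtain \<delta>0 where \<delta>0: "\<delta>0 > 0" "\<And>h. norm h < \<delta>0 \<Longrightarrow> ?N (\<lambda>x. w (x + h) - w x) < e'"
      using L2_translation_continuous[OF wD(1) e'] by blast
    have "\<exists>\<delta>. \<delta> > 0 \<and> (\<forall>h. norm h < \<delta> \<longrightarrow> ?N (\<lambda>x. ?g i (x + h) - ?g i x) < e')" for i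
      by (rule L2_translation_continuous[OF L2_component[OF wD(3), of i] e']) blast
    then have "\<forall>i. \<exists>\<delta>. \<delta> > 0 \<and> (\<forall>h. norm h < \<delta> \<longrightarrow> ?N (\<lambda>x. ?g i (x + h) - ?g i x) < e')" ..
    from choice[OF this] obtain d
      where "\<forall>i. d i > 0 \<and> (\<forall>h. norm h < d i \<longrightarrow> ?N (\<lambda>x. ?g i (x + h) - ?g i x) < e')" ..
    then have d: "\<And>i. d i > 0" "\<And>i h. norm h < d i \<Longrightarrow> ?N (\<lambda>x. ?g i (x + h) - ?g i x) < e'"
      by simp_all
    define \<delta> where "\<delta> = min \<delta>0 (Min (range d))"
    have \<delta>: "\<delta> > 0" using \<delta>0(1) d(1) by (simp add: \<delta>_def)
    have \<delta>_le: "\<delta> \<le> \<delta>0" "\<delta> \<le> d i" for i by (auto simp: \<delta>_def min.coboundedI2)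
    obtain z where z: "norm z < \<delta> / 2" "\<And>x. x \<in> S \<Longrightarrow> x + z \<in> \<Omega>"
      using shift[of "\<delta> / 2"] \<delta> by auto
    have "compact ((\<lambda>x. x + z) ` S)" by (intro compact_continuous_image continuous_intros S)
    then obtain r0 where r0: "r0 > 0" "(\<Union>x\<in>(\<lambda>x. x + z) ` S. ball x r0) \<subseteq> \<Omega>"
      using compact_subset_open_imp_ball_epsilon_subset[OF _ \<Omega>, of "(\<lambda>x. x + z) ` S"] z(2) by blast
    \<comment> \<open>\<open>r < r0\<close> keeps the translated and thickened support inside
      \<Omega>; \<open>r <= \<delta>/4\<close> keeps all shifts in the support of the kernel shorter
      than \<delta>.\<close>
    define r where "r = min (r0 / 2) (\<delta> / 4)"
    have r: "r > 0" "r < r0" "r \<le> \<delta> / 4" using r0 \<delta> by (auto simp: r_def)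
    obtain k where k: "k \<in> tests" "\<And>x. 0 \<le> k x" "\<And>x. x \<notin> cball z r \<Longrightarrow> k x = 0"
        "integral\<^sup>L lebesgue k = 1"
      using exists_kernel[OF r(1), of z] by blast
    have small: "norm (- t) < \<delta>" if "t \<in> cball z r" for t
    proof -
      have "norm t \<le> norm z + norm (z - t)" by norm
      then show ?thesis using that z(1) r(3) \<delta> by (simp add: dist_norm)
    qed
    have \<phi>: "conv w k \<in> test_functions \<Omega>"
    proof (rule conv_test[OF L2_locally_integrable[OF wD(1)] k(1) S compact_cball k(3)])
      fix x t assume xt: "x \<in> S" "t \<in> cball z r"
      have "dist (x + z) (x + t) = dist z t" by (simp add: dist_norm)
      then have "x + t \<in> ball (x + z) r0" using xt(2) r(2) by simp
      then show "x + t \<in> \<Omega>" using r0(2) xt(1) by blast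
    qed
    have "?N (\<lambda>x. conv w k x - w x) \<le> e'"
      by (rule conv_diff_L2_norm_le(2)[OF wD(1) k(1,2,4,3) less_imp_le[OF e']
          less_imp_le[OF \<delta>0(2)[OF less_le_trans[OF small \<delta>_le(1)]]]])
    moreover have "?N (\<lambda>x. conv (?g i) k x - ?g i x) \<le> e'" for i
      by (rule conv_diff_L2_norm_le(2)[OF L2_component[OF wD(3)] k(1,2,4,3) less_imp_le[OF e']
          less_imp_le[OF d(2)[OF less_le_trans[OF small \<delta>_le(2)]]]])
    \<comment> \<open>The gradient of the convolution is the convolution of the weak gradient, so
      the \<open>L2\<close> estimate also controls the derivatives.\<close>
    moreover have "pderivative i (conv w k) = conv (?g i) k" for i
      by (simp add: pderivative_conv[OF L2_locally_integrable[OF wD(1)] k(1)] conv_pderivative_weak[OF wD(2) k(1)])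
    ultimately have le: "?N (\<lambda>x. conv w k x - w x) \<le> e'" "\<And>i. ?N (\<lambda>x. pderivative i (conv w k) x - ?g i x) \<le> e'"
      by simp_all
    define D where "D x = conv w k x - w x" for x
    have DH: "D \<in> H1" unfolding D_def by (intro H1.diff_mem test_H1[OF \<phi>] w)
    have gD: "AE x in lebesgue. weak_gradient D x = gradient (conv w k) x - weak_gradient w x"
      using H1_diff(2)[OF test_H1[OF \<phi>] w] weak_gradient_AE_eq(1)[OF has_weak_gradient_test[OF \<phi>]]
      unfolding D_def by eventually_elim simp
    have gL: "(\<lambda>x. gradient (conv w k) x - weak_gradient w x) \<in> L2 lebesgue"
      by (intro L2.diff_mem test_gradient_L2[OF \<phi>] wD)
    have "(?N (weak_gradient D))\<^sup>2 = (?N (\<lambda>x. gradient (conv w k) x - weak_gradient w x))\<^sup>2"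
      using L2_norm_cong_AE[OF L2_measurable[OF H1_D(3)[OF DH]] L2_measurable[OF gL] gD] by simp
    also have "\<dots> = (\<Sum>i\<in>UNIV. (?N (\<lambda>x. pderivative i (conv w k) x - ?g i x))\<^sup>2)"
      unfolding L2_norm_vec[OF gL] by (simp add: gradient_def)
    also have "\<dots> \<le> (\<Sum>i\<in>(UNIV :: 'n set). e'\<^sup>2)"
      by (intro sum_mono power_mono le) auto
    finally have "(?N (weak_gradient D))\<^sup>2 \<le> n * e'\<^sup>2" by (simp add: n_def)
    moreover have "(?N D)\<^sup>2 \<le> e'\<^sup>2" unfolding D_def by (intro power_mono le) auto
    ultimately have "(H1_norm D)\<^sup>2 \<le> (n + 1) * e'\<^sup>2" unfolding H1_norm_square by (simp add: algebra_simps)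
    also have "\<dots> \<le> (n + 1)\<^sup>2 * e'\<^sup>2" using n by (intro mult_right_mono) (auto simp: power2_eq_square)
    finally have "(H1_norm D)\<^sup>2 \<le> ((n + 1) * e')\<^sup>2" by (simp add: power_mult_distrib)
    then have "H1_norm D \<le> (n + 1) * e'" by (rule power2_le_imp_le) (use n e' in auto)
    also have "\<dots> < e" using n e by (simp add: e'_def field_simps)
    finally have "H1_norm D < e" .
    moreover have "H1_norm (\<lambda>x. w x - conv w k x) = H1_norm D"
      unfolding D_def using H1.form_square_diff_commute[OF w test_H1[OF \<phi>]]
      by (simp add: H1_norm_eq_inner H1.diff_mem w test_H1[OF \<phi>])
    ultimately show ?thesis using \<phi> by (intro bexI[of _ "conv w k"]) simp
  qed
  then show ?thesis using w by (simp add: test_closure_def)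
qed

section \<open>The space X and its approximation near the boundary\<close>

lemma X_space_D:
  assumes "u \<in> X_space \<Omega>"
  shows "u \<in> H1" "AE x in lebesgue. x \<notin> \<Omega> \<longrightarrow> u x = 0"
  using assms by (auto simp: X_space_def)

lemma X_space_mult:
  assumes "u \<in> X_space \<Omega>" "\<eta> \<in> test_functions U"
  shows "(\<lambda>x. \<eta> x * u x) \<in> X_space \<Omega>"
proof -
  have "(\<lambda>x. \<eta> x * u x) \<in> H1"
    by (rule has_weak_gradient_mult(1)[OF X_space_D(1)[OF assms(1)] test_mono[OF assms(2) subset_UNIV]])
  moreover have "AE x in lebesgue. x \<notin> \<Omega> \<longrightarrow> \<eta> x * u x = 0"
    using X_space_D(2)[OF assms(1)] by eventually_elim auto
  ultimately show ?thesis by (simp add: X_space_def)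
qed

lemma X_space_add_scaleR:
  assumes "u \<in> X_space \<Omega>" "v \<in> X_space \<Omega>"
  shows "(\<lambda>x. u x + c *\<^sub>R v x) \<in> X_space \<Omega>"
proof -
  have "AE x in lebesgue. x \<notin> \<Omega> \<longrightarrow> u x + c *\<^sub>R v x = 0"
    using X_space_D(2)[OF assms(1)] X_space_D(2)[OF assms(2)] by eventually_elim auto
  then show ?thesis
    unfolding X_space_def using H1_add_scaleR(1) X_space_D(1) assms by blast
qed

lemma X_space_diff:
  assumes "u \<in> X_space \<Omega>" "v \<in> X_space \<Omega>"
  shows "(\<lambda>x. u x - v x) \<in> X_space \<Omega>"
  using X_space_add_scaleR[OF assms, of "-1"] by simp

lemma test_X_space: "\<phi> \<in> test_functions \<Omega> \<Longrightarrow> \<phi> \<in> X_space \<Omega>"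
  by (auto simp: X_space_def test_H1 elim!: test_functionsE intro!: AE_I2)

text \<open>Near a boundary point the translate in direction \<open>\<nu>\<close> is supported in \<open>\<Omega>\<close>.\<close>
lemma boundary_piece_in_test_closure:
  fixes \<Omega> :: "(real^'n::finite) set"
  assumes \<Omega>: "open \<Omega>" "bounded \<Omega>" and r: "r > 0" and \<nu>: "norm \<nu> = 1" and \<gamma>: "C_k 1 \<gamma>"
    and graph: "\<Omega> \<inter> ball p r = {y \<in> ball p r. \<gamma> (y - (y \<bullet> \<nu>) *\<^sub>R \<nu>) < y \<bullet> \<nu>}"
    and w: "w \<in> X_space \<Omega>" and \<eta>: "\<eta> \<in> test_functions (ball p r)"
  shows "(\<lambda>x. \<eta> x * w x) \<in> test_closure \<Omega>"
proof -
  obtain K where K: "compact K" "K \<subseteq> ball p r" "\<And>x. x \<notin> K \<Longrightarrow> \<eta> x = 0"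
    using \<eta> by (rule test_functionsE) blast
  have \<gamma>c: "continuous_on UNIV \<gamma>"
    using C_k_Suc_D[of 0 \<gamma>] \<gamma> by simp
  \<comment> \<open>The points strictly below the graph form an open set that misses \<Omega>, hence
    also misses its closure.\<close>
  have closure_ge: "\<gamma> (x - (x \<bullet> \<nu>) *\<^sub>R \<nu>) \<le> x \<bullet> \<nu>" if x: "x \<in> closure \<Omega>" "x \<in> ball p r" for x
  proof (rule ccontr)
    define U where "U = ball p r \<inter> {y. y \<bullet> \<nu> < \<gamma> (y - (y \<bullet> \<nu>) *\<^sub>R \<nu>)}"
    have "continuous_on UNIV (\<lambda>y. \<gamma> (y - (y \<bullet> \<nu>) *\<^sub>R \<nu>))"
      by (rule continuous_on_compose2[OF \<gamma>c]) (auto intro!: continuous_intros)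
    then have "open U"
      unfolding U_def by (intro open_Int open_ball open_Collect_less) (auto intro!: continuous_intros)
    moreover assume "\<not> \<gamma> (x - (x \<bullet> \<nu>) *\<^sub>R \<nu>) \<le> x \<bullet> \<nu>"
    then have "x \<in> U" using x(2) by (simp add: U_def)
    ultimately have "\<Omega> \<inter> U \<noteq> {}" using x(1) open_Int_closure_eq_empty[of U \<Omega>] by blast
    then obtain y where "y \<in> \<Omega>" "y \<in> U" by blast
    then have "y \<in> {y \<in> ball p r. \<gamma> (y - (y \<bullet> \<nu>) *\<^sub>R \<nu>) < y \<bullet> \<nu>}" "y \<bullet> \<nu> < \<gamma> (y - (y \<bullet> \<nu>) *\<^sub>R \<nu>)"
      unfolding graph[symmetric] by (auto simp: U_def)
    then show False by simp
  qed
  have \<nu>\<nu>: "\<nu> \<bullet> \<nu> = 1" using \<nu> by (simp add: dot_square_norm)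
  show ?thesis
  proof (rule shifted_support_in_test_closure[where S = "closure \<Omega> \<inter> K"])
    show "(\<lambda>x. \<eta> x * w x) \<in> H1" by (rule X_space_D(1)[OF X_space_mult[OF w \<eta>]])
    show "open \<Omega>" by fact
    show "compact (closure \<Omega> \<inter> K)" by (intro closed_Int_compact closed_closure K)
    show "AE x in lebesgue. x \<notin> closure \<Omega> \<inter> K \<longrightarrow> \<eta> x * w x = 0"
      using X_space_D(2)[OF w]
      by eventually_elim (use K(3) closure_subset in auto)
    fix \<delta> :: real assume \<delta>: "\<delta> > 0"
    obtain e where e: "e > 0" "(\<Union>x\<in>K. ball x e) \<subseteq> ball p r"
      using compact_subset_open_imp_ball_epsilon_subset[OF K(1) open_ball K(2)] by blast
    \<comment> \<open>\<open>t < e\<close> keeps the shifted point in the ball where the graph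
      describes \<Omega>. The shift leaves the projection unchanged and raises the height by
      \<open>t\<close>, turning the weak inequality on the closure into the strict one.\<close>
    define t where "t = min \<delta> e / 2"
    have t: "t > 0" "t < \<delta>" "t < e" using \<delta> e by (auto simp: t_def)
    have "x + t *\<^sub>R \<nu> \<in> \<Omega>" if x: "x \<in> closure \<Omega> \<inter> K" for x
    proof -
      have "x + t *\<^sub>R \<nu> \<in> ball x e" using t \<nu> by (simp add: dist_norm)
      then have ball: "x + t *\<^sub>R \<nu> \<in> ball p r" using x e(2) by blast
      have proj: "x + t *\<^sub>R \<nu> - ((x + t *\<^sub>R \<nu>) \<bullet> \<nu>) *\<^sub>R \<nu> = x - (x \<bullet> \<nu>) *\<^sub>R \<nu>"
        by (simp add: inner_add_left \<nu>\<nu> scaleR_add_left)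
      have height: "(x + t *\<^sub>R \<nu>) \<bullet> \<nu> = x \<bullet> \<nu> + t" by (simp add: inner_add_left \<nu>\<nu>)
      have "\<gamma> (x - (x \<bullet> \<nu>) *\<^sub>R \<nu>) \<le> x \<bullet> \<nu>" using closure_ge x K(2) by blast
      then have "\<gamma> (x + t *\<^sub>R \<nu> - ((x + t *\<^sub>R \<nu>) \<bullet> \<nu>) *\<^sub>R \<nu>) < (x + t *\<^sub>R \<nu>) \<bullet> \<nu>"
        unfolding proj unfolding height using t(1) by linarith
      with ball have "x + t *\<^sub>R \<nu> \<in> {y \<in> ball p r. \<gamma> (y - (y \<bullet> \<nu>) *\<^sub>R \<nu>) < y \<bullet> \<nu>}" by blast
      then show ?thesis unfolding graph[symmetric] by blast
    qed
    then show "\<exists>z. norm z < \<delta> \<and> (\<forall>x\<in>closure \<Omega> \<inter> K. x + z \<in> \<Omega>)"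
      using t \<nu> by (intro exI[of _ "t *\<^sub>R \<nu>"]) auto
  qed
qed

text \<open>The finitely many boundary pieces are split off one after the other, so that no partition
  of unity is needed.\<close>
lemma X_space_subset_test_closure:
  fixes \<Omega> :: "(real^'n::finite) set"
  assumes \<Omega>: "open \<Omega>" "bounded \<Omega>" "C1_boundary \<Omega>" and w: "w \<in> X_space \<Omega>"
  shows "w \<in> test_closure \<Omega>"
proof -
  have "\<forall>p\<in>frontier \<Omega>. \<exists>r. r > 0 \<and> (\<forall>w\<in>X_space \<Omega>. \<forall>\<eta>\<in>test_functions (ball p r). (\<lambda>x. \<eta> x * w x) \<in> test_closure \<Omega>)"
    using \<Omega>(3) boundary_piece_in_test_closure[OF \<Omega>(1,2)] unfolding C1_boundary_def by meson
  then obtain r where r: "\<And>p. p \<in> frontier \<Omega> \<Longrightarrow> r p > 0"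
      "\<And>p w \<eta>. p \<in> frontier \<Omega> \<Longrightarrow> w \<in> X_space \<Omega> \<Longrightarrow> \<eta> \<in> test_functions (ball p (r p)) \<Longrightarrow>
        (\<lambda>x. \<eta> x * w x) \<in> test_closure \<Omega>"
    unfolding bchoice_iff by blast
  \<comment> \<open>Half radii leave room for a cutoff that is 1 on the small ball and supported in
    the large one.\<close>
  have cover: "frontier \<Omega> \<subseteq> (\<Union>p\<in>frontier \<Omega>. ball p (r p / 2))"
  proof
    fix p assume "p \<in> frontier \<Omega>"
    then show "p \<in> (\<Union>p\<in>frontier \<Omega>. ball p (r p / 2))"
      using r(1)[of p] by (intro UN_I[of p]) auto
  qed
  obtain P where P: "P \<subseteq> frontier \<Omega>" "finite P" "frontier \<Omega> \<subseteq> (\<Union>p\<in>P. ball p (r p / 2))"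
    using compactE_image[OF compact_frontier_bounded[OF \<Omega>(2)] open_ball cover] by blast
  \<comment> \<open>The invariant reduces \<open>w\<close> to a remainder \<open>v\<close> that
    vanishes on the balls treated so far. Passing from \<open>v\<close> to
    \<open>v - \<eta> v\<close> keeps the zeros already obtained, adds those on the next ball, and
    changes \<open>v\<close> by an element of the closure.\<close>
  have "\<exists>v\<in>X_space \<Omega>. (AE x in lebesgue. x \<in> (\<Union>p\<in>Q. ball p (r p / 2)) \<longrightarrow> v x = 0) \<and>
      (v \<in> test_closure \<Omega> \<longrightarrow> w \<in> test_closure \<Omega>)" if "finite Q" "Q \<subseteq> frontier \<Omega>" for Q
    using that
  proof (induction Q rule: finite_induct)
    case empty
    then show ?case using w by auto
  next
    case (insert p Q)
    then obtain v where v: "v \<in> X_space \<Omega>" "AE x in lebesgue. x \<in> (\<Union>p\<in>Q. ball p (r p / 2)) \<longrightarrow> v x = 0"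
      "v \<in> test_closure \<Omega> \<Longrightarrow> w \<in> test_closure \<Omega>"
      by auto
    have p: "p \<in> frontier \<Omega>" using insert.prems by simp
    have "cball p (r p / 2) \<subseteq> ball p (r p)" using r(1)[OF p] by auto
    then obtain \<eta> where \<eta>: "\<eta> \<in> test_functions (ball p (r p))" "\<And>x. x \<in> cball p (r p / 2) \<Longrightarrow> \<eta> x = 1"
      by (rule smooth_cutoff[OF compact_cball open_ball]) blast
    have \<eta>v: "(\<lambda>x. \<eta> x * v x) \<in> test_closure \<Omega>" by (rule r(2)[OF p v(1) \<eta>(1)])
    show ?case
    proof (intro bexI[of _ "\<lambda>x. v x - \<eta> x * v x"] conjI impI)
      show "(\<lambda>x. v x - \<eta> x * v x) \<in> X_space \<Omega>"
        by (rule X_space_diff[OF v(1) X_space_mult[OF v(1) \<eta>(1)]])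
      show "AE x in lebesgue. x \<in> (\<Union>p\<in>insert p Q. ball p (r p / 2)) \<longrightarrow> v x - \<eta> x * v x = 0"
        using v(2) by eventually_elim (use \<eta>(2) in auto)
      assume "(\<lambda>x. v x - \<eta> x * v x) \<in> test_closure \<Omega>"
      from test_closure_add[OF this \<eta>v] show "w \<in> test_closure \<Omega>" using v(3) by simp
    qed
  qed
  from this[OF P(2,1)] obtain v where v: "v \<in> X_space \<Omega>"
    "AE x in lebesgue. x \<in> (\<Union>p\<in>P. ball p (r p / 2)) \<longrightarrow> v x = 0"
    "v \<in> test_closure \<Omega> \<Longrightarrow> w \<in> test_closure \<Omega>"
    by blast
  \<comment> \<open>The small balls cover the boundary, so the remainder lives on a compact subset
    of \<Omega> and the zero shift suffices.\<close>
  define S where "S = closure \<Omega> - (\<Union>p\<in>P. ball p (r p / 2))"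
  have "v \<in> test_closure \<Omega>"
  proof (rule shifted_support_in_test_closure[where S = S])
    show "v \<in> H1" by (rule X_space_D(1)[OF v(1)])
    show "compact S" unfolding S_def using \<Omega>(2) by (intro compact_diff) auto
    show "AE x in lebesgue. x \<notin> S \<longrightarrow> v x = 0"
      using v(2) X_space_D(2)[OF v(1)] by eventually_elim (use closure_subset in \<open>auto simp: S_def\<close>)
    have "S \<subseteq> \<Omega>"
      using P(3) \<Omega>(1) by (auto simp: S_def frontier_def interior_open)
    then show "\<exists>z. norm z < \<delta> \<and> (\<forall>x\<in>S. x + z \<in> \<Omega>)" if "\<delta> > 0" for \<delta>
      using that by (intro exI[of _ 0]) auto
  qed fact
  then show ?thesis by (rule v(3))
qed

subsection \<open>Weak solutions\<close>

lemma L2_lebesgue_on: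
  fixes u :: "'a::euclidean_space \<Rightarrow> 'b::euclidean_space"
  assumes u: "u \<in> L2 lebesgue" and \<Omega>: "\<Omega> \<in> sets lebesgue"
  shows "u \<in> L2 (lebesgue_on \<Omega>)" "L2_norm (lebesgue_on \<Omega>) u \<le> L2_norm lebesgue u"
proof -
  have int: "integrable lebesgue (\<lambda>x. indicator \<Omega> x *\<^sub>R (norm (u x))\<^sup>2)"
    by (intro integrable_mult_indicator \<Omega> L2_integrable_square u)
  then have "integrable (lebesgue_on \<Omega>) (\<lambda>x. (norm (u x))\<^sup>2)"
    using \<Omega> by (subst integrable_restrict_space) auto
  moreover have "u \<in> borel_measurable (lebesgue_on \<Omega>)"
    by (intro measurable_restrict_space1 L2_measurable u)
  ultimately show "u \<in> L2 (lebesgue_on \<Omega>)" by (simp add: L2_def)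
  have "(\<integral>x. (norm (u x))\<^sup>2 \<partial>lebesgue_on \<Omega>) = (\<integral>x. indicator \<Omega> x *\<^sub>R (norm (u x))\<^sup>2 \<partial>lebesgue)"
    using \<Omega> by (subst integral_restrict_space) auto
  also have "\<dots> \<le> (\<integral>x. (norm (u x))\<^sup>2 \<partial>lebesgue)"
    by (intro integral_mono int L2_integrable_square u) (auto simp: indicator_def)
  finally show "L2_norm (lebesgue_on \<Omega>) u \<le> L2_norm lebesgue u"
    unfolding L2_norm_def by (rule real_sqrt_le_mono)
qed

text \<open>The gradient of \<phi> vanishes outside \<Omega>, so the local integral extends to the
  whole space; classical and weak gradient of \<phi> agree almost everywhere.\<close>

lemma weak_form_eq_energy:
  fixes u :: "real^'n::finite \<Rightarrow> real"
  assumes u: "u \<in> H1" and \<phi>: "\<phi> \<in> test_functions \<Omega>" and \<Omega>: "open \<Omega>"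
  shows "weak_form s \<Omega> u \<phi> = energy s u \<phi>"
proof -
  obtain K where K: "compact K" "K \<subseteq> \<Omega>" "\<And>x. x \<notin> K \<Longrightarrow> \<phi> x = 0"
    using \<phi> by (rule test_functionsE) blast
  have "gradient \<phi> x = 0" if "x \<notin> \<Omega>" for x
    using gradient_eq_0_outside[of K \<phi> x] compact_imp_closed[OF K(1)] K(2,3) that by blast
  then have eq: "indicator \<Omega> x *\<^sub>R (weak_gradient u x \<bullet> gradient \<phi> x) = weak_gradient u x \<bullet> gradient \<phi> x" for x
    by (cases "x \<in> \<Omega>") auto
  have "(\<integral>x. weak_gradient u x \<bullet> gradient \<phi> x \<partial>lebesgue_on \<Omega>) = (\<integral>x. weak_gradient u x \<bullet> gradient \<phi> x \<partial>lebesgue)"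
    using \<Omega> by (subst integral_restrict_space) (simp_all only: eq, auto)
  also have "\<dots> = L2_inner lebesgue (weak_gradient u) (weak_gradient \<phi>)"
    unfolding L2_inner_def
  proof (rule integral_cong_AE)
    show "(\<lambda>x. weak_gradient u x \<bullet> gradient \<phi> x) \<in> borel_measurable lebesgue"
      "(\<lambda>x. weak_gradient u x \<bullet> weak_gradient \<phi> x) \<in> borel_measurable lebesgue"
      by (intro borel_measurable_inner L2_measurable H1_D u test_gradient_L2[OF \<phi>] test_H1[OF \<phi>])+
    show "AE x in lebesgue. weak_gradient u x \<bullet> gradient \<phi> x = weak_gradient u x \<bullet> weak_gradient \<phi> x"
      using weak_gradient_AE_eq(1)[OF has_weak_gradient_test[OF \<phi>]] by eventually_elim simp
  qed
  finally show ?thesis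
    unfolding weak_form_def energy_def L2_inner_def
    by (simp add: case_prod_beta' Gagliardo_quotient_mult[of s u "fst z" "snd z" for z, simplified])
qed

lemma Poincare_bounded:
  fixes \<Omega> :: "(real^'n::finite) set"
  assumes "bounded \<Omega>"
  obtains C where "C > 0" "\<And>u. u \<in> X_space \<Omega> \<Longrightarrow> L2_norm lebesgue u \<le> C * L2_norm lebesgue (weak_gradient u)"
proof -
  obtain R where R: "R > 0" "\<And>x. x \<in> \<Omega> \<Longrightarrow> norm x \<le> R"
    using assms unfolding bounded_pos by auto
  show thesis
  proof (rule that)
    show "3 * R > 0" using R by simp
    fix u assume u: "u \<in> X_space \<Omega>"
    have "AE x in lebesgue. norm x > R \<longrightarrow> u x = 0"
      using X_space_D(2)[OF u] by eventually_elim (use R(2) in fastforce)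
    then show "L2_norm lebesgue u \<le> 3 * R * L2_norm lebesgue (weak_gradient u)"
      by (intro Poincare X_space_D(1)[OF u] R(1))
  qed
qed

lemma semi_inner_space_energy_X:
  assumes s: "0 < s" "s < 1"
  shows "semi_inner_space (X_space \<Omega>) (energy s :: (real^'n::finite \<Rightarrow> real) \<Rightarrow> _)"
proof -
  interpret E: semi_inner_space H1 "energy s :: (real^'n \<Rightarrow> real) \<Rightarrow> _"
    by (rule semi_inner_space_energy[OF s])
  show ?thesis
  proof
    show "(\<lambda>_. 0) \<in> X_space \<Omega>" by (rule test_X_space[OF test_zero])
    show "(\<lambda>x. u x + c *\<^sub>R v x) \<in> X_space \<Omega>" if "u \<in> X_space \<Omega>" "v \<in> X_space \<Omega>" for u v c
      by (rule X_space_add_scaleR[OF that])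
  qed (simp_all only: E.form_add_scaleR E.form_sym E.form_nonneg X_space_D(1))
qed

text \<open>Coercivity makes an energy-Cauchy sequence Cauchy in \<open>L2\<close> together with its
  gradients. The gradient limit is the weak gradient of the function limit, since the defining
  identity passes to \<open>L2\<close> limits; the upper energy bound then returns convergence in
  energy.\<close>

lemma energy_complete:
  fixes \<Omega> :: "(real^'n::finite) set"
  assumes s: "0 < s" "s < 1" and \<Omega>: "bounded \<Omega>" "open \<Omega>"
  shows "semi_inner_space.complete_form (X_space \<Omega>) (energy s)"
proof -
  interpret E: semi_inner_space "X_space \<Omega>" "energy s"
    by (rule semi_inner_space_energy_X[OF s])
  let ?N = "L2_norm lebesgue"
  obtain P where P: "P > 0" "\<And>u. u \<in> X_space \<Omega> \<Longrightarrow> ?N u \<le> P * ?N (weak_gradient u)"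
    using Poincare_bounded[OF \<Omega>(1)] by blast
  obtain C where C: "C > 0" "\<And>u :: real^'n \<Rightarrow> real. u \<in> H1 \<Longrightarrow> energy s u u \<le> C * (H1_norm u)\<^sup>2"
    "\<And>u :: real^'n \<Rightarrow> real. u \<in> H1 \<Longrightarrow> (?N (weak_gradient u))\<^sup>2 \<le> energy s u u"
    using energy_bounds[OF s, where 'n = 'n] by metis
  show ?thesis
    unfolding E.complete_form_def
  proof (intro allI impI)
    fix X :: "nat \<Rightarrow> real^'n \<Rightarrow> real"
    let ?E = "\<lambda>m n. diag (energy s) (\<lambda>x. X m x - X n x)"
    let ?dG = "\<lambda>m n x. weak_gradient (X m) x - weak_gradient (X n) x"
    assume X: "\<forall>n. X n \<in> X_space \<Omega>"
      and Cauchy: "\<forall>e>0. \<exists>M. \<forall>m\<ge>M. \<forall>n\<ge>M. ?E m n < e"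
    have XX: "X n \<in> X_space \<Omega>" for n using X by simp
    note XH = X_space_D(1)[OF XX]
    have gdiff: "?N (\<lambda>x. weak_gradient u x - weak_gradient v x) = ?N (weak_gradient (\<lambda>x. u x - v x))"
      if "u \<in> H1" "v \<in> H1" for u v :: "real^'n \<Rightarrow> real"
    proof (rule L2_norm_cong_AE)
      show "AE x in lebesgue. weak_gradient u x - weak_gradient v x = weak_gradient (\<lambda>x. u x - v x) x"
        using H1_diff(2)[OF that] by eventually_elim simp
    qed (intro L2_measurable L2.diff_mem H1_D H1_diff that)+
    have g_le: "(?N (?dG m n))\<^sup>2 \<le> ?E m n" for m n
      unfolding gdiff[OF XH XH] by (intro C(3) H1_diff XH)
    have u_le: "(?N (\<lambda>x. X m x - X n x))\<^sup>2 \<le> P\<^sup>2 * ?E m n" for m n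
    proof -
      have "?N (\<lambda>x. X m x - X n x) \<le> P * ?N (?dG m n)"
        unfolding gdiff[OF XH XH] by (intro P(2) X_space_diff XX)
      then have "(?N (\<lambda>x. X m x - X n x))\<^sup>2 \<le> (P * ?N (?dG m n))\<^sup>2"
        by (rule power_mono) simp
      also have "\<dots> \<le> P\<^sup>2 * ?E m n"
        unfolding power_mult_distrib by (intro mult_left_mono g_le) simp
      finally show ?thesis .
    qed
    have sq: "L2_inner lebesgue f f = (?N f)\<^sup>2" if "f \<in> L2 lebesgue" for f :: "real^'n \<Rightarrow> 'b::euclidean_space"
      using that by (simp add: L2_norm_eq_inner L2.form_nonneg)
    have "\<exists>u\<in>L2 lebesgue. (\<lambda>n. diag (L2_inner lebesgue) (\<lambda>x. X n x - u x)) \<longlonglongrightarrow> 0"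
    proof (rule L2_complete[unfolded L2.complete_form_def, rule_format])
      show "X n \<in> L2 lebesgue" for n by (rule H1_D(1)[OF XH])
      fix e :: real assume "e > 0"
      then have "e / P\<^sup>2 > 0" using P(1) by simp
      then obtain M where M: "\<forall>m\<ge>M. \<forall>n\<ge>M. ?E m n < e / P\<^sup>2"
        using Cauchy by blast
      have "diag (L2_inner lebesgue) (\<lambda>x. X m x - X n x) < e" if "m \<ge> M" "n \<ge> M" for m n
      proof -
        have "P\<^sup>2 * ?E m n < e"
          using M that P(1) by (simp add: field_simps)
        then show ?thesis using u_le[of m n] by (simp add: sq L2.diff_mem H1_D(1)[OF XH])
      qed
      then show "\<exists>M. \<forall>m\<ge>M. \<forall>n\<ge>M. diag (L2_inner lebesgue) (\<lambda>x. X m x - X n x) < e" by blast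
    qed
    then obtain u where u: "u \<in> L2 lebesgue"
      and u_lim: "(\<lambda>n. diag (L2_inner lebesgue) (\<lambda>x. X n x - u x)) \<longlonglongrightarrow> 0" by blast
    have "\<exists>g\<in>L2 lebesgue. (\<lambda>n. diag (L2_inner lebesgue) (\<lambda>x. weak_gradient (X n) x - g x)) \<longlonglongrightarrow> 0"
    proof (rule L2_complete[unfolded L2.complete_form_def, rule_format])
      show "weak_gradient (X n) \<in> L2 lebesgue" for n by (rule H1_D(3)[OF XH])
      fix e :: real assume "e > 0"
      then obtain M where M: "\<forall>m\<ge>M. \<forall>n\<ge>M. ?E m n < e"
        using Cauchy by blast
      have "diag (L2_inner lebesgue) (?dG m n) < e" if "m \<ge> M" "n \<ge> M" for m n
        using g_le[of m n] M that by (auto simp: sq L2.diff_mem H1_D(3)[OF XH] intro: le_less_trans)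
      then show "\<exists>M. \<forall>m\<ge>M. \<forall>n\<ge>M. diag (L2_inner lebesgue) (?dG m n) < e" by blast
    qed
    then obtain g where g: "g \<in> L2 lebesgue"
      and g_lim: "(\<lambda>n. diag (L2_inner lebesgue) (\<lambda>x. weak_gradient (X n) x - g x)) \<longlonglongrightarrow> 0" by blast
    let ?du = "\<lambda>n x. X n x - u x" and ?dg = "\<lambda>n x. weak_gradient (X n) x - g x"
    have lim_inner: "(\<lambda>n. L2_inner lebesgue (Y n) \<psi>) \<longlonglongrightarrow> L2_inner lebesgue y \<psi>"
      if Y: "\<And>n. Y n \<in> L2 lebesgue" "y \<in> L2 lebesgue" "\<psi> \<in> L2 lebesgue"
        "(\<lambda>n. (?N (\<lambda>x. Y n x - y x))\<^sup>2) \<longlonglongrightarrow> 0" for Y and y \<psi> :: "real^'n \<Rightarrow> real"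
    proof (rule Lim_null[THEN iffD2], rule Lim_null_comparison)
      show "(\<lambda>n. sqrt ((?N (\<lambda>x. Y n x - y x))\<^sup>2) * ?N \<psi>) \<longlonglongrightarrow> 0"
        using tendsto_mult_right[OF tendsto_real_sqrt[OF Y(4)], of "?N \<psi>"] by simp
      have "norm (L2_inner lebesgue (Y n) \<psi> - L2_inner lebesgue y \<psi>) \<le> sqrt ((?N (\<lambda>x. Y n x - y x))\<^sup>2) * ?N \<psi>" for n
        using L2.Cauchy_Schwarz[OF L2.diff_mem[OF Y(1,2)] Y(3), of n] L2.form_diff[OF Y(1,2,3), of n]
          L2.form_nonneg[OF L2.diff_mem[OF Y(1,2)], of n]
        by (simp add: L2_norm_eq_inner)
      then show "\<forall>\<^sub>F n in sequentially. norm (L2_inner lebesgue (Y n) \<psi> - L2_inner lebesgue y \<psi>)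
          \<le> sqrt ((?N (\<lambda>x. Y n x - y x))\<^sup>2) * ?N \<psi>" by simp
    qed
    have u_lim': "(\<lambda>n. (?N (?du n))\<^sup>2) \<longlonglongrightarrow> 0"
      using u_lim by (simp add: sq L2.diff_mem H1_D(1)[OF XH] u)
    have gL: "(?dg n) \<in> L2 lebesgue" for n
      by (intro L2.diff_mem H1_D(3)[OF XH] g)
    have g_lim': "(\<lambda>n. (?N (?dg n))\<^sup>2) \<longlonglongrightarrow> 0"
      using g_lim by (simp add: sq gL)
    have wg: "has_weak_gradient u g"
    proof (rule L2_weak_gradientI[OF u g])
      fix \<phi> :: "real^'n \<Rightarrow> real" and i assume \<phi>: "\<phi> \<in> tests"
      have "(\<lambda>n. L2_inner lebesgue (X n) (pderivative i \<phi>)) \<longlonglongrightarrow> L2_inner lebesgue u (pderivative i \<phi>)"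
        by (rule lim_inner[OF H1_D(1)[OF XH] u test_L2[OF test_pderivative[OF \<phi>]] u_lim'])
      moreover have "(\<lambda>n. L2_inner lebesgue (\<lambda>x. weak_gradient (X n) x $ i) \<phi>) \<longlonglongrightarrow> L2_inner lebesgue (\<lambda>x. g x $ i) \<phi>"
      proof (rule lim_inner[OF L2_component[OF H1_D(3)[OF XH]] L2_component[OF g] test_L2[OF \<phi>]])
        have "(?N (\<lambda>x. weak_gradient (X n) x $ i - g x $ i))\<^sup>2 \<le> (?N (?dg n))\<^sup>2" for n
          unfolding L2_norm_vec[OF gL] vector_minus_component[symmetric]
          by (rule member_le_sum) auto
        then show "(\<lambda>n. (?N (\<lambda>x. weak_gradient (X n) x $ i - g x $ i))\<^sup>2) \<longlonglongrightarrow> 0"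
          by (intro tendsto_sandwich[OF _ _ tendsto_const g_lim']) auto
      qed
      moreover have "L2_inner lebesgue (X n) (pderivative i \<phi>) = - L2_inner lebesgue (\<lambda>x. weak_gradient (X n) x $ i) \<phi>" for n
        using weak_gradient_eqD[OF H1_D(2)[OF XH] \<phi>, of n i] by (simp add: L2_inner_def)
      ultimately have "L2_inner lebesgue u (pderivative i \<phi>) = - L2_inner lebesgue (\<lambda>x. g x $ i) \<phi>"
        by (intro LIMSEQ_unique[of "\<lambda>n. L2_inner lebesgue (X n) (pderivative i \<phi>)"]) (auto intro: tendsto_minus)
      then show "(\<integral>x. u x * pderivative i \<phi> x \<partial>lebesgue) = - (\<integral>x. g x $ i * \<phi> x \<partial>lebesgue)"
        by (simp add: L2_inner_def)
    qed
    have uH: "u \<in> H1" by (rule H1_I[OF u g wg])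
    have uX: "u \<in> X_space \<Omega>"
    proof -
      \<comment> \<open>Outside \<Omega> each \<open>X n\<close> is 0 almost everywhere, so
        \<open>|v|\<close> is at most \<open>|X n - u|\<close>; letting \<open>n\<close> grow forces
        \<open>v\<close> to have norm 0.\<close>
      define v where "v x = indicator (- \<Omega>) x * u x" for x
      have \<Omega>m: "- \<Omega> \<in> sets lebesgue" using \<Omega>(2) by auto
      have v_int: "integrable lebesgue (\<lambda>x. (v x)\<^sup>2)"
        using integrable_mult_indicator[OF \<Omega>m L2_integrable_square[OF u]]
        by (rule back_subst[of "integrable lebesgue"]) (auto simp: v_def indicator_def)
      have "(\<integral>x. (v x)\<^sup>2 \<partial>lebesgue) \<le> (?N (?du n))\<^sup>2" for n
        unfolding L2_norm_square
      proof (rule integral_mono_AE[OF v_int L2_integrable_square[OF L2.diff_mem[OF H1_D(1)[OF XH] u]]])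
        show "AE x in lebesgue. (v x)\<^sup>2 \<le> (norm (X n x - u x))\<^sup>2"
          using X_space_D(2)[OF XX, of n] by eventually_elim (auto simp: v_def indicator_def)
      qed
      then have "(\<integral>x. (v x)\<^sup>2 \<partial>lebesgue) \<le> 0"
        by (intro LIMSEQ_le_const[OF u_lim']) auto
      then have "(\<integral>x. (v x)\<^sup>2 \<partial>lebesgue) = 0"
        by (intro antisym integral_nonneg_AE) auto
      then have "AE x in lebesgue. (v x)\<^sup>2 = 0"
        by (subst integral_nonneg_eq_0_iff_AE[symmetric]) (use v_int in auto)
      then have "AE x in lebesgue. x \<notin> \<Omega> \<longrightarrow> u x = 0"
        by eventually_elim (auto simp: v_def indicator_def)
      then show ?thesis using uH by (simp add: X_space_def)
    qed
    have bound: "diag (energy s) (?du n)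
        \<le> C * ((?N (?du n))\<^sup>2 + (?N (?dg n))\<^sup>2)" for n
    proof -
      have "?N (weak_gradient (?du n)) = ?N (?dg n)"
      proof (rule L2_norm_cong_AE)
        show "AE x in lebesgue. weak_gradient (?du n) x = weak_gradient (X n) x - g x"
          using H1_diff(2)[OF XH uH, of n] weak_gradient_AE_eq(1)[OF wg] by eventually_elim simp
      qed (intro L2_measurable gL H1_D H1_diff XH uH)+
      then show ?thesis using C(2)[OF H1_diff(1)[OF XH uH], of n] by (simp add: H1_norm_square)
    qed
    have "(\<lambda>n. C * ((?N (?du n))\<^sup>2 + (?N (?dg n))\<^sup>2)) \<longlonglongrightarrow> C * (0 + 0)"
      by (intro tendsto_intros u_lim' g_lim')
    then have bound_lim: "(\<lambda>n. C * ((?N (?du n))\<^sup>2 + (?N (?dg n))\<^sup>2)) \<longlonglongrightarrow> 0"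
      by simp
    have "\<forall>\<^sub>F n in sequentially. norm (diag (energy s) (?du n))
        \<le> C * ((?N (?du n))\<^sup>2 + (?N (?dg n))\<^sup>2)"
      using bound by (intro always_eventually allI) (simp add: E.form_nonneg[OF X_space_diff[OF XX uX]])
    then have "(\<lambda>n. diag (energy s) (?du n)) \<longlonglongrightarrow> 0"
      using bound_lim by (rule Lim_null_comparison)
    then show "\<exists>u\<in>X_space \<Omega>. (\<lambda>n. diag (energy s) (\<lambda>x. X n x - u x)) \<longlonglongrightarrow> 0"
      using uX by blast
  qed
qed

text \<open>Both sides of the weak equation are continuous in the \<open>H1\<close> norm of the test
  argument, so density extends it to all of \<open>X_space\<close>. A solution, or a difference of
  two, can then be inserted as its own test function.\<close>

lemma weak_solution_iff:
  fixes u :: "real^'n::finite \<Rightarrow> real"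
  assumes s: "0 < s" "s < 1" and \<Omega>: "open \<Omega>" "bounded \<Omega>" "C1_boundary \<Omega>"
    and f: "f \<in> L2 (lebesgue_on \<Omega>)"
  shows "weak_solution s \<Omega> f u \<longleftrightarrow>
    u \<in> X_space \<Omega> \<and> (\<forall>v\<in>X_space \<Omega>. energy s u v = L2_inner (lebesgue_on \<Omega>) f v)" (is "_ \<longleftrightarrow> ?R")
proof
  assume R: ?R
  then have u: "u \<in> X_space \<Omega>" by blast
  have "weak_form s \<Omega> u \<phi> = (\<integral>x. f x * \<phi> x \<partial>lebesgue_on \<Omega>)" if \<phi>: "\<phi> \<in> test_functions \<Omega>" for \<phi>
    using weak_form_eq_energy[OF X_space_D(1)[OF u] \<phi> \<Omega>(1), of s] R test_X_space[OF \<phi>]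
    by (simp add: L2_inner_def)
  then show "weak_solution s \<Omega> f u"
    using u X_space_D(1)[OF u] by (simp add: weak_solution_def weak_solution_eq_def)
next
  interpret E: semi_inner_space "X_space \<Omega>" "energy s"
    by (rule semi_inner_space_energy_X[OF s])
  let ?l = "L2_inner (lebesgue_on \<Omega>) f"
  let ?F = "L2_norm (lebesgue_on \<Omega>) f"
  assume ws: "weak_solution s \<Omega> f u"
  then have u: "u \<in> X_space \<Omega>" by (simp add: weak_solution_def)
  have \<Omega>m: "\<Omega> \<in> sets lebesgue" using \<Omega>(1) by auto
  have test: "energy s u \<phi> = ?l \<phi>" if "\<phi> \<in> test_functions \<Omega>" for \<phi>
    using ws that weak_form_eq_energy[OF X_space_D(1)[OF u] that \<Omega>(1), of s]
    by (auto simp: weak_solution_def weak_solution_eq_def L2_inner_def)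
  obtain C where C: "C > 0" "\<And>u :: real^'n \<Rightarrow> real. u \<in> H1 \<Longrightarrow> energy s u u \<le> C * (H1_norm u)\<^sup>2"
    using energy_bounds[OF s, where 'n = 'n] by metis
  \<comment> \<open>A bound for the norm of the defect functional \<open>energy s u v - ?l v\<close>
    on \<open>H1\<close>. It may be 0, hence the later division by \<open>A + 1\<close>.\<close>
  define A where "A = sqrt (energy s u u) * sqrt C + ?F"
  have A: "A \<ge> 0" using C(1) E.form_nonneg[OF u] by (simp add: A_def)
  have "energy s u v = ?l v" if v: "v \<in> X_space \<Omega>" for v
  proof -
    have "\<bar>energy s u v - ?l v\<bar> \<le> 0 + e" if e: "e > 0" for e
    proof -
      have "e / (A + 1) > 0" using e A by simp
      then obtain \<phi> where \<phi>: "\<phi> \<in> test_functions \<Omega>" "H1_norm (\<lambda>x. v x - \<phi> x) < e / (A + 1)"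
        using test_closureD[OF X_space_subset_test_closure[OF \<Omega> v]] by blast
      note \<phi>X = test_X_space[OF \<phi>(1)]
      define d where "d x = v x - \<phi> x" for x
      have d: "d \<in> X_space \<Omega>" unfolding d_def by (rule X_space_diff[OF v \<phi>X])
      note L2\<Omega> = L2_lebesgue_on(1)[OF H1_D(1)[OF X_space_D(1)] \<Omega>m]
      have "energy s u v = energy s u \<phi> + energy s u d"
        unfolding d_def using E.form_diff[OF v \<phi>X u] E.form_sym u v \<phi>X d[unfolded d_def] by simp
      moreover have "?l v = ?l \<phi> + ?l d"
        unfolding d_def using L2.form_diff[OF L2\<Omega>[OF v] L2\<Omega>[OF \<phi>X] f]
          L2.form_sym[OF f L2\<Omega>[OF v]] L2.form_sym[OF f L2\<Omega>[OF \<phi>X]] L2.form_sym[OF f L2\<Omega>[OF d[unfolded d_def]]]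
        by simp
      ultimately have "\<bar>energy s u v - ?l v\<bar> \<le> \<bar>energy s u d\<bar> + \<bar>?l d\<bar>" using test[OF \<phi>(1)] by simp
      also have "\<bar>energy s u d\<bar> \<le> sqrt (energy s u u) * sqrt (energy s d d)"
        by (rule E.Cauchy_Schwarz[OF u d])
      also have "sqrt (energy s d d) \<le> sqrt (C * (H1_norm d)\<^sup>2)"
        by (intro real_sqrt_le_mono C(2) X_space_D(1)[OF d])
      also have "\<dots> = sqrt C * H1_norm d" by (simp add: real_sqrt_mult H1_norm_nonneg)
      also have "\<bar>?l d\<bar> \<le> ?F * L2_norm (lebesgue_on \<Omega>) d"
        unfolding L2_norm_eq_inner by (rule L2.Cauchy_Schwarz[OF f L2\<Omega>[OF d]])
      also have "L2_norm (lebesgue_on \<Omega>) d \<le> L2_norm lebesgue d"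
        by (rule L2_lebesgue_on(2)[OF H1_D(1)[OF X_space_D(1)[OF d]] \<Omega>m])
      also have "L2_norm lebesgue d \<le> H1_norm d"
        unfolding H1_norm_def by (rule real_le_rsqrt) simp
      finally have "\<bar>energy s u v - ?l v\<bar> \<le> A * H1_norm d"
        using E.form_nonneg[OF u] by (simp add: A_def distrib_right mult.assoc mult_left_mono)
      also have "\<dots> \<le> A * (e / (A + 1))" using \<phi>(2) A unfolding d_def by (intro mult_left_mono) auto
      also have "\<dots> \<le> e" using A e by (simp add: field_simps)
      finally show ?thesis by simp
    qed
    then have "\<bar>energy s u v - ?l v\<bar> \<le> 0" by (rule field_le_epsilon)
    then show ?thesis by simp
  qed
  then show ?R using u by blast
qed

text \<open>Uniqueness means equality almost everywhere because \<open>H1\<close> consists of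
  functions. The estimate ranges over every weak solution, so it does not depend on a chosen
  representative.\<close>

theorem theorem1p1:
  fixes \<Omega> :: "(real^'n::finite) set" and s :: real
  assumes "open \<Omega>" and "bounded \<Omega>" and "C1_boundary \<Omega>"
    and "0 < s" and "s < 1"
  shows "(\<forall>f \<in> L2 (lebesgue_on \<Omega>). \<exists>u. weak_solution s \<Omega> f u \<and>
            (\<forall>v. weak_solution s \<Omega> f v \<longrightarrow> (AE x in lebesgue. v x = u x))) \<and>
         (\<exists>c>0. \<forall>f \<in> L2 (lebesgue_on \<Omega>). \<forall>u. weak_solution s \<Omega> f u \<longrightarrow>
            H1_norm u \<le> c * L2_norm (lebesgue_on \<Omega>) f)"
proof -
  interpret E: semi_inner_space "X_space \<Omega>" "energy s"
    by (rule semi_inner_space_energy_X[OF assms(4,5)])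
  let ?N = "L2_norm lebesgue"
  obtain P where P: "P > 0" "\<And>u. u \<in> X_space \<Omega> \<Longrightarrow> ?N u \<le> P * ?N (weak_gradient u)"
    using Poincare_bounded[OF assms(2)] by blast
  obtain coercive: "\<And>u :: real^'n \<Rightarrow> real. u \<in> H1 \<Longrightarrow> (?N (weak_gradient u))\<^sup>2 \<le> energy s u u"
    using energy_bounds[OF assms(4,5), where 'n = 'n] by metis
  have \<Omega>m: "\<Omega> \<in> sets lebesgue" using assms(1) by auto
  note L2\<Omega> = L2_lebesgue_on[OF H1_D(1)[OF X_space_D(1)] \<Omega>m]
  note iff = weak_solution_iff[OF assms(4,5,1,2,3)]
  have l_le: "\<bar>L2_inner (lebesgue_on \<Omega>) f v\<bar> \<le> L2_norm (lebesgue_on \<Omega>) f * (P * ?N (weak_gradient v))"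
    if f: "f \<in> L2 (lebesgue_on \<Omega>)" and v: "v \<in> X_space \<Omega>" for f v
  proof -
    have "\<bar>L2_inner (lebesgue_on \<Omega>) f v\<bar> \<le> L2_norm (lebesgue_on \<Omega>) f * L2_norm (lebesgue_on \<Omega>) v"
      unfolding L2_norm_eq_inner by (rule L2.Cauchy_Schwarz[OF f L2\<Omega>(1)[OF v]])
    also have "\<dots> \<le> L2_norm (lebesgue_on \<Omega>) f * (P * ?N (weak_gradient v))"
      using L2\<Omega>(2)[OF v] P(2)[OF v] by (intro mult_left_mono) auto
    finally show ?thesis .
  qed
  have existence: "\<exists>u. weak_solution s \<Omega> f u" if f: "f \<in> L2 (lebesgue_on \<Omega>)" for f
  proof -
    \<comment> \<open>The subspace in the Riesz argument is \<open>X_space\<close> itself. Poincare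
      followed by coercivity bounds the functional by \<open>P\<close> times the norm of
      \<open>f\<close>.\<close>
    obtain u where "u \<in> X_space \<Omega>" "\<And>v. v \<in> X_space \<Omega> \<Longrightarrow> energy s u v = L2_inner (lebesgue_on \<Omega>) f v"
    proof (rule E.Riesz_subspace[OF energy_complete[OF assms(4,5,2,1)] subset_refl E.zero_mem E.add_scaleR_mem,
          where l = "L2_inner (lebesgue_on \<Omega>) f" and C = "L2_norm (lebesgue_on \<Omega>) f * P"])
      show "L2_inner (lebesgue_on \<Omega>) f (\<lambda>x. u x + c *\<^sub>R v x) =
          L2_inner (lebesgue_on \<Omega>) f u + c * L2_inner (lebesgue_on \<Omega>) f v"
        if "u \<in> X_space \<Omega>" "v \<in> X_space \<Omega>" for u v c
        using L2.form_add_scaleR[OF L2\<Omega>(1)[OF that(1)] L2\<Omega>(1)[OF that(2)] f, of c]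
          L2.form_sym[OF f L2\<Omega>(1)[OF that(1)]] L2.form_sym[OF f L2\<Omega>(1)[OF that(2)]]
          L2.form_sym[OF f L2.add_scaleR_mem[OF L2\<Omega>(1)[OF that(1)] L2\<Omega>(1)[OF that(2)], of c]] by simp
      show "\<bar>L2_inner (lebesgue_on \<Omega>) f u\<bar> \<le> L2_norm (lebesgue_on \<Omega>) f * P * sqrt (energy s u u)"
        if u: "u \<in> X_space \<Omega>" for u
      proof -
        have "?N (weak_gradient u) \<le> sqrt (energy s u u)"
          by (rule real_le_rsqrt[OF coercive[OF X_space_D(1)[OF u]]])
        then have "L2_norm (lebesgue_on \<Omega>) f * (P * ?N (weak_gradient u)) \<le> L2_norm (lebesgue_on \<Omega>) f * (P * sqrt (energy s u u))"
          using P(1) by (intro mult_left_mono) auto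
        then show ?thesis using l_le[OF f u] by (simp add: mult.assoc)
      qed
    qed auto
    then show ?thesis using iff[OF f] by blast
  qed
  \<comment> \<open>The difference of two solutions has zero energy when tested with itself, so its
    gradient has norm 0, and Poincare removes the function.\<close>
  have uniqueness: "AE x in lebesgue. v x = u x"
    if f: "f \<in> L2 (lebesgue_on \<Omega>)" and u: "weak_solution s \<Omega> f u" and v: "weak_solution s \<Omega> f v" for f u v
  proof -
    have uv: "u \<in> X_space \<Omega>" "v \<in> X_space \<Omega>" using u v iff[OF f] by auto
    define w where "w x = v x - u x" for x
    have w: "w \<in> X_space \<Omega>" unfolding w_def by (rule X_space_diff[OF uv(2,1)])
    have "energy s w w = energy s v w - energy s u w"
      using E.form_diff[OF uv(2,1) w] by (simp add: w_def[abs_def])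
    also have "\<dots> = 0" using u v iff[OF f] w by simp
    finally have "(?N (weak_gradient w))\<^sup>2 \<le> 0" using coercive[OF X_space_D(1)[OF w]] by simp
    then have "?N w \<le> 0" using P(2)[OF w] by simp
    then have "?N w = 0" by (simp add: antisym)
    then have "(\<integral>x. (norm (w x))\<^sup>2 \<partial>lebesgue) = 0" using L2_norm_square[of lebesgue w] by simp
    then have "AE x in lebesgue. (norm (w x))\<^sup>2 = 0"
      by (subst integral_nonneg_eq_0_iff_AE[symmetric])
         (use L2_integrable_square[OF H1_D(1)[OF X_space_D(1)[OF w]]] in auto)
    then show ?thesis by eventually_elim (simp add: w_def)
  qed
  \<comment> \<open>Testing with \<open>u\<close> bounds the gradient norm by \<open>P\<close> times
    the norm of \<open>f\<close>; Poincare costs another factor \<open>P\<close> for the function.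
    The sum of the two bounds is the constant \<open>P * P + P\<close>.\<close>
  have estimate: "H1_norm u \<le> (P * P + P) * L2_norm (lebesgue_on \<Omega>) f"
    if f: "f \<in> L2 (lebesgue_on \<Omega>)" and ws: "weak_solution s \<Omega> f u" for f u
  proof -
    let ?F = "L2_norm (lebesgue_on \<Omega>) f" and ?G = "?N (weak_gradient u)"
    have u: "u \<in> X_space \<Omega>" using ws iff[OF f] by auto
    have "?G * ?G \<le> energy s u u"
      using coercive[OF X_space_D(1)[OF u]] by (simp add: power2_eq_square)
    also have "energy s u u = L2_inner (lebesgue_on \<Omega>) f u" using ws iff[OF f] u by blast
    also have "\<dots> \<le> ?F * P * ?G" using l_le[OF f u] by (simp add: mult.assoc)
    finally have "?G * ?G \<le> (?F * P) * ?G" .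
    \<comment> \<open>Cancelling \<open>?G\<close> requires it to be positive; otherwise the claim
      is trivial.\<close>
    then have G: "?G \<le> ?F * P"
      using L2_norm_nonneg[of lebesgue "weak_gradient u"] P(1) L2_norm_nonneg[of "lebesgue_on \<Omega>" f]
      by (cases "?G = 0") (auto simp: mult_le_cancel_right)
    have "H1_norm u \<le> ?N u + ?G"
      unfolding H1_norm_def by (rule sqrt_sum_squares_le_sum) auto
    also have "?N u \<le> P * ?G" by (rule P(2)[OF u])
    also have "P * ?G + ?G \<le> P * (?F * P) + ?F * P"
      using G P(1) by (intro add_mono mult_left_mono) auto
    finally show ?thesis by (simp add: algebra_simps)
  qed
  have "P * P + P > 0" using P(1) by (simp add: add_pos_pos)
  then show ?thesis using existence uniqueness estimate by blast
qed

end
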